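(* Let $a,b\ge 1$ be integers, and let $H^+$ and $H^-$ be the positive and negative unit pseudospheres of $\mathbb{R}^{(a,b)}$. Let $N^+$ be any neck of $H^+$ and let $N^-$ be any neck of $H^-$, and let $N^\diamond=\overline{N^+ * N^-}$ be their filled join. Then $\mathrm{Vol}\, N^\diamond$ is minimized when $N^+$ and $N^-$ are flat, orthogonal, and centered at the origin. That is, if $P\subset\mathbb{R}^{(a,b)}$ is an $a$-dimensional spacelike linear subspace, $P^\perp$ is its orthogonal complement, $N_0^+=H^+\cap P$ and $N_0^-=H^-\cap P^\perp$, then $$\mathrm{Vol}\, N^\diamond \ \ge\ \mathrm{Vol}\, N_0^\diamond$$ for all necks $N^+$ of $H^+$ and $N^-$ of $H^-$, where $N_0^\diamond=\overline{N_0^+ * N_0^-}$.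
   Context: $\mathbb{R}^{(a,b)}$ is $\mathbb{R}^{a+b}$ with the indefinite inner product $\vec{x}\cdot\vec{y}=\sum_{i=1}^a x_iy_i-\sum_{i=a+1}^{a+b}x_iy_i$; $\mathrm{Vol}$ is Lebesgue measure on $\mathbb{R}^{a+b}$. A non-zero vector $\vec{x}$ is spacelike if $\vec{x}\cdot\vec{x}>0$ and timelike if $\vec{x}\cdot\vec{x}<0$. A linear subspace or a submanifold is spacelike (resp. timelike) if all of its non-zero (tangent) vectors are spacelike (resp. timelike). The positive and negative unit pseudospheres are $H^\pm=\{\vec{x}\in\mathbb{R}^{(a,b)} : \vec{x}\cdot\vec{x}=\pm1\}$. Write $\vec{x}=(p,q)$ with $p\in\mathbb{R}^a$, $q\in\mathbb{R}^b$. The normal exponential map of the flat section $H^+\cap(\mathbb{R}^a\times 0)$ makes $H^+$ a bundle of hyperbolic spaces over $S^{a-1}$, with projection $(p,q)\mapsto p/|p|$; similarly $H^-$ is a bundle over $S^{b-1}$ with projection $(p,q)\mapsto q/|q|$. A neck of $H^+$ is a smooth spacelike submanifold $N^+\subset H^+$ of dimension $a-1$ which is the image of a section of the bundle $H^+\to S^{a-1}$. A neck of $H^-$ is a smooth timelike submanifold $N^-\subset H^-$ of dimension $b-1$ which is the image of a section of the bundle $H^-\to S^{b-1}$. (If $a=1$, then $N^+$ consists of one point on each of the two sheets of $H^+$; similarly for $N^-$ if $b=1$.) The geometric join $A*B$ of two subsets of a real vector space is the union of all line segments connecting a point of $A$ to a point of $B$. If $A*B$ is a closed (topological) manifold of codimension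 1, the filled join $\overline{A*B}$ is the compact region that it encloses. For necks $N^\pm$, the join $N^+*N^-$ is such a manifold, namely the boundary of a body that is starlike with respect to the origin. *)

theory Defs
  imports "HOL-Analysis.Analysis"
begin

text \<open>\<open>C\<^sup>k\<close> regularity on an \<^emph>\<open>open\<close> set, by iterating directional derivatives of the Frechet derivative.\<close>

primrec Ck_on :: "nat \<Rightarrow> 'e::euclidean_space set \<Rightarrow> ('e \<Rightarrow> 'f::euclidean_space) \<Rightarrow> bool" where
  "Ck_on 0 U f \<longleftrightarrow> continuous_on U f"
| "Ck_on (Suc k) U f \<longleftrightarrow> (\<forall>x\<in>U. f differentiable (at x)) \<and>
     (\<forall>v. Ck_on k U (\<lambda>x. frechet_derivative f (at x) v))"

definition smooth_on :: "'e::euclidean_space set \<Rightarrow> ('e \<Rightarrow> 'f::euclidean_space) \<Rightarrow> bool" where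
  "smooth_on U f \<longleftrightarrow> (\<forall>k. Ck_on k U f)"

text \<open>Embedded submanifolds, by slice charts; \<open>L\<close> plays the role of \<open>\<real>\<^sup>k\<close> inside the ambient space.\<close>

definition smooth_submanifold :: "nat \<Rightarrow> 'e::euclidean_space set \<Rightarrow> bool" where
  "smooth_submanifold k N \<longleftrightarrow>
     (\<forall>x\<in>N. \<exists>U V L \<phi> \<psi>. open U \<and> x \<in> U \<and> open V \<and>
        subspace L \<and> dim L = k \<and>
        homeomorphism U V \<phi> \<psi> \<and> smooth_on U \<phi> \<and> smooth_on V \<psi> \<and>
        \<phi> ` (N \<inter> U) = V \<inter> (L :: 'e set))"

definition tangent_vector :: "'e::euclidean_space set \<Rightarrow> 'e \<Rightarrow> 'e \<Rightarrow> bool" where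
  "tangent_vector N x v \<longleftrightarrow>
     (\<exists>\<epsilon>>0. \<exists>\<gamma>. smooth_on {-\<epsilon><..<\<epsilon>} \<gamma> \<and> \<gamma> ` {-\<epsilon><..<\<epsilon>} \<subseteq> N \<and>
        \<gamma> (0::real) = x \<and> (\<gamma> has_vector_derivative v) (at 0))"

text \<open>\<open>\<real>\<^sup>(\<^sup>a\<^sup>,\<^sup>b\<^sup>)\<close> is the product \<open>\<real>\<^sup>a \<times> \<real>\<^sup>b\<close> with \<open>a = CARD('a)\<close>, \<open>b = CARD('b)\<close>;
  both are automatically at least 1. The library's \<open>\<bullet>\<close> and \<open>norm\<close> on this
  type remain the positive definite ones.\<close>

type_synonym ('a, 'b) pseudo = "(real ^ 'a) \<times> (real ^ 'b)"

definition pinner :: "('a::finite, 'b::finite) pseudo \<Rightarrow> ('a, 'b) pseudo \<Rightarrow> real" where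
  "pinner x y = fst x \<bullet> fst y - snd x \<bullet> snd y"

definition spacelike :: "('a::finite, 'b::finite) pseudo \<Rightarrow> bool" where
  "spacelike x \<longleftrightarrow> x \<noteq> 0 \<and> pinner x x > 0"

definition timelike :: "('a::finite, 'b::finite) pseudo \<Rightarrow> bool" where
  "timelike x \<longleftrightarrow> x \<noteq> 0 \<and> pinner x x < 0"

definition spacelike_subspace :: "('a::finite, 'b::finite) pseudo set \<Rightarrow> bool" where
  "spacelike_subspace P \<longleftrightarrow> subspace P \<and> (\<forall>x\<in>P. x \<noteq> 0 \<longrightarrow> spacelike x)"

definition spacelike_submanifold :: "nat \<Rightarrow> ('a::finite, 'b::finite) pseudo set \<Rightarrow> bool" where
  "spacelike_submanifold k N \<longleftrightarrow> smooth_submanifold k N \<and>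
     (\<forall>x\<in>N. \<forall>v. tangent_vector N x v \<and> v \<noteq> 0 \<longrightarrow> spacelike v)"

definition timelike_submanifold :: "nat \<Rightarrow> ('a::finite, 'b::finite) pseudo set \<Rightarrow> bool" where
  "timelike_submanifold k N \<longleftrightarrow> smooth_submanifold k N \<and>
     (\<forall>x\<in>N. \<forall>v. tangent_vector N x v \<and> v \<noteq> 0 \<longrightarrow> timelike v)"

definition porthogonal :: "('a::finite, 'b::finite) pseudo set \<Rightarrow> ('a, 'b) pseudo set" where
  "porthogonal P = {y. \<forall>x\<in>P. pinner x y = 0}"

definition H_pos :: "('a::finite, 'b::finite) pseudo set" where
  "H_pos = {x. pinner x x = 1}"

definition H_neg :: "('a::finite, 'b::finite) pseudo set" where
  "H_neg = {x. pinner x x = -1}"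

definition bundle_section ::
    "('e::topological_space \<Rightarrow> 'f::topological_space) \<Rightarrow> 'e set \<Rightarrow> 'f set \<Rightarrow> ('f \<Rightarrow> 'e) \<Rightarrow> bool" where
  "bundle_section \<pi> E B s \<longleftrightarrow> continuous_on B s \<and> s ` B \<subseteq> E \<and> (\<forall>u\<in>B. \<pi> (s u) = u)"

text \<open>The first component does not vanish on \<open>H_pos\<close>, nor the second one on \<open>H_neg\<close>.\<close>

definition proj_pos :: "('a::finite, 'b::finite) pseudo \<Rightarrow> real ^ 'a" where
  "proj_pos x = fst x /\<^sub>R norm (fst x)"

definition proj_neg :: "('a::finite, 'b::finite) pseudo \<Rightarrow> real ^ 'b" where
  "proj_neg x = snd x /\<^sub>R norm (snd x)"

definition neck_pos :: "('a::finite, 'b::finite) pseudo set \<Rightarrow> bool" where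
  "neck_pos N \<longleftrightarrow> N \<subseteq> H_pos \<and> spacelike_submanifold (CARD('a) - 1) N \<and>
     (\<exists>s. bundle_section proj_pos H_pos (sphere 0 1) s \<and> N = s ` sphere 0 1)"

definition neck_neg :: "('a::finite, 'b::finite) pseudo set \<Rightarrow> bool" where
  "neck_neg N \<longleftrightarrow> N \<subseteq> H_neg \<and> timelike_submanifold (CARD('b) - 1) N \<and>
     (\<exists>s. bundle_section proj_neg H_neg (sphere 0 1) s \<and> N = s ` sphere 0 1)"

definition geometric_join :: "'e::real_vector set \<Rightarrow> 'e set \<Rightarrow> 'e set" where
  "geometric_join A B = (\<Union>x\<in>A. \<Union>y\<in>B. closed_segment x y)"

text \<open>When the join is a closed hypersurface, the compact region enclosed by it consists of the
  hypersurface and of the bounded component of its complement. For other joins the value is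
  not meaningful.\<close>

definition filled_join :: "'e::real_normed_vector set \<Rightarrow> 'e set \<Rightarrow> 'e set" where
  "filled_join A B = geometric_join A B \<union> inside (geometric_join A B)"

end

theory Submission
  imports Defs "HOL-Complex_Analysis.Complex_Analysis"
begin

text \<open>The cones over the necks are graphs of positively homogeneous maps \<open>F : \<real>\<^sup>a \<rightarrow> \<real>\<^sup>b\<close> and
  \<open>G : \<real>\<^sup>b \<rightarrow> \<real>\<^sup>a\<close> with Lipschitz constant \<open>\<kappa> < 1\<close>, and \<open>\<Phi>(p, q) = (p + G q, q + F p)\<close> maps
  \<open>{A p + B q \<le> 1}\<close> onto the filled join, where \<open>A p\<close> and \<open>B q\<close> are the pseudo-lengths of \<open>(p, F p)\<close> and
  \<open>(G q, q)\<close>. The Jacobian \<open>J\<close> of \<open>\<Phi>\<close> is homogeneous of degree 0 in \<open>p\<close> and in \<open>q\<close> separately, so the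
  image of the measure \<open>J dp dq\<close> under \<open>(A, B)\<close> is determined up to a factor, and volumes of filled joins
  can be compared through \<open>\<integral> exp(- A\<^sup>2 - B\<^sup>2) J dp dq\<close> instead.

  Put \<open>\<Psi>(p, q) = (- G q, F p)\<close>. For small real \<open>w\<close>, substituting \<open>y = x + w \<Psi> x\<close> shows that
  \<open>\<integral> exp(- (x + w \<Psi> x)\<^sup>2) det(1 + w D\<Psi>) dx = \<integral> exp(- |x|\<^sup>2) dx\<close>. The left-hand side is holomorphic in \<open>w\<close>
  as long as \<open>|Re w| + |Im w| < 1 / \<kappa>\<close>, so the identity persists at \<open>w = \<i>\<close>. There the integrand is
  \<open>exp(- A\<^sup>2 - B\<^sup>2) J\<close> times a factor of modulus 1, which bounds \<open>\<integral> exp(- A\<^sup>2 - B\<^sup>2) J\<close> from below by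
  \<open>\<integral> exp(- |x|\<^sup>2)\<close>. For flat orthogonal necks \<open>F\<close> is linear and \<open>G\<close> its adjoint, the phase
  \<open>- 2 x \<bullet> \<Psi> x\<close> vanishes, and equality holds.\<close>

text \<open>The two integrands cannot be compared point by point. If \<open>F\<close> is linear and
  \<open>G\<close> its adjoint, then J = det(1 - G F) is at most 1, and only the shortening A p
  \<le> |p|, B q \<le> |q| makes up for it; in general the sign of J - 1 can vary with p and q. The
  contour shift settles both effects at once. The minus sign in \<Psi> is forced. At w = \<i> the
  square of the shift counts negatively, which turns |p|^2 + |q|^2 into A^2 + B^2. The determinant
  is det(1 + w^2 DG DF) because of the sign, and this is J exactly at w = \<i>. The shift needs a
  weight that is entire in the coordinates. The indicator of A + B \<le> 1 is not, hence the detour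
  through a Gaussian and proportional measures. The causal character of the necks enters through
  \<kappa>. Tangent vectors satisfy strict inequalities only pointwise, and compactness of the unit
  sphere makes them uniform. Then \<kappa> < 1 both makes \<Phi> bijective and places \<i> inside
  the domain |Re w| + |Im w| < 1 / \<kappa>.\<close>

no_notation fps_nth (infixl \<open>$\<close> 75)

subsection \<open>Gaussian integrals along shifted contours\<close>

text \<open>Cauchy's inequality turns the bound \<open>B x\<close> on \<open>f\<close> into the
  bound \<open>B x / r\<close> on its derivatives in \<open>w\<close>, hence on difference quotients
  near \<open>w0\<close>. These are dominated by an integrable function, so the limit passes under
  the integral.\<close>

lemma holomorphic_on_lebesgue_integral:
  fixes f :: "complex \<Rightarrow> 'x \<Rightarrow> complex"
  assumes U: "open U"
    and hol: "\<And>x. x \<in> space M \<Longrightarrow> (\<lambda>w. f w x) holomorphic_on U"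
    and meas: "\<And>w. w \<in> U \<Longrightarrow> f w \<in> borel_measurable M"
    and B: "integrable M B"
    and bound: "\<And>w x. w \<in> U \<Longrightarrow> x \<in> space M \<Longrightarrow> norm (f w x) \<le> B x"
  shows "(\<lambda>w. \<integral>x. f w x \<partial>M) holomorphic_on U"
proof -
  have int: "integrable M (f w)" if "w \<in> U" for w
    by (rule Bochner_Integration.integrable_bound[OF B meas[OF that]])
       (use bound[OF that] in \<open>force intro!: AE_I2\<close>)
  have "(\<lambda>w. \<integral>x. f w x \<partial>M) field_differentiable at w0" if w0: "w0 \<in> U" for w0
  proof -
    obtain R where R: "R > 0" "cball w0 R \<subseteq> U"
      using U w0 open_contains_cball by blast
    \<comment> \<open>Half the radius, so that every point of \<open>ball w0 r\<close> still has a
      closed disc of radius \<open>r\<close> inside \<open>U\<close> on which Cauchy's inequality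
      applies.\<close>
    define r where "r = R / 2"
    have r: "r > 0" using R by (simp add: r_def)
    have sub: "cball w r \<subseteq> U" if "w \<in> ball w0 r" for w
    proof
      fix z assume z: "z \<in> cball w r"
      have "dist w0 z \<le> dist w0 w + dist w z" by (rule dist_triangle)
      also have "\<dots> \<le> R" using that z by (simp add: r_def)
      finally show "z \<in> U" using R by auto
    qed
    have bU: "ball w0 r \<subseteq> U"
      using sub[of w0] r by (meson ball_subset_cball centre_in_ball order_trans)
    define D where "D x = deriv (\<lambda>w. f w x) w0" for x
    have der: "((\<lambda>w. f w x) has_field_derivative deriv (\<lambda>w. f w x) w) (at w)"
      if "x \<in> space M" "w \<in> U" for x w
      using holomorphic_derivI[OF hol[OF that(1)] U that(2)] .
    have dbound: "norm (deriv (\<lambda>w. f w x) w) \<le> B x / r" if "x \<in> space M" "w \<in> ball w0 r" for x w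
    proof -
      have "norm ((deriv ^^ 1) (\<lambda>w. f w x) w) \<le> fact 1 * B x / r ^ 1"
      proof (rule Cauchy_inequality)
        have h: "(\<lambda>w. f w x) holomorphic_on cball w r"
          using holomorphic_on_subset[OF hol[OF that(1)] sub[OF that(2)]] .
        then show "(\<lambda>w. f w x) holomorphic_on ball w r"
          using holomorphic_on_subset ball_subset_cball by blast
        show "continuous_on (cball w r) (\<lambda>w. f w x)"
          using h holomorphic_on_imp_continuous_on by blast
        show "norm (f z x) \<le> B x" if "norm (w - z) = r" for z
          using bound[of z x] sub[of w] that \<open>x \<in> space M\<close> \<open>w \<in> ball w0 r\<close> by (auto simp: dist_norm)
      qed (use r in auto)
      then show ?thesis by simp
    qed
    have lip: "norm (f w x - f w0 x) \<le> B x / r * norm (w - w0)" if "x \<in> space M" "w \<in> ball w0 r" for x w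
    proof (rule field_differentiable_bound[of "ball w0 r" "\<lambda>w. f w x" "deriv (\<lambda>w. f w x)"])
      show "((\<lambda>w. f w x) has_field_derivative deriv (\<lambda>w. f w x) z) (at z within ball w0 r)"
        if "z \<in> ball w0 r" for z
        using der[OF \<open>x \<in> space M\<close>, of z] bU that has_field_derivative_at_within by blast
    qed (use that dbound r in auto)
    have "((\<lambda>w. ((\<integral>x. f w x \<partial>M) - (\<integral>x. f w0 x \<partial>M)) / (w - w0)) \<longlongrightarrow> (\<integral>x. D x \<partial>M)) (at w0 within ball w0 r)"
      unfolding tendsto_at_iff_sequentially o_def
    proof (intro allI impI)
      fix X :: "nat \<Rightarrow> complex"
      assume X: "\<forall>i. X i \<in> ball w0 r - {w0}" and lim: "X \<longlonglongrightarrow> w0"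
      have XU: "X i \<in> U" for i using X bU by blast
      have eq: "((\<integral>x. f (X i) x \<partial>M) - (\<integral>x. f w0 x \<partial>M)) / (X i - w0)
        = (\<integral>x. (f (X i) x - f w0 x) / (X i - w0) \<partial>M)" for i
        using int[OF XU] int[OF w0] by simp
      have lm: "(\<lambda>i. (f (X i) x - f w0 x) / (X i - w0)) \<longlonglongrightarrow> D x" if "x \<in> space M" for x
      proof -
        have "((\<lambda>w. (f w x - f w0 x) / (w - w0)) \<longlongrightarrow> D x) (at w0)"
          using der[OF that w0] by (simp add: has_field_derivative_iff D_def)
        then show ?thesis
          using lim X by (auto simp: tendsto_at_iff_sequentially o_def)
      qed
      have mq: "(\<lambda>x. (f (X i) x - f w0 x) / (X i - w0)) \<in> borel_measurable M" for i
        using meas[OF XU] meas[OF w0] by simp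
      show "(\<lambda>i. ((\<integral>x. f (X i) x \<partial>M) - (\<integral>x. f w0 x \<partial>M)) / (X i - w0)) \<longlonglongrightarrow> (\<integral>x. D x \<partial>M)"
        unfolding eq
      proof (rule integral_dominated_convergence)
        show "D \<in> borel_measurable M"
          by (rule borel_measurable_LIMSEQ_metric[OF mq]) (rule lm)
        show "integrable M (\<lambda>x. B x / r)" using B by simp
        show "AE x in M. (\<lambda>i. (f (X i) x - f w0 x) / (X i - w0)) \<longlonglongrightarrow> D x"
          using lm by simp
        show "AE x in M. norm ((f (X i) x - f w0 x) / (X i - w0)) \<le> B x / r" for i
        proof (rule AE_I2)
          fix x assume "x \<in> space M"
          then show "norm ((f (X i) x - f w0 x) / (X i - w0)) \<le> B x / r"
            using lip[of x "X i"] X by (auto simp: norm_divide divide_le_eq)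
        qed
      qed (rule mq)
    qed
    then have "((\<lambda>w. \<integral>x. f w x \<partial>M) has_field_derivative (\<integral>x. D x \<partial>M)) (at w0)"
      using at_within_open[of w0 "ball w0 r"] r by (simp add: has_field_derivative_iff)
    then show ?thesis
      unfolding field_differentiable_def by blast
  qed
  then show ?thesis
    unfolding holomorphic_on_def by (blast intro: field_differentiable_at_within)
qed

text \<open>Cover space by shells k \<le> |x| \<le> k + 1. Each contributes at most its largest
  weight times the volume of the enclosing ball, and these terms \<open>c k\<close> are
  summable.\<close>

lemma integrable_gaussian:
  fixes \<delta> :: real
  assumes "\<delta> > 0"
  shows "integrable lborel (\<lambda>x::'a::euclidean_space. exp (- \<delta> * (norm x)\<^sup>2))"
proof (rule integrableI_bounded)
  let ?n = "DIM('a)"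
  define c where "c k = exp (- \<delta> * (real k)\<^sup>2) * (unit_ball_vol ?n * (real k + 1) ^ ?n)" for k
  have sm: "summable c"
  proof (rule summable_comparison_test_ev)
    \<comment> \<open>Of the \<open>?n + 2\<close> powers of 1/k, \<open>?n\<close> absorb the ball
      volume and two remain for summability; k + 1 \<le> 2 k costs the factor
      \<open>2 ^ ?n\<close>.\<close>
    let ?C = "unit_ball_vol ?n * 2 ^ ?n / \<delta> ^ (?n + 2)"
    show "summable (\<lambda>k. ?C * inverse (real k ^ 2))"
      by (intro summable_mult inverse_power_summable) simp
    have "filterlim (\<lambda>k. \<delta> * real k) at_top sequentially"
      using assms by (intro filterlim_tendsto_pos_mult_at_top[OF tendsto_const] filterlim_real_sequentially)
    from filterlim_compose[OF tendsto_power_div_exp_0 this, of "?n + 2"]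
    have "\<forall>\<^sub>F k in sequentially. (\<delta> * real k) ^ (?n + 2) / exp (\<delta> * real k) < 1"
      by (rule order_tendstoD) simp
    then show "\<forall>\<^sub>F k in sequentially. norm (c k) \<le> ?C * inverse (real k ^ 2)"
      using eventually_ge_at_top[of 1]
    proof eventually_elim
      case (elim k)
      then have k: "1 \<le> real k" by simp
      have "(\<delta> * real k) ^ (?n + 2) < exp (\<delta> * real k)"
        using elim by (simp add: divide_less_eq)
      also have "\<dots> \<le> exp (\<delta> * (real k)\<^sup>2)"
        using k assms by (simp add: power2_eq_square)
      finally have "exp (- \<delta> * (real k)\<^sup>2) \<le> inverse ((\<delta> * real k) ^ (?n + 2))"
        using k assms by (simp add: exp_minus del: power_add power_Suc)
      then have "c k \<le> inverse ((\<delta> * real k) ^ (?n + 2)) * (unit_ball_vol ?n * (2 * real k) ^ ?n)"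
        unfolding c_def using k assms by (intro mult_mono power_mono) (auto simp del: power_Suc)
      also have "\<dots> = ?C * inverse (real k ^ 2)"
        using k assms by (simp add: power_mult_distrib power_add power2_eq_square field_simps)
      finally show ?case
        by (simp add: c_def)
    qed
  qed
  have "(\<integral>\<^sup>+x. ennreal (norm (exp (- \<delta> * (norm (x::'a))\<^sup>2))) \<partial>lborel)
    \<le> (\<integral>\<^sup>+x. (\<Sum>k. ennreal (exp (- \<delta> * (real k)\<^sup>2)) * indicator (cball 0 (real k + 1)) (x::'a)) \<partial>lborel)"
  proof (rule nn_integral_mono)
    fix x :: 'a
    define k where "k = nat \<lfloor>norm x\<rfloor>"
    have k: "real k \<le> norm x" "norm x \<le> real k + 1"
      by (auto simp: k_def)
    have "ennreal (norm (exp (- \<delta> * (norm x)\<^sup>2))) \<le> ennreal (exp (- \<delta> * (real k)\<^sup>2)) * indicator (cball 0 (real k + 1)) x"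
      using k assms by (auto simp: indicator_def intro!: ennreal_leI power_mono)
    also have "\<dots> = (\<Sum>i\<in>{k}. ennreal (exp (- \<delta> * (real i)\<^sup>2)) * indicator (cball 0 (real i + 1)) x)"
      by (subst sum.insert) simp_all
    also have "\<dots> \<le> (\<Sum>k. ennreal (exp (- \<delta> * (real k)\<^sup>2)) * indicator (cball 0 (real k + 1)) x)"
      by (rule sum_le_suminf) auto
    finally show "ennreal (norm (exp (- \<delta> * (norm x)\<^sup>2))) \<le> (\<Sum>k. ennreal (exp (- \<delta> * (real k)\<^sup>2)) * indicator (cball 0 (real k + 1)) x)" .
  qed
  also have "\<dots> = (\<Sum>k. \<integral>\<^sup>+x. ennreal (exp (- \<delta> * (real k)\<^sup>2)) * indicator (cball 0 (real k + 1)) (x::'a) \<partial>lborel)"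
    by (intro nn_integral_suminf borel_measurable_times_ennreal borel_measurable_const borel_measurable_indicator) simp
  also have "\<dots> = (\<Sum>k. ennreal (c k))"
    by (intro suminf_cong) (simp add: nn_integral_cmult_indicator emeasure_cball c_def ennreal_mult)
  also have "\<dots> = ennreal (\<Sum>k. c k)"
    by (rule suminf_ennreal2[OF _ sm]) (simp add: c_def)
  also have "\<dots> < \<infinity>" by simp
  finally show "(\<integral>\<^sup>+x. ennreal (norm (exp (- \<delta> * (norm (x::'a))\<^sup>2))) \<partial>lborel) < \<infinity>" .
qed simp

text \<open>Deform \<open>K\<close> to 0 through t K. Were the determinant not positive, it would
  vanish for some t in [0, 1], as it is 1 at t = 0. A kernel vector would satisfy x = - t K x, which
  a contraction forbids.\<close>

lemma det_mat_add_contraction_pos: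
  fixes K :: "real^'n^'n"
  assumes K: "\<And>x. norm (K *v x) \<le> \<kappa> * norm x" and \<kappa>: "\<kappa> < 1"
  shows "det (mat 1 + K) > 0"
proof (rule ccontr)
  assume "\<not> ?thesis"
  then have neg: "det (mat 1 + K) \<le> 0" by simp
  let ?d = "\<lambda>t::real. det (mat 1 + t *\<^sub>R K)"
  have "continuous_on {0..1} ?d"
    unfolding det_def by (intro continuous_intros)
  then obtain t where t: "0 \<le> t" "t \<le> 1" "?d t = 0"
    using IVT2'[of ?d 1 0 0] neg by auto
  then have "\<nexists>B. B ** (mat 1 + t *\<^sub>R K) = mat 1"
    by (metis invertible_det_nz invertible_left_inverse)
  then obtain x where x: "(mat 1 + t *\<^sub>R K) *v x = 0" "x \<noteq> 0"
    unfolding matrix_left_invertible_ker by blast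
  then have "x = - (t *\<^sub>R (K *v x))"
    by (simp add: matrix_vector_mult_add_rdistrib scaleR_matrix_vector_assoc eq_neg_iff_add_eq_0)
  then have "norm x = norm (- (t *\<^sub>R (K *v x)))"
    by (rule arg_cong)
  also have "\<dots> = t * norm (K *v x)"
    using t by simp
  also have "\<dots> \<le> norm (K *v x)"
    using t by (simp add: mult_left_le_one_le)
  also have "\<dots> \<le> \<kappa> * norm x" by (rule K)
  also have "\<dots> < norm x" using \<kappa> x by simp
  finally show False by simp
qed

text \<open>Fixing one sequence of step sizes serves two purposes: bounds on difference quotients
  pass to the derivative, and derivatives of continuous maps appear as pointwise limits of
  measurable functions.\<close>

lemma has_derivative_imp_LIMSEQ:
  fixes f :: "'a::real_normed_vector \<Rightarrow> 'b::real_normed_vector"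
  assumes "(f has_derivative f') (at x)"
  shows "(\<lambda>n. real (Suc n) *\<^sub>R (f (x + inverse (real (Suc n)) *\<^sub>R h) - f x)) \<longlonglongrightarrow> f' h"
proof -
  interpret bounded_linear f' using assms by (rule has_derivative_bounded_linear)
  have "((\<lambda>t. x + t *\<^sub>R h) has_derivative (\<lambda>t. t *\<^sub>R h)) (at 0)"
    by (auto intro!: derivative_eq_intros)
  from has_derivative_compose[OF this, of f f'] assms
  have "((\<lambda>t. f (x + t *\<^sub>R h)) has_vector_derivative f' h) (at 0)"
    by (simp add: has_vector_derivative_def scaleR)
  then have lim: "((\<lambda>t. (f (x + t *\<^sub>R h) - f x) /\<^sub>R t) \<longlongrightarrow> f' h) (at 0)"
  proof -
    assume "((\<lambda>t. f (x + t *\<^sub>R h)) has_vector_derivative f' h) (at 0)"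
    then have "(\<lambda>t. norm (f (x + t *\<^sub>R h) - f x - t *\<^sub>R f' h) / norm t) \<midarrow>0\<rightarrow> 0"
      by (simp add: has_vector_derivative_def has_derivative_at)
    then have "(\<lambda>t. norm ((f (x + t *\<^sub>R h) - f x) /\<^sub>R t - f' h)) \<midarrow>0\<rightarrow> 0"
    proof (rule Lim_transform_eventually)
      have "norm (f (x + t *\<^sub>R h) - f x - t *\<^sub>R f' h) / norm t = norm ((f (x + t *\<^sub>R h) - f x) /\<^sub>R t - f' h)"
        if "t \<noteq> 0" for t
      proof -
        have "(f (x + t *\<^sub>R h) - f x) /\<^sub>R t - f' h = (f (x + t *\<^sub>R h) - f x - t *\<^sub>R f' h) /\<^sub>R t"
          using that by (simp add: scaleR_diff_right)
        then show ?thesis by (simp only: norm_scaleR norm_inverse divide_inverse mult.commute real_norm_def abs_inverse)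
      qed
      then show "\<forall>\<^sub>F t in at 0. norm (f (x + t *\<^sub>R h) - f x - t *\<^sub>R f' h) / norm t
          = norm ((f (x + t *\<^sub>R h) - f x) /\<^sub>R t - f' h)"
        by (simp add: eventually_at_filter)
    qed
    then show ?thesis
      by (rule LIM_zero_cancel[OF tendsto_norm_zero_cancel])
  qed
  have "filterlim (\<lambda>n. inverse (real (Suc n))) (at 0) sequentially"
    by (rule filterlim_atI[OF LIMSEQ_inverse_real_of_nat]) simp
  from filterlim_compose[OF lim this] show ?thesis
    by simp
qed

lemma has_derivative_local_lipschitz_bound:
  fixes f :: "'a::real_normed_vector \<Rightarrow> 'b::real_normed_vector"
  assumes der: "(f has_derivative f') (at x)"
    and lip: "\<forall>\<^sub>F y in nhds x. norm (f y - f x) \<le> \<kappa> * norm (y - x)"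
  shows "norm (f' h) \<le> \<kappa> * norm h"
proof (rule tendsto_upperbound[OF tendsto_norm[OF has_derivative_imp_LIMSEQ[OF der]]])
  have "(\<lambda>n. x + inverse (real (Suc n)) *\<^sub>R h) \<longlonglongrightarrow> x + 0 *\<^sub>R h"
    by (intro tendsto_intros LIMSEQ_inverse_real_of_nat)
  then have "filterlim (\<lambda>n. x + inverse (real (Suc n)) *\<^sub>R h) (nhds x) sequentially" by simp
  from eventually_compose_filterlim[OF lip this]
  show "\<forall>\<^sub>F n in sequentially. norm (real (Suc n) *\<^sub>R (f (x + inverse (real (Suc n)) *\<^sub>R h) - f x)) \<le> \<kappa> * norm h"
  proof eventually_elim
    case (elim n)
    then have "real (Suc n) * norm (f (x + inverse (real (Suc n)) *\<^sub>R h) - f x)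
        \<le> real (Suc n) * (\<kappa> * norm (inverse (real (Suc n)) *\<^sub>R h))"
      by (intro mult_left_mono) auto
    then show ?case
      by (simp add: divide_simps mult_ac split: if_splits)
  qed
qed simp

lemma has_derivative_lipschitz_bound:
  fixes f :: "'a::real_normed_vector \<Rightarrow> 'b::real_normed_vector"
  assumes "(f has_derivative f') (at x)" "\<And>x y. norm (f x - f y) \<le> \<kappa> * norm (x - y)"
  shows "norm (f' h) \<le> \<kappa> * norm h"
  using assms by (intro has_derivative_local_lipschitz_bound) auto

lemma norm_det_le:
  fixes A :: "'a::real_normed_field^'n^'n"
  assumes "\<And>i j. norm (A $ i $ j) \<le> C"
  shows "norm (det A) \<le> fact CARD('n) * C ^ CARD('n)"
proof -
  have "norm (det A) \<le> (\<Sum>p\<in>{p. p permutes (UNIV :: 'n set)}. norm (of_int (sign p) * (\<Prod>i\<in>UNIV. A $ i $ p i)))"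
    unfolding det_def by (rule norm_sum)
  also have "\<dots> \<le> (\<Sum>p\<in>{p. p permutes (UNIV :: 'n set)}. C ^ CARD('n))"
  proof (rule sum_mono)
    fix p :: "'n \<Rightarrow> 'n"
    have "norm (\<Prod>i\<in>UNIV. A $ i $ p i) \<le> (\<Prod>i\<in>(UNIV::'n set). C)"
      unfolding prod_norm[symmetric] by (rule prod_mono) (use assms in auto)
    then show "norm (of_int (sign p) * (\<Prod>i\<in>UNIV. A $ i $ p i)) \<le> C ^ CARD('n)"
      by (simp add: norm_mult sign_def)
  qed
  also have "\<dots> = fact CARD('n) * C ^ CARD('n)"
    by (simp add: card_permutations[OF refl])
  finally show ?thesis .
qed

section \<open>Contractive perturbations of the identity\<close>

lemma lipschitz_bound_continuous_on:
  fixes f :: "'a::real_normed_vector \<Rightarrow> 'b::real_normed_vector"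
  assumes "\<And>x y. norm (f x - f y) \<le> \<kappa> * norm (x - y)" and "0 \<le> \<kappa>"
  shows "continuous_on S f"
proof -
  have "\<kappa>-lipschitz_on S f"
    using assms by (intro lipschitz_onI) (simp_all add: dist_norm)
  then show ?thesis by (rule lipschitz_on_continuous_on)
qed

lemma contraction_perturbation:
  fixes \<Psi> :: "'a::{real_normed_vector,complete_space} \<Rightarrow> 'a"
  assumes lip: "\<And>x y. norm (\<Psi> x - \<Psi> y) \<le> \<kappa> * norm (x - y)" and \<kappa>: "0 \<le> \<kappa>" "\<kappa> < 1"
  shows contraction_perturbation_expand: "(1 - \<kappa>) * norm (x - y) \<le> norm ((x + \<Psi> x) - (y + \<Psi> y))"
    and contraction_perturbation_bij: "bij (\<lambda>x. x + \<Psi> x)"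
proof -
  show ex: "(1 - \<kappa>) * norm (x - y) \<le> norm ((x + \<Psi> x) - (y + \<Psi> y))" for x y
  proof -
    have "norm (x - y) \<le> norm ((x + \<Psi> x) - (y + \<Psi> y)) + norm (\<Psi> x - \<Psi> y)"
      using norm_triangle_ineq4[of "(x + \<Psi> x) - (y + \<Psi> y)" "\<Psi> x - \<Psi> y"] by simp
    then show ?thesis using lip[of x y] by (simp add: algebra_simps)
  qed
  show "bij (\<lambda>x. x + \<Psi> x)"
    unfolding bij_def
  proof
    show "inj (\<lambda>x. x + \<Psi> x)"
    proof (rule injI)
      fix x y assume "x + \<Psi> x = y + \<Psi> y"
      then have "(1 - \<kappa>) * norm (x - y) \<le> 0" using ex[of x y] by simp
      then show "x = y" using \<kappa> by (simp add: mult_le_0_iff)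
    qed
    show "surj (\<lambda>x. x + \<Psi> x)"
    proof (rule surjI)
      fix z
      \<comment> \<open>A preimage of \<open>z\<close> is a fixed point of the contraction sending x
        to z - \<Psi> x.\<close>
      have "\<exists>!x. z - \<Psi> x = x"
      proof (rule banach_fix_type[OF \<kappa>])
        show "\<forall>x y. dist (z - \<Psi> x) (z - \<Psi> y) \<le> \<kappa> * dist x y"
          using lip by (simp add: dist_norm norm_minus_commute)
      qed
      then obtain x where "z - \<Psi> x = x" by blast
      then have "x + \<Psi> x = z" by (simp add: diff_eq_eq)
      then have "\<exists>x. x + \<Psi> x = z" by blast
      then show "(SOME x. x + \<Psi> x = z) + \<Psi> (SOME x. x + \<Psi> x = z) = z"
        by (rule someI_ex)
    qed
  qed
qed

lemma borel_measurable_jacobian: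
  fixes \<Psi> :: "real^'n \<Rightarrow> real^'n"
  assumes S: "open S" and cont: "continuous_on UNIV \<Psi>"
    and der: "\<And>x. x \<in> S \<Longrightarrow> (\<Psi> has_derivative ((*v) (K x))) (at x)"
    and K0: "\<And>x. x \<notin> S \<Longrightarrow> K x = 0"
  shows "(\<lambda>x. K x $ i $ j) \<in> borel_measurable borel"
proof (rule borel_measurable_LIMSEQ_metric)
  \<comment> \<open>The indicator matches the convention K = 0 off \<open>S\<close>, where the
    quotients need not converge.\<close>
  let ?q = "\<lambda>n x. indicator S x * (real (Suc n) *\<^sub>R (\<Psi> (x + inverse (real (Suc n)) *\<^sub>R axis j 1) - \<Psi> x)) $ i"
  show "?q n \<in> borel_measurable borel" for n
  proof -
    have "continuous_on UNIV (\<lambda>x. (real (Suc n) *\<^sub>R (\<Psi> (x + inverse (real (Suc n)) *\<^sub>R axis j 1) - \<Psi> x)) $ i)"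
      by (intro continuous_intros continuous_on_compose2[OF cont]) auto
    then show ?thesis
      using S by (intro borel_measurable_times borel_measurable_indicator borel_measurable_continuous_onI) auto
  qed
  show "(\<lambda>n. ?q n x) \<longlonglongrightarrow> K x $ i $ j" for x
  proof (cases "x \<in> S")
    case True
    have "K x *v axis j 1 = column j (K x)"
      by (simp add: matrix_vector_mul_component matrix_vector_mult_basis)
    then show ?thesis
      using tendsto_vec_nth[OF has_derivative_imp_LIMSEQ[OF der[OF True], of "axis j 1"], of i] True
      by (simp add: column_def del: of_nat_Suc)
  qed (simp add: K0)
qed

text \<open>The substitution takes place on \<open>S\<close>. The complement is negligible and
  remains so under the Lipschitz map x + \<Psi> x, so both integrals extend to the whole space.
  Positivity of the determinant removes the absolute value from the change of variables
  formula.\<close>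

lemma gaussian_change_of_variables:
  fixes \<Psi> :: "real^'n::{finite,wellorder} \<Rightarrow> real^'n::_"
  assumes lip: "\<And>x y. norm (\<Psi> x - \<Psi> y) \<le> \<kappa> * norm (x - y)" and \<kappa>: "0 \<le> \<kappa>" "\<kappa> < 1"
    and S: "open S" "negligible (- S)"
    and der: "\<And>x. x \<in> S \<Longrightarrow> (\<Psi> has_derivative ((*v) (K x))) (at x)"
    and K0: "\<And>x. x \<notin> S \<Longrightarrow> K x = 0"
  shows "(LINT x|lborel. exp (- (norm (x + \<Psi> x))\<^sup>2) * det (mat 1 + K x)) = (LINT x|lborel. exp (- (norm (x :: real^'n::_))\<^sup>2))"
proof -
  define \<Phi> where "\<Phi> x = x + \<Psi> x" for x
  have bij: "bij \<Phi>"
    using contraction_perturbation_bij[OF lip \<kappa>] by (simp add: \<Phi>_def[abs_def])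
  have cont: "continuous_on UNIV \<Psi>"
    by (rule lipschitz_bound_continuous_on[OF lip \<kappa>(1)])
  have detpos: "det (mat 1 + K x) > 0" for x
  proof (rule det_mat_add_contraction_pos[OF _ \<kappa>(2)])
    show "norm (K x *v h) \<le> \<kappa> * norm h" for h
      using has_derivative_lipschitz_bound[OF der lip] K0 \<kappa> by (cases "x \<in> S") auto
  qed
  have der\<Phi>: "(\<Phi> has_derivative ((*v) (mat 1 + K x))) (at x within S)" if "x \<in> S" for x
    unfolding \<Phi>_def matrix_vector_mult_add_rdistrib
    using that by (auto intro!: derivative_eq_intros has_derivative_at_withinI[OF der])
  have neg: "negligible (\<Phi> ` (- S))"
  proof (rule negligible_locally_Lipschitz_image[OF _ S(2)])
    fix x
    have "norm (\<Phi> y - \<Phi> x) \<le> (1 + \<kappa>) * norm (y - x)" for y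
    proof -
      have "norm (\<Phi> y - \<Phi> x) \<le> norm (y - x) + norm (\<Psi> y - \<Psi> x)"
        unfolding \<Phi>_def by (metis add_diff_add norm_triangle_ineq)
      then show ?thesis using lip[of y x] by (simp add: algebra_simps)
    qed
    then show "\<exists>T B. open T \<and> x \<in> T \<and> (\<forall>y\<in>- S \<inter> T. norm (\<Phi> y - \<Phi> x) \<le> B * norm (y - x))"
      by blast
  qed simp
  have im: "\<Phi> ` S = - \<Phi> ` (- S)"
    using bij by (metis bij_image_Compl_eq double_complement)
  have Sm: "S \<in> sets lebesgue" "\<Phi> ` S \<in> sets lebesgue"
    using S negligible_imp_sets[OF neg] by (auto simp: im Compl_in_sets_lebesgue)
  let ?g = "\<lambda>x::real^'n::_. exp (- (norm x)\<^sup>2)"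
  \<comment> \<open>The change of variables theorem is stated for vector-valued integrands, so the
    Gaussian is wrapped in \<open>real^1\<close>.\<close>
  let ?f = "\<lambda>x. (vec (?g x) :: real^1)"
  have gi: "?g absolutely_integrable_on UNIV"
    using integrable_gaussian[of 1, where 'a="real^'n::_"]
    by (simp add: set_integrable_def integrable_completion)
  then have gi': "?g absolutely_integrable_on (\<Phi> ` S)"
    using set_integrable_subset[OF gi Sm(2)] by simp
  have "integral (\<Phi> ` S) ?g = integral UNIV ?g"
    by (rule integral_spike_set) (auto simp: im intro: negligible_subset[OF neg])
  then have "?f absolutely_integrable_on (\<Phi> ` S) \<and> integral (\<Phi> ` S) ?f = vec (integral UNIV ?g)"
    using gi' by (simp add: absolutely_integrable_on_1_iff integral_on_1_eq)
  then have *: "(\<lambda>x. \<bar>det (matrix ((*v) (mat 1 + K x)))\<bar> *\<^sub>R ?f (\<Phi> x)) absolutely_integrable_on S \<and>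
      integral S (\<lambda>x. \<bar>det (matrix ((*v) (mat 1 + K x)))\<bar> *\<^sub>R ?f (\<Phi> x)) = vec (integral UNIV ?g)"
    using has_absolute_integral_change_of_variables[OF Sm(1) der\<Phi>, of ?f "vec (integral UNIV ?g)"]
      inj_on_subset[OF bij_is_inj[OF bij]] by blast
  let ?h = "\<lambda>x. ?g (\<Phi> x) * det (mat 1 + K x)"
  have h: "?h absolutely_integrable_on S" "integral S ?h = integral UNIV ?g"
    using * detpos
    by (simp_all add: absolutely_integrable_on_1_iff integral_on_1_eq abs_of_pos vec_eq_iff mult.commute)
  have hU: "?h absolutely_integrable_on UNIV"
    by (rule absolutely_integrable_spike_set[OF h(1)]) (auto intro: negligible_subset[OF S(2)])
  have "integral UNIV ?h = integral S ?h"
    by (rule integral_spike_set) (auto intro: negligible_subset[OF S(2)])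
  have hm: "?h \<in> borel_measurable lborel"
  proof -
    have "continuous_on UNIV (\<lambda>x. ?g (\<Phi> x))"
      unfolding \<Phi>_def using cont by (intro continuous_intros)
    then have "(\<lambda>x. ?g (\<Phi> x)) \<in> borel_measurable borel"
      by (rule borel_measurable_continuous_onI)
    moreover have "(\<lambda>x. det (mat 1 + K x)) \<in> borel_measurable borel"
      unfolding det_def
      using borel_measurable_jacobian[OF S(1) cont der K0] by simp
    ultimately show ?thesis by simp
  qed
  have "(LINT x|lborel. ?h x) = (LINT x|lebesgue. ?h x)"
    using integral_completion[OF hm] by simp
  also have "\<dots> = integral UNIV ?h"
    using set_lebesgue_integral_eq_integral(2)[OF hU] by (simp add: set_lebesgue_integral_def)
  also have "\<dots> = integral UNIV ?g"
    using h \<open>integral UNIV ?h = integral S ?h\<close> by simp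
  also have "\<dots> = (LINT x|lebesgue. ?g x)"
    using set_lebesgue_integral_eq_integral(2)[OF gi] by (simp add: set_lebesgue_integral_def)
  also have "\<dots> = (LINT x|lborel. ?g x)"
    by (rule integral_completion) simp
  finally show ?thesis
    by (simp add: \<Phi>_def)
qed

section \<open>Continuation of the Gaussian substitution to imaginary parameters\<close>

definition complex_perturbation :: "complex \<Rightarrow> real^'n^'n \<Rightarrow> complex^'n^'n" where
  "complex_perturbation w K = (\<chi> i j. (if i = j then 1 else 0) + w * of_real (K $ i $ j))"

lemma det_complex_perturbation_of_real:
  "det (complex_perturbation (of_real t) K) = of_real (det (mat 1 + t *\<^sub>R K))"
  unfolding det_def complex_perturbation_def
  by (simp add: mat_def if_distrib[of complex_of_real] cong: if_cong)

text \<open>The exponent is the bilinear sum of squares rather than a Hermitian norm: this form is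
  holomorphic in w and agrees with |x + w \<Psi> x|^2 for real w.\<close>

lemma gaussian_contour_shift:
  fixes \<Psi> :: "real^'n::{finite,wellorder} \<Rightarrow> real^'n::_"
  assumes lip: "\<And>x y. norm (\<Psi> x - \<Psi> y) \<le> \<kappa> * norm (x - y)" and \<kappa>: "0 \<le> \<kappa>" "\<kappa> < 1"
    and \<Psi>0: "\<Psi> 0 = 0"
    and S: "open S" "negligible (- S)"
    and der: "\<And>x. x \<in> S \<Longrightarrow> (\<Psi> has_derivative ((*v) (K x))) (at x)"
    and K0: "\<And>x. x \<notin> S \<Longrightarrow> K x = 0"
  shows "(LINT x|lborel. exp (- (\<Sum>i\<in>UNIV. (of_real (x $ i) + \<i> * of_real (\<Psi> x $ i))\<^sup>2))
            * det (complex_perturbation \<i> (K x)))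
         = of_real (LINT x|lborel. exp (- (norm (x :: real^'n::_))\<^sup>2))"
proof -
  \<comment> \<open>Any \<open>R\<close> with 1 < R and R \<kappa> < 1 would do: the first puts \<i>
    into \<open>U\<close>, the second gives Gaussian decay on \<open>U\<close>. This choice also
    makes sense for \<kappa> = 0.\<close>
  define R where "R = 2 / (1 + \<kappa>)"
  have R: "R > 1" "R * \<kappa> < 1" using \<kappa> by (auto simp: R_def divide_simps)
  define \<delta> where "\<delta> = (1 - R * \<kappa>)\<^sup>2"
  have \<delta>: "\<delta> > 0" using R by (simp add: \<delta>_def)
  define U where "U = {w. \<bar>Re w\<bar> + \<bar>Im w\<bar> < R}"
  define f where "f w x = exp (- (\<Sum>i\<in>UNIV. (of_real (x $ i) + w * of_real (\<Psi> x $ i))\<^sup>2))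
            * det (complex_perturbation w (K x))" for w x
  define B where "B x = exp (- \<delta> * (norm x)\<^sup>2) * (fact CARD('n) * (1 + R) ^ CARD('n))" for x :: "real^'n::_"
  have cont: "continuous_on UNIV \<Psi>"
    by (rule lipschitz_bound_continuous_on[OF lip \<kappa>(1)])
  have Km: "(\<lambda>x. K x $ i $ j) \<in> borel_measurable borel" for i j
    by (rule borel_measurable_jacobian[OF S(1) cont der K0])
  have of_real_meas: "(\<lambda>x. complex_of_real (h x)) \<in> borel_measurable borel"
    if "h \<in> borel_measurable borel" for h :: "real^'n::_ \<Rightarrow> real"
    using that by simp
  have Kn: "\<bar>K x $ i $ j\<bar> \<le> \<kappa>" for x i j
  proof (cases "x \<in> S")
    case True
    have "\<bar>K x $ i $ j\<bar> = \<bar>(K x *v axis j 1) $ i\<bar>"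
      by (simp add: matrix_vector_mult_basis column_def)
    also have "\<dots> \<le> norm (K x *v axis j 1)" by (rule component_le_norm_cart)
    also have "\<dots> \<le> \<kappa>" using has_derivative_lipschitz_bound[OF der[OF True] lip, of "axis j 1"] by simp
    finally show ?thesis .
  qed (use K0 \<kappa> in auto)
  have U: "open U"
    unfolding U_def by (intro open_Collect_less continuous_intros)
  have cU: "convex U"
  proof (rule convexI)
    fix x y :: complex and u v :: real
    assume *: "x \<in> U" "y \<in> U" "0 \<le> u" "0 \<le> v" "u + v = 1"
    have "\<bar>Re (u *\<^sub>R x + v *\<^sub>R y)\<bar> + \<bar>Im (u *\<^sub>R x + v *\<^sub>R y)\<bar>
      \<le> u * (\<bar>Re x\<bar> + \<bar>Im x\<bar>) + v * (\<bar>Re y\<bar> + \<bar>Im y\<bar>)"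
      using abs_triangle_ineq[of "u * Re x" "v * Re y"] abs_triangle_ineq[of "u * Im x" "v * Im y"] *
      by (simp add: abs_mult algebra_simps)
    also have "\<dots> < R"
      using * convex_bound_lt[of "\<bar>Re x\<bar> + \<bar>Im x\<bar>" R "\<bar>Re y\<bar> + \<bar>Im y\<bar>" u v] by (auto simp: U_def)
    finally show "u *\<^sub>R x + v *\<^sub>R y \<in> U" by (simp add: U_def)
  qed
  have wn: "norm w \<le> R" if "w \<in> U" for w
    using that cmod_le[of w] by (auto simp: U_def)
  have hol: "(\<lambda>w. f w x) holomorphic_on U" for x
    unfolding f_def det_def complex_perturbation_def vec_lambda_beta by (intro holomorphic_intros)
  have meas: "f w \<in> borel_measurable lborel" for w
  proof -
    have "(\<lambda>x. det (complex_perturbation w (K x))) \<in> borel_measurable borel"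
      unfolding det_def complex_perturbation_def vec_lambda_beta using Km
      by (intro borel_measurable_sum borel_measurable_prod borel_measurable_times borel_measurable_add
          borel_measurable_const of_real_meas)
    moreover have "(\<lambda>x. exp (- (\<Sum>i\<in>UNIV. (of_real (x $ i) + w * of_real (\<Psi> x $ i))\<^sup>2))) \<in> borel_measurable borel"
      by (intro borel_measurable_continuous_onI continuous_intros cont)
    ultimately show ?thesis
      unfolding f_def by simp
  qed
  have bound: "norm (f w x) \<le> B x" if w: "w \<in> U" for w x
  proof -
    have "norm (complex_perturbation w (K x) $ i $ j) \<le> 1 + R" for i j
    proof -
      have "norm (complex_perturbation w (K x) $ i $ j) \<le> 1 + norm w * \<bar>K x $ i $ j\<bar>"
        unfolding complex_perturbation_def vec_lambda_beta
        by (rule order_trans[OF norm_triangle_ineq]) (auto simp: norm_mult)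
      also have "\<dots> \<le> 1 + R * 1"
        using wn[OF w] Kn[of x i j] \<kappa> R by (intro add_left_mono mult_mono) auto
      finally show ?thesis by simp
    qed
    then have d: "norm (det (complex_perturbation w (K x))) \<le> fact CARD('n) * (1 + R) ^ CARD('n)"
      by (rule norm_det_le)
    let ?c = "Re w" and ?s = "Im w"
    let ?a = "norm x" and ?p = "norm (\<Psi> x)"
    have "Re (\<Sum>i\<in>UNIV. (of_real (x $ i) + w * of_real (\<Psi> x $ i))\<^sup>2)
      = (\<Sum>i\<in>UNIV. ((x + ?c *\<^sub>R \<Psi> x) $ i)\<^sup>2 - ?s\<^sup>2 * (\<Psi> x $ i)\<^sup>2)"
      by (simp add: power2_eq_square algebra_simps)
    also have "\<dots> = (norm (x + ?c *\<^sub>R \<Psi> x))\<^sup>2 - ?s\<^sup>2 * ?p\<^sup>2"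
      unfolding power2_norm_eq_inner[of "x + ?c *\<^sub>R \<Psi> x"] power2_norm_eq_inner[of "\<Psi> x"] inner_vec_def
      by (simp add: sum_subtractf sum_distrib_left power2_eq_square)
    finally have re: "Re (\<Sum>i\<in>UNIV. (of_real (x $ i) + w * of_real (\<Psi> x $ i))\<^sup>2)
      = (norm (x + ?c *\<^sub>R \<Psi> x))\<^sup>2 - ?s\<^sup>2 * ?p\<^sup>2" .
    have p: "?p \<le> \<kappa> * ?a" using lip[of x 0] \<Psi>0 by simp
    \<comment> \<open>\<open>?u * ?v\<close> factors (|x| - |Re w| |\<Psi> x|)^2 - (Im w)^2 |\<Psi>
      x|^2, a lower bound for the real part of the sum of squares. Both factors are at least (1 - R
      \<kappa>) |x|, which explains the value of \<delta>.\<close>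
    let ?u = "?a - (\<bar>?c\<bar> + \<bar>?s\<bar>) * ?p" and ?v = "?a - (\<bar>?c\<bar> - \<bar>?s\<bar>) * ?p"
    have "(\<bar>?c\<bar> + \<bar>?s\<bar>) * ?p \<le> R * (\<kappa> * ?a)"
      using w p R by (intro mult_mono) (auto simp: U_def)
    then have u: "(1 - R * \<kappa>) * ?a \<le> ?u" by (simp add: algebra_simps)
    have uv: "?u \<le> ?v" by (simp add: algebra_simps)
    have pos: "0 \<le> (1 - R * \<kappa>) * ?a" using R by simp
    have "\<delta> * ?a\<^sup>2 = ((1 - R * \<kappa>) * ?a) * ((1 - R * \<kappa>) * ?a)"
      by (simp add: \<delta>_def power2_eq_square algebra_simps)
    also have "\<dots> \<le> ?u * ?v"
      using u uv pos by (intro mult_mono) auto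
    also have "\<dots> = (?a - \<bar>?c\<bar> * ?p)\<^sup>2 - ?s\<^sup>2 * ?p\<^sup>2"
      by (simp add: power2_eq_square algebra_simps flip: abs_mult)
    also have "\<dots> \<le> (norm (x + ?c *\<^sub>R \<Psi> x))\<^sup>2 - ?s\<^sup>2 * ?p\<^sup>2"
    proof -
      have "?a - \<bar>?c\<bar> * ?p \<le> norm (x + ?c *\<^sub>R \<Psi> x)"
        using norm_diff_ineq[of x "?c *\<^sub>R \<Psi> x"] by simp
      moreover have "0 \<le> ?a - \<bar>?c\<bar> * ?p"
        using u uv pos by (simp add: algebra_simps) (smt (verit) mult_nonneg_nonneg norm_ge_zero)
      ultimately show ?thesis by (simp add: power_mono)
    qed
    finally have e: "norm (exp (- (\<Sum>i\<in>UNIV. (of_real (x $ i) + w * of_real (\<Psi> x $ i))\<^sup>2))) \<le> exp (- \<delta> * ?a\<^sup>2)"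
      unfolding norm_exp_eq_Re uminus_complex.sel re by simp
    show ?thesis
      unfolding f_def B_def norm_mult using e d by (intro mult_mono) auto
  qed
  have Bi: "integrable lborel B"
    unfolding B_def using integrable_gaussian[OF \<delta>, where 'a="real^'n::_"] by simp
  let ?I = "complex_of_real (LINT x|lborel. exp (- (norm (x :: real^'n::_))\<^sup>2))"
  define g where "g w = (LINT x|lborel. f w x) - ?I" for w
  have g: "g holomorphic_on U"
    unfolding g_def
    by (intro holomorphic_on_diff holomorphic_on_const holomorphic_on_lebesgue_integral[OF U hol meas Bi bound])
  \<comment> \<open>For 0 < t < 1 the map t \<Psi> is again \<kappa>-Lipschitz, so the real
    substitution applies to it.\<close>
  have g0: "g (of_real t) = 0" if t: "t \<in> {0<..<1}" for t :: real
  proof -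
    have re: "f (of_real t) x = of_real (exp (- (norm (x + t *\<^sub>R \<Psi> x))\<^sup>2) * det (mat 1 + t *\<^sub>R K x))" for x
    proof -
      have "(\<Sum>i\<in>UNIV. (complex_of_real (x $ i) + of_real t * of_real (\<Psi> x $ i))\<^sup>2)
        = of_real (\<Sum>i\<in>UNIV. ((x + t *\<^sub>R \<Psi> x) $ i)\<^sup>2)" by simp
      also have "\<dots> = of_real ((norm (x + t *\<^sub>R \<Psi> x))\<^sup>2)"
        unfolding power2_norm_eq_inner inner_vec_def by (simp add: power2_eq_square)
      finally show ?thesis
        unfolding f_def det_complex_perturbation_of_real by (simp only: of_real_mult of_real_minus[symmetric] exp_of_real)
    qed
    have "(LINT x|lborel. exp (- (norm (x + t *\<^sub>R \<Psi> x))\<^sup>2) * det (mat 1 + t *\<^sub>R K x))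
        = (LINT x|lborel. exp (- (norm (x :: real^'n::_))\<^sup>2))"
    proof (rule gaussian_change_of_variables[OF _ \<kappa> S])
      show "norm (t *\<^sub>R \<Psi> x - t *\<^sub>R \<Psi> y) \<le> \<kappa> * norm (x - y)" for x y
      proof -
        have "norm (t *\<^sub>R \<Psi> x - t *\<^sub>R \<Psi> y) = t * norm (\<Psi> x - \<Psi> y)"
          using t by (simp flip: scaleR_diff_right)
        also have "\<dots> \<le> norm (\<Psi> x - \<Psi> y)"
          using t by (simp add: mult_left_le_one_le)
        finally show ?thesis using lip[of x y] by simp
      qed
      show "((\<lambda>x. t *\<^sub>R \<Psi> x) has_derivative (*v) (t *\<^sub>R K x)) (at x)" if "x \<in> S" for x
        using has_derivative_scaleR_right[OF der[OF that], of t] by (simp only: scaleR_matrix_vector_assoc)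
    qed (simp add: K0)
    then show ?thesis
      unfolding g_def re by (simp only: integral_complex_of_real) simp
  qed
  \<comment> \<open>The zeros on the real segment accumulate at 0, an interior point of the
    connected set \<open>U\<close>.\<close>
  have "g \<i> = 0"
  proof (rule analytic_continuation[OF g U convex_connected[OF cU], of "of_real ` {0<..<1}" 0])
    show "of_real ` {0<..<1} \<subseteq> U" using R by (auto simp: U_def)
    show "0 islimpt complex_of_real ` {0<..<1}"
      unfolding islimpt_approachable
    proof (intro allI impI)
      fix e :: real assume "e > 0"
      then show "\<exists>x'\<in>complex_of_real ` {0<..<1}. x' \<noteq> 0 \<and> dist x' 0 < e"
        by (intro bexI[of _ "of_real (min (e/2) (1/2))"]) (auto simp: min_def)
    qed
  qed (use R g0 in \<open>auto simp: U_def\<close>)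
  then show ?thesis
    by (simp add: g_def f_def)
qed

subsection \<open>Vectors indexed by a sum type\<close>

text \<open>The library's change of variables theorem requires a well-ordered index type; any order will do.\<close>

definition finite_enum :: "'a::finite \<Rightarrow> nat" where
  "finite_enum = (SOME f. inj f)"

lemma inj_finite_enum: "inj (finite_enum :: 'a::finite \<Rightarrow> nat)"
proof -
  have "\<exists>f :: 'a \<Rightarrow> nat. inj f"
    using finite_imp_inj_to_nat_seg[OF finite[of UNIV]] by blast
  then show ?thesis
    unfolding finite_enum_def by (rule someI_ex)
qed

instantiation sum :: (finite, finite) wellorder
begin

definition less_eq_sum :: "'a + 'b \<Rightarrow> 'a + 'b \<Rightarrow> bool" where
  "less_eq_sum x y \<longleftrightarrow> finite_enum x \<le> finite_enum y"

definition less_sum :: "'a + 'b \<Rightarrow> 'a + 'b \<Rightarrow> bool" where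
  "less_sum x y \<longleftrightarrow> finite_enum x < finite_enum y"

instance
proof
  fix x y z :: "'a + 'b" and P :: "'a + 'b \<Rightarrow> bool"
  show "x = y" if "x \<le> y" "y \<le> x"
    using that injD[OF inj_finite_enum] by (auto simp: less_eq_sum_def)
  show "P x" if "\<And>x. (\<And>y. y < x \<Longrightarrow> P y) \<Longrightarrow> P x"
    using that unfolding less_sum_def by (rule measure_induct_rule)
qed (auto simp: less_eq_sum_def less_sum_def)

end

text \<open>Bridge from the product type, on which the necks live, to a single vector type, on which
  determinants and the change of variables theorem are available. It is an isometry and preserves
  Lebesgue measure.\<close>

definition join_vec :: "(real^'a) \<times> (real^'b) \<Rightarrow> real^('a + 'b)" where
  "join_vec z = (\<chi> k. case k of Inl i \<Rightarrow> fst z $ i | Inr j \<Rightarrow> snd z $ j)"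

definition left_vec :: "real^('a::finite + 'b::finite) \<Rightarrow> real^'a" where
  "left_vec x = (\<chi> i. x $ Inl i)"

definition right_vec :: "real^('a::finite + 'b::finite) \<Rightarrow> real^'b" where
  "right_vec x = (\<chi> j. x $ Inr j)"

lemma join_vec_nth [simp]: "join_vec z $ Inl i = fst z $ i" "join_vec z $ Inr j = snd z $ j"
  by (simp_all add: join_vec_def)

lemma left_right_vec_nth [simp]: "left_vec x $ i = x $ Inl i" "right_vec x $ j = x $ Inr j"
  by (simp_all add: left_vec_def right_vec_def)

lemma left_right_join_vec [simp]: "left_vec (join_vec z) = fst z" "right_vec (join_vec z) = snd z"
  by (simp_all add: vec_eq_iff)

lemma vec_sum_eq_iff: "x = y \<longleftrightarrow> left_vec x = left_vec y \<and> right_vec x = right_vec y"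
proof
  assume *: "left_vec x = left_vec y \<and> right_vec x = right_vec y"
  have "x $ k = y $ k" for k
    using * by (cases k) (auto simp: vec_eq_iff)
  then show "x = y" by (simp add: vec_eq_iff)
qed simp

lemma join_left_right_vec [simp]: "join_vec (left_vec x, right_vec x) = x"
  by (simp add: vec_sum_eq_iff)

lemma bij_join_vec: "bij join_vec"
  by (rule o_bij[of "\<lambda>x. (left_vec x, right_vec x)"]) (auto simp: fun_eq_iff)

lemma linear_join_vec: "linear join_vec"
  by (rule linearI) (simp_all add: vec_sum_eq_iff vec_eq_iff)

lemma linear_left_vec: "linear left_vec" and linear_right_vec: "linear right_vec"
  by (rule linearI; simp add: vec_eq_iff)+

lemma sum_UNIV_sum_type:
  fixes f :: "'a::finite + 'b::finite \<Rightarrow> 'c::comm_monoid_add"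
  shows "(\<Sum>k\<in>UNIV. f k) = (\<Sum>i\<in>UNIV. f (Inl i)) + (\<Sum>j\<in>UNIV. f (Inr j))"
  using sum.Plus[of UNIV UNIV f] by (simp add: UNIV_Plus_UNIV comp_def)

lemma inner_vec_sum: "x \<bullet> y = left_vec x \<bullet> left_vec y + right_vec x \<bullet> right_vec y"
  by (simp add: inner_vec_def sum_UNIV_sum_type)

lemma inner_join_vec [simp]: "join_vec x \<bullet> join_vec y = x \<bullet> y"
  by (simp add: inner_vec_sum inner_prod_def)

lemma norm_join_vec [simp]: "norm (join_vec x) = norm x"
  by (simp add: norm_eq_sqrt_inner)

lemma norm_vec_sum_sq: "(norm x)\<^sup>2 = (norm (left_vec x))\<^sup>2 + (norm (right_vec x))\<^sup>2"
  by (simp add: power2_norm_eq_inner inner_vec_sum)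

lemma left_vec_axis [simp]: "left_vec (axis (Inl i) c) = axis i c" "left_vec (axis (Inr j) c) = 0"
  and right_vec_axis [simp]: "right_vec (axis (Inl i) c) = 0" "right_vec (axis (Inr j) c) = axis j c"
  by (simp_all add: vec_eq_iff axis_def)

lemma bij_betw_join_vec_Basis:
  "bij_betw (join_vec :: (real^'a) \<times> (real^'b) \<Rightarrow> real^('a + 'b)) Basis Basis"
proof -
  have 1: "join_vec (axis i c, 0) = (axis (Inl i) c :: real^('a + 'b))"
      "join_vec (0, axis j c) = (axis (Inr j) c :: real^('a + 'b))" for i j c
    by (simp_all add: vec_sum_eq_iff)
  have "(join_vec :: (real^'a) \<times> (real^'b) \<Rightarrow> real^('a + 'b)) ` Basis = Basis"
  proof
    show "(join_vec :: (real^'a) \<times> (real^'b) \<Rightarrow> real^('a + 'b)) ` Basis \<subseteq> Basis"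
      by (auto simp: Basis_prod_def Basis_vec_def 1)
    show "Basis \<subseteq> (join_vec :: (real^'a) \<times> (real^'b) \<Rightarrow> real^('a + 'b)) ` Basis"
    proof
      fix v :: "real^('a + 'b)" assume "v \<in> Basis"
      then obtain k where v: "v = axis k 1" by (auto simp: Basis_vec_def)
      show "v \<in> (join_vec :: (real^'a) \<times> (real^'b) \<Rightarrow> real^('a + 'b)) ` Basis"
      proof (cases k)
        case (Inl i)
        show ?thesis
          by (rule image_eqI[of _ _ "(axis i 1, 0)"]) (auto simp: v Inl 1 Basis_prod_def Basis_vec_def)
      next
        case (Inr j)
        show ?thesis
          by (rule image_eqI[of _ _ "(0, axis j 1)"]) (auto simp: v Inr 1 Basis_prod_def Basis_vec_def)
      qed
    qed
  qed
  then show ?thesis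
    unfolding bij_betw_def using inj_on_subset[OF bij_is_inj[OF bij_join_vec] subset_UNIV] by blast
qed

text \<open>Standard basis vectors go to standard basis vectors, so boxes pull back to boxes with
  the same side lengths, and box volumes determine Lebesgue measure.\<close>

lemma lborel_distr_join_vec:
  "lborel = distr lborel borel (join_vec :: (real^'a) \<times> (real^'b) \<Rightarrow> real^('a + 'b))"
proof (rule lborel_eqI)
  have m: "(join_vec :: (real^'a) \<times> (real^'b) \<Rightarrow> real^('a + 'b)) \<in> borel_measurable borel"
    by (rule borel_measurable_continuous_onI) (rule linear_continuous_on[OF linear_join_vec[unfolded linear_conv_bounded_linear]])
  fix l u :: "real^('a + 'b)"
  assume le: "\<And>b. b \<in> Basis \<Longrightarrow> l \<bullet> b \<le> u \<bullet> b"
  let ?J = "\<lambda>x. (left_vec x, right_vec x)"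
  have J: "?J x \<bullet> b = x \<bullet> join_vec b" for x b
    by (simp add: inner_vec_sum inner_prod_def)
  have Bs: "(Basis :: (real^('a + 'b)) set) = join_vec ` Basis"
    using bij_betw_imp_surj_on[OF bij_betw_join_vec_Basis] ..
  have v: "join_vec -` box l u = box (?J l) (?J u)"
  proof (rule set_eqI)
    fix z :: "(real^'a) \<times> (real^'b)"
    have "join_vec z \<in> box l u \<longleftrightarrow> (\<forall>b\<in>Basis. l \<bullet> join_vec b < join_vec z \<bullet> join_vec b \<and> join_vec z \<bullet> join_vec b < u \<bullet> join_vec b)"
      unfolding mem_box Bs by (simp only: ball_simps)
    also have "\<dots> \<longleftrightarrow> z \<in> box (?J l) (?J u)"
      unfolding mem_box J inner_join_vec ..
    finally show "z \<in> join_vec -` box l u \<longleftrightarrow> z \<in> box (?J l) (?J u)"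
      unfolding vimage_eq .
  qed
  have "emeasure (distr lborel borel join_vec) (box l u) = emeasure lborel (box (?J l) (?J u))"
    using m by (simp add: emeasure_distr v)
  also have "\<dots> = (\<Prod>b\<in>Basis. (?J u - ?J l) \<bullet> b)"
  proof (rule emeasure_lborel_box)
    fix b :: "(real^'a) \<times> (real^'b)" assume "b \<in> Basis"
    then have "join_vec b \<in> Basis" using bij_betw_imp_surj_on[OF bij_betw_join_vec_Basis] by blast
    then show "?J l \<bullet> b \<le> ?J u \<bullet> b" unfolding J by (rule le)
  qed
  also have "(\<Prod>b\<in>Basis. (?J u - ?J l) \<bullet> b) = (\<Prod>b\<in>Basis. (u - l) \<bullet> join_vec b)"
    unfolding inner_diff_left J ..
  also have "\<dots> = (\<Prod>b\<in>Basis. (u - l) \<bullet> b)"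
    by (rule prod.reindex_bij_betw[OF bij_betw_join_vec_Basis])
  finally show "emeasure (distr lborel borel join_vec) (box l u) = (\<Prod>b\<in>Basis. (u - l) \<bullet> b)" .
qed simp

lemma emeasure_lborel_scale_vec_sum:
  fixes f :: "real^('a::finite + 'b::finite) \<Rightarrow> ennreal"
  assumes \<alpha>\<beta>: "\<alpha> > 0" "\<beta> > 0" and f: "f \<in> borel_measurable borel"
  shows "(\<integral>\<^sup>+x. f x \<partial>lborel) = ennreal (\<alpha> ^ CARD('a) * \<beta> ^ CARD('b)) *
     (\<integral>\<^sup>+x. f (join_vec (\<alpha> *\<^sub>R left_vec x, \<beta> *\<^sub>R right_vec x)) \<partial>lborel)"
proof -
  \<comment> \<open>On basis vectors \<open>c\<close> tells the two blocks apart: the left part of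
    an axis vector vanishes exactly when its index is an \<open>Inr\<close>.\<close>
  define c where "c v = (if left_vec v = 0 then \<beta> else \<alpha>)" for v :: "real^('a + 'b)"
  let ?T = "\<lambda>x. 0 + (\<Sum>j\<in>Basis. (c j * (x \<bullet> j)) *\<^sub>R j)"
  have bas: "(Basis :: (real^('a + 'b)) set) = range (\<lambda>k. axis k 1)"
    by (auto simp: Basis_vec_def)
  have inj: "inj (\<lambda>k. axis k 1 :: real^('a + 'b))"
    by (auto simp: inj_on_def axis_eq_axis)
  have c_ax: "c (axis k 1) = (case k of Inl _ \<Rightarrow> \<alpha> | Inr _ \<Rightarrow> \<beta>)" for k
    by (auto simp: c_def axis_eq_0_iff split: sum.split)
  have T: "?T x = join_vec (\<alpha> *\<^sub>R left_vec x, \<beta> *\<^sub>R right_vec x)" for x :: "real^('a + 'b)"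
  proof -
    have "?T x = (\<Sum>k\<in>UNIV. (c (axis k 1) * (x $ k)) *\<^sub>R axis k 1)"
      unfolding bas by (simp add: sum.reindex[OF inj] inner_axis)
    also have "\<dots> $ k = c (axis k 1) * (x $ k)" for k
      by (simp add: axis_def if_distrib cong: if_cong)
    then have "(\<Sum>k\<in>UNIV. (c (axis k 1) * (x $ k)) *\<^sub>R axis k 1) = join_vec (\<alpha> *\<^sub>R left_vec x, \<beta> *\<^sub>R right_vec x)"
      by (simp add: vec_sum_eq_iff vec_eq_iff c_ax)
    finally show ?thesis .
  qed
  have "(\<Prod>j\<in>(Basis :: (real^('a + 'b)) set). \<bar>c j\<bar>) = (\<Prod>k\<in>UNIV. \<bar>c (axis k 1)\<bar>)"
    unfolding bas by (simp add: prod.reindex[OF inj])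
  also have "\<dots> = \<alpha> ^ CARD('a) * \<beta> ^ CARD('b)"
    using \<alpha>\<beta> prod.Plus[of UNIV UNIV "\<lambda>k::'a + 'b. \<bar>c (axis k 1)\<bar>"] by (simp add: UNIV_Plus_UNIV comp_def c_ax)
  finally have P: "(\<Prod>j\<in>(Basis :: (real^('a + 'b)) set). \<bar>c j\<bar>) = \<alpha> ^ CARD('a) * \<beta> ^ CARD('b)" .
  have Tm: "?T \<in> borel_measurable borel"
    by (intro borel_measurable_continuous_onI continuous_intros)
  have "(lborel :: (real^('a + 'b)) measure) = density (distr lborel borel ?T) (\<lambda>_. (\<Prod>j\<in>Basis. \<bar>c j\<bar>))"
    by (rule lborel_affine_euclidean) (use \<alpha>\<beta> in \<open>auto simp: c_def\<close>)
  then have "(\<integral>\<^sup>+x. f x \<partial>lborel) = (\<integral>\<^sup>+x. f x \<partial>density (distr lborel borel ?T) (\<lambda>_. ennreal (\<alpha> ^ CARD('a) * \<beta> ^ CARD('b))))"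
    unfolding P by simp
  also have "\<dots> = ennreal (\<alpha> ^ CARD('a) * \<beta> ^ CARD('b)) * (\<integral>\<^sup>+x. f (?T x) \<partial>lborel)"
    using f Tm by (simp add: nn_integral_density nn_integral_cmult nn_integral_distr)
  finally show ?thesis
    unfolding T .
qed

subsection \<open>Pairs of short cones\<close>

text \<open>Differentiability is asked only away from the origin: a positively homogeneous map that
  is differentiable at 0 is linear.\<close>

definition short_cone :: "real \<Rightarrow> ('x::euclidean_space \<Rightarrow> 'y::euclidean_space) \<Rightarrow> bool" where
  "short_cone \<kappa> F \<longleftrightarrow> (\<forall>p p'. norm (F p - F p') \<le> \<kappa> * norm (p - p')) \<and>
     (\<forall>t\<ge>0. \<forall>p. F (t *\<^sub>R p) = t *\<^sub>R F p) \<and> (\<forall>p. p \<noteq> 0 \<longrightarrow> F differentiable (at p))"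

definition cone_length :: "('x::real_normed_vector \<Rightarrow> 'y::real_normed_vector) \<Rightarrow> 'x \<Rightarrow> real" where
  "cone_length F p = sqrt ((norm p)\<^sup>2 - (norm (F p))\<^sup>2)"

lemma short_coneD:
  assumes "short_cone \<kappa> F"
  shows short_cone_lip: "norm (F p - F p') \<le> \<kappa> * norm (p - p')"
    and short_cone_scale: "t \<ge> 0 \<Longrightarrow> F (t *\<^sub>R p) = t *\<^sub>R F p"
    and short_cone_diff: "p \<noteq> 0 \<Longrightarrow> F differentiable (at p)"
  using assms by (auto simp: short_cone_def)

lemma short_cone_zero: "short_cone \<kappa> F \<Longrightarrow> F 0 = 0"
  using short_cone_scale[of \<kappa> F 0 0] by simp

lemma short_cone_norm_le: "short_cone \<kappa> F \<Longrightarrow> norm (F p) \<le> \<kappa> * norm p"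
  using short_cone_lip[of \<kappa> F p 0] by (simp add: short_cone_zero)

lemma short_cone_continuous_on: "short_cone \<kappa> F \<Longrightarrow> 0 \<le> \<kappa> \<Longrightarrow> continuous_on S F"
  by (rule lipschitz_bound_continuous_on[OF short_cone_lip])

text \<open>In F y = t F(y / t) the outer factor t cancels the inner factor 1 / t upon
  differentiation.\<close>

lemma homogeneous_has_derivative_scale:
  fixes F :: "'x::real_normed_vector \<Rightarrow> 'y::real_normed_vector"
  assumes hom: "\<And>t p. t \<ge> 0 \<Longrightarrow> F (t *\<^sub>R p) = t *\<^sub>R F p"
    and d: "(F has_derivative F') (at p)" and t: "t > 0"
  shows "(F has_derivative F') (at (t *\<^sub>R p))"
proof -
  have lin: "linear F'"
    using d by (rule has_derivative_linear)
  have "((\<lambda>y. y /\<^sub>R t) has_derivative (\<lambda>h. h /\<^sub>R t)) (at (t *\<^sub>R p))"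
    by (auto intro!: derivative_eq_intros)
  from has_derivative_compose[OF this, of F F'] d t
  have "((\<lambda>y. F (y /\<^sub>R t)) has_derivative (\<lambda>h. F' (h /\<^sub>R t))) (at (t *\<^sub>R p))"
    by simp
  from has_derivative_scaleR_right[OF this, of t]
  have "((\<lambda>y. t *\<^sub>R F (y /\<^sub>R t)) has_derivative (\<lambda>h. t *\<^sub>R F' (h /\<^sub>R t))) (at (t *\<^sub>R p))" .
  moreover have "t *\<^sub>R F (y /\<^sub>R t) = F y" for y
    using hom[of t "y /\<^sub>R t"] t by simp
  moreover have "t *\<^sub>R F' (h /\<^sub>R t) = F' h" for h
    using linear_scale[OF lin, of t "h /\<^sub>R t"] t by simp
  ultimately show ?thesis
    by simp
qed

lemma short_cone_derivative_scale:
  assumes F: "short_cone \<kappa> F" and p: "p \<noteq> 0" and t: "t > 0"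
  shows "frechet_derivative F (at (t *\<^sub>R p)) = frechet_derivative F (at p)"
proof -
  have "(F has_derivative frechet_derivative F (at p)) (at p)"
    using short_cone_diff[OF F p] by (simp add: frechet_derivative_works)
  from homogeneous_has_derivative_scale[OF short_cone_scale[OF F] this t]
  show ?thesis
    by (rule frechet_derivative_at[symmetric])
qed

lemma cone_length_sq_ge:
  assumes F: "short_cone \<kappa> F" and \<kappa>: "0 \<le> \<kappa>" "\<kappa> < 1"
  shows "(1 - \<kappa>\<^sup>2) * (norm p)\<^sup>2 \<le> (norm p)\<^sup>2 - (norm (F p))\<^sup>2"
proof -
  have "(norm (F p))\<^sup>2 \<le> (\<kappa> * norm p)\<^sup>2"
    by (rule power_mono[OF short_cone_norm_le[OF F]]) simp
  then show ?thesis by (simp add: algebra_simps)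
qed

lemma cone_length_props:
  assumes F: "short_cone \<kappa> F" and \<kappa>: "0 \<le> \<kappa>" "\<kappa> < 1"
  shows cone_length_sq: "(cone_length F p)\<^sup>2 = (norm p)\<^sup>2 - (norm (F p))\<^sup>2"
    and cone_length_nonneg: "0 \<le> cone_length F p"
    and cone_length_ge: "sqrt (1 - \<kappa>\<^sup>2) * norm p \<le> cone_length F p"
    and cone_length_le: "cone_length F p \<le> norm p"
    and cone_length_pos: "p \<noteq> 0 \<Longrightarrow> 0 < cone_length F p"
    and cone_length_scale: "t \<ge> 0 \<Longrightarrow> cone_length F (t *\<^sub>R p) = t * cone_length F p"
    and cone_length_continuous_on: "continuous_on S (cone_length F)"
proof -
  have k: "0 < 1 - \<kappa>\<^sup>2" using \<kappa> by (simp add: abs_square_less_1)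
  have *: "0 \<le> (norm p)\<^sup>2 - (norm (F p))\<^sup>2"
    by (rule order_trans[OF _ cone_length_sq_ge[OF F \<kappa>]]) (use k in simp)
  show "(cone_length F p)\<^sup>2 = (norm p)\<^sup>2 - (norm (F p))\<^sup>2" and "0 \<le> cone_length F p"
    using * by (simp_all add: cone_length_def)
  have "sqrt ((1 - \<kappa>\<^sup>2) * (norm p)\<^sup>2) \<le> cone_length F p"
    unfolding cone_length_def by (rule real_sqrt_le_mono[OF cone_length_sq_ge[OF F \<kappa>]])
  then show ge: "sqrt (1 - \<kappa>\<^sup>2) * norm p \<le> cone_length F p"
    by (simp add: real_sqrt_mult)
  have "cone_length F p \<le> sqrt ((norm p)\<^sup>2)"
    unfolding cone_length_def by (rule real_sqrt_le_mono) simp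
  then show "cone_length F p \<le> norm p" by simp
  show "0 < cone_length F p" if "p \<noteq> 0"
    by (rule less_le_trans[OF _ ge]) (use k that in simp)
  show "cone_length F (t *\<^sub>R p) = t * cone_length F p" if "t \<ge> 0"
  proof -
    have "(norm (t *\<^sub>R p))\<^sup>2 - (norm (F (t *\<^sub>R p)))\<^sup>2 = t\<^sup>2 * ((norm p)\<^sup>2 - (norm (F p))\<^sup>2)"
      using that by (simp add: short_cone_scale[OF F] power_mult_distrib algebra_simps)
    then show ?thesis
      using that by (simp add: cone_length_def real_sqrt_mult)
  qed
  show "continuous_on S (cone_length F)"
    unfolding cone_length_def by (intro continuous_intros short_cone_continuous_on[OF F \<kappa>(1)])
qed

lemma integral_gaussian_pos: "0 < (LINT x|lborel. exp (- (norm (x :: 'a::euclidean_space))\<^sup>2))"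
proof -
  have int: "integrable lborel (\<lambda>x :: 'a. exp (- (norm x)\<^sup>2))"
    using integrable_gaussian[of 1, where 'a='a] by simp
  have "(LINT x|lborel. exp (- (norm (x :: 'a))\<^sup>2)) \<noteq> 0"
  proof
    assume "(LINT x|lborel. exp (- (norm (x :: 'a))\<^sup>2)) = 0"
    then have "AE x in lborel. exp (- (norm (x :: 'a))\<^sup>2) = 0"
      using integral_nonneg_eq_0_iff_AE[OF int] by simp
    then have "UNIV \<in> null_sets (lborel :: 'a measure)"
      using AE_iff_null[of lborel "\<lambda>_ :: 'a. False"] by simp
    then show False
      using emeasure_lborel_UNIV[where 'a='a] by (auto simp: null_sets_def)
  qed
  moreover have "0 \<le> (LINT x|lborel. exp (- (norm (x :: 'a))\<^sup>2))" by simp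
  ultimately show ?thesis by linarith
qed

section \<open>The substitution maps and their Jacobians\<close>

locale neck_graphs =
  fixes F :: "real^'a \<Rightarrow> real^'b" and G :: "real^'b \<Rightarrow> real^'a" and \<kappa> :: real
  assumes \<kappa>: "0 \<le> \<kappa>" "\<kappa> < 1" and F: "short_cone \<kappa> F" and G: "short_cone \<kappa> G"
begin

text \<open>\<open>s = 1\<close> yields the map \<open>\<Phi>\<close>, and \<open>s = - 1\<close> the direction \<open>\<Psi>\<close> in which the contour is shifted.\<close>

definition perturb :: "real \<Rightarrow> real^('a + 'b) \<Rightarrow> real^('a + 'b)" where
  "perturb s x = join_vec (s *\<^sub>R G (right_vec x), F (left_vec x))"

text \<open>At these points both \<open>F\<close> and \<open>G\<close> are differentiable; what is
  left out is a union of two proper subspaces.\<close>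

definition regular :: "(real^('a + 'b)) set" where
  "regular = {x. left_vec x \<noteq> 0 \<and> right_vec x \<noteq> 0}"

text \<open>The value 0 off \<open>regular\<close> fits the hypotheses of the Gaussian lemmas and
  makes the entries Borel functions on the whole space.\<close>

definition jacobian :: "real \<Rightarrow> real^('a + 'b) \<Rightarrow> real^('a + 'b)^('a + 'b)" where
  "jacobian s x = (if x \<in> regular then matrix (\<lambda>h. join_vec
     (s *\<^sub>R frechet_derivative G (at (right_vec x)) (right_vec h),
      frechet_derivative F (at (left_vec x)) (left_vec h))) else 0)"

definition jac_det :: "real^('a + 'b) \<Rightarrow> real" where
  "jac_det x = det (mat 1 + jacobian 1 x)"

definition lengths :: "real^('a + 'b) \<Rightarrow> real \<times> real" where
  "lengths x = (cone_length F (left_vec x), cone_length G (right_vec x))"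

lemma continuous_left_right:
  "continuous_on S (left_vec :: real^('a + 'b) \<Rightarrow> _)" "continuous_on S (right_vec :: real^('a + 'b) \<Rightarrow> _)"
  using linear_left_vec linear_right_vec
  by (auto intro: linear_continuous_on simp: linear_conv_bounded_linear)

text \<open>The two components of \<open>perturb\<close> depend on disjoint sets of variables, so by
  Pythagoras the constant does not grow beyond \<kappa>.\<close>

lemma perturb_lip:
  assumes s: "\<bar>s\<bar> = 1"
  shows "norm (perturb s x - perturb s y) \<le> \<kappa> * norm (x - y)"
proof (rule power2_le_imp_le)
  have "perturb s x - perturb s y = join_vec (s *\<^sub>R (G (right_vec x) - G (right_vec y)), F (left_vec x) - F (left_vec y))"
    by (simp add: perturb_def vec_sum_eq_iff vec_eq_iff algebra_simps)
  then have "(norm (perturb s x - perturb s y))\<^sup>2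
      = (norm (G (right_vec x) - G (right_vec y)))\<^sup>2 + (norm (F (left_vec x) - F (left_vec y)))\<^sup>2"
    using s by (simp add: norm_Pair)
  also have "\<dots> \<le> (\<kappa> * norm (right_vec x - right_vec y))\<^sup>2 + (\<kappa> * norm (left_vec x - left_vec y))\<^sup>2"
    by (intro add_mono power_mono short_cone_lip F G) auto
  also have "\<dots> = (\<kappa> * norm (x - y))\<^sup>2"
    using norm_vec_sum_sq[of "x - y"]
    by (simp add: power_mult_distrib algebra_simps linear_diff[OF linear_left_vec] linear_diff[OF linear_right_vec])
  finally show "(norm (perturb s x - perturb s y))\<^sup>2 \<le> (\<kappa> * norm (x - y))\<^sup>2" .
qed (use \<kappa> in simp)

lemma perturb_zero: "perturb s 0 = 0"
  using short_cone_zero[OF F] short_cone_zero[OF G]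
  by (simp add: perturb_def vec_sum_eq_iff linear_0[OF linear_left_vec] linear_0[OF linear_right_vec])

lemma regular_open: "open regular"
  unfolding regular_def by (intro open_Collect_conj open_Collect_neq continuous_left_right continuous_intros)

lemma regular_negligible: "negligible (- regular)"
proof -
  have 1: "linear (left_vec :: real^('a + 'b) \<Rightarrow> _)" "linear (right_vec :: real^('a + 'b) \<Rightarrow> _)"
    by (rule linear_left_vec linear_right_vec)+
  have sub: "subspace {x :: real^('a + 'b). left_vec x = 0}" "subspace {x :: real^('a + 'b). right_vec x = 0}"
    using linear_subspace_vimage[OF 1(1), of "{0}"] linear_subspace_vimage[OF 1(2), of "{0}"]
    by (simp_all add: vimage_def)
  have "axis (Inl undefined) 1 \<notin> {x :: real^('a + 'b). left_vec x = 0}"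
       "axis (Inr undefined) 1 \<notin> {x :: real^('a + 'b). right_vec x = 0}"
    by (simp_all add: axis_eq_0_iff)
  then have "{x :: real^('a + 'b). left_vec x = 0} \<noteq> UNIV" "{x :: real^('a + 'b). right_vec x = 0} \<noteq> UNIV"
    by blast+
  then have "negligible {x :: real^('a + 'b). left_vec x = 0}" "negligible {x :: real^('a + 'b). right_vec x = 0}"
    using sub dim_eq_full by (metis negligible_lowdim dim_subset_UNIV order_less_le span_eq_iff)+
  moreover have "- regular = {x. left_vec x = 0} \<union> {x. right_vec x = 0}"
    by (auto simp: regular_def)
  ultimately show ?thesis by simp
qed

lemma regular_null: "emeasure lborel (- regular) = 0"
  using regular_negligible regular_open
  by (simp add: negligible_iff_emeasure0 closed_Compl borel_closed)

lemma derivs: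
  assumes "x \<in> regular"
  shows F_der: "(F has_derivative frechet_derivative F (at (left_vec x))) (at (left_vec x))"
    and G_der: "(G has_derivative frechet_derivative G (at (right_vec x))) (at (right_vec x))"
  using short_cone_diff[OF F, of "left_vec x"] short_cone_diff[OF G, of "right_vec x"] assms
  by (simp_all add: regular_def frechet_derivative_works)

lemma perturb_deriv:
  assumes x: "x \<in> regular"
  shows "(perturb s has_derivative ((*v) (jacobian s x))) (at x)"
proof -
  let ?D = "\<lambda>h. join_vec (s *\<^sub>R frechet_derivative G (at (right_vec x)) (right_vec h),
      frechet_derivative F (at (left_vec x)) (left_vec h))"
  have bl: "bounded_linear (left_vec :: real^('a + 'b) \<Rightarrow> _)" "bounded_linear (right_vec :: real^('a + 'b) \<Rightarrow> _)"
      "bounded_linear (join_vec :: _ \<Rightarrow> real^('a + 'b))"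
    using linear_left_vec linear_right_vec linear_join_vec by (simp_all add: linear_conv_bounded_linear)
  have F': "((\<lambda>x. F (left_vec x)) has_derivative (\<lambda>h. frechet_derivative F (at (left_vec x)) (left_vec h))) (at x)"
    by (rule has_derivative_compose[OF bounded_linear_imp_has_derivative[OF bl(1)] F_der[OF x]])
  have G': "((\<lambda>x. G (right_vec x)) has_derivative (\<lambda>h. frechet_derivative G (at (right_vec x)) (right_vec h))) (at x)"
    by (rule has_derivative_compose[OF bounded_linear_imp_has_derivative[OF bl(2)] G_der[OF x]])
  have *: "(perturb s has_derivative ?D) (at x)"
    unfolding perturb_def
    by (intro bounded_linear.has_derivative[OF bl(3)] has_derivative_Pair has_derivative_scaleR_right F' G')
  then have "(*v) (jacobian s x) = ?D"
    using x matrix_works[OF has_derivative_linear[OF *, folded linear_matrix_vector_mul_eq]]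
    by (auto simp: jacobian_def)
  then show ?thesis using * by simp
qed

lemma jacobian_outside: "x \<notin> regular \<Longrightarrow> jacobian s x = 0"
  by (simp add: jacobian_def)

lemma jacobian_nth:
  "jacobian s x $ Inl i $ Inl i' = 0"
  "jacobian s x $ Inr j $ Inr j' = 0"
  "jacobian s x $ Inl i $ Inr j = s * jacobian 1 x $ Inl i $ Inr j"
  "jacobian s x $ Inr j $ Inl i = jacobian 1 x $ Inr j $ Inl i"
proof -
  have "x \<in> regular \<Longrightarrow> frechet_derivative F (at (left_vec x)) 0 = 0"
    "x \<in> regular \<Longrightarrow> frechet_derivative G (at (right_vec x)) 0 = 0"
    using derivs by (blast intro: linear_0 has_derivative_linear)+
  then show "jacobian s x $ Inl i $ Inl i' = 0" "jacobian s x $ Inr j $ Inr j' = 0"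
    "jacobian s x $ Inl i $ Inr j = s * jacobian 1 x $ Inl i $ Inr j"
    "jacobian s x $ Inr j $ Inl i = jacobian 1 x $ Inr j $ Inl i"
    by (simp_all add: jacobian_def matrix_def)
qed

lemma jacobian_norm_le:
  assumes "\<bar>s\<bar> = 1"
  shows "norm (jacobian s x *v h) \<le> \<kappa> * norm h"
proof (cases "x \<in> regular")
  case True
  show ?thesis
    by (rule has_derivative_lipschitz_bound[OF perturb_deriv[OF True] perturb_lip[OF assms]])
qed (use \<kappa> in \<open>simp add: jacobian_outside\<close>)

lemma jac_det_pos: "0 < jac_det x"
  unfolding jac_det_def by (rule det_mat_add_contraction_pos[OF jacobian_norm_le \<kappa>(2)]) simp

lemma perturb_continuous: "\<bar>s\<bar> = 1 \<Longrightarrow> continuous_on S (perturb s)"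
  by (rule lipschitz_bound_continuous_on[OF perturb_lip \<kappa>(1)])

lemma jac_det_measurable: "jac_det \<in> borel_measurable borel"
proof -
  have "(\<lambda>x. jacobian 1 x $ i $ j) \<in> borel_measurable borel" for i j
    by (rule borel_measurable_jacobian[OF regular_open perturb_continuous perturb_deriv jacobian_outside]) simp_all
  then show ?thesis
    unfolding jac_det_def[abs_def] det_def by simp
qed

lemma jac_det_le: "jac_det x \<le> fact CARD('a + 'b) * 2 ^ CARD('a + 'b)"
proof -
  have "norm ((mat 1 + jacobian 1 x) $ i $ j) \<le> 2" for i j
  proof -
    have "\<bar>jacobian 1 x $ i $ j\<bar> = \<bar>(jacobian 1 x *v axis j 1) $ i\<bar>"
      by (simp add: matrix_vector_mult_basis column_def)
    also have "\<dots> \<le> norm (jacobian 1 x *v axis j 1)" by (rule component_le_norm_cart)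
    also have "\<dots> \<le> 1" using jacobian_norm_le[of 1 x "axis j 1"] \<kappa> by simp
    finally show ?thesis by (auto simp: mat_def)
  qed
  then have "norm (det (mat 1 + jacobian 1 x)) \<le> fact CARD('a + 'b) * 2 ^ CARD('a + 'b)"
    by (rule norm_det_le)
  then show ?thesis by (simp add: jac_det_def)
qed

lemma jac_det_scale:
  assumes "\<alpha> > 0" "\<beta> > 0"
  shows "jac_det (join_vec (\<alpha> *\<^sub>R left_vec x, \<beta> *\<^sub>R right_vec x)) = jac_det x"
proof -
  have "jacobian 1 (join_vec (\<alpha> *\<^sub>R left_vec x, \<beta> *\<^sub>R right_vec x)) = jacobian 1 x"
    using assms by (auto simp: jacobian_def regular_def short_cone_derivative_scale[OF F] short_cone_derivative_scale[OF G])
  then show ?thesis by (simp add: jac_det_def)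
qed

text \<open>Conjugation by \<open>diag(1, \<i>)\<close> turns the complex Jacobian of the shifted contour into the real one.\<close>

lemma det_complex_jacobian: "det (complex_perturbation \<i> (jacobian (- 1) x)) = of_real (jac_det x)"
proof -
  define \<sigma> :: "'a + 'b \<Rightarrow> complex" where "\<sigma> k = (case k of Inl _ \<Rightarrow> 1 | Inr _ \<Rightarrow> \<i>)" for k
  let ?S = "(\<chi> k l. if k = l then \<sigma> k else 0) :: complex^('a + 'b)^('a + 'b)"
  let ?A = "complex_perturbation \<i> (jacobian (- 1) x)" and ?B = "complex_perturbation 1 (jacobian 1 x)"
  have "?A $ k $ l * \<sigma> l = \<sigma> k * ?B $ k $ l" for k l
    using jacobian_nth(1,2)[of _ x] jacobian_nth(3,4)[of "- 1" x]
    by (cases k; cases l) (simp_all add: complex_perturbation_def \<sigma>_def mult_ac)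
  then have "?A ** ?S = ?S ** ?B"
    by (simp add: matrix_matrix_mult_def vec_eq_iff if_distrib if_distribR cong: if_cong)
  then have "det ?A * det ?S = det ?S * det ?B"
    by (simp add: det_mul[symmetric])
  moreover have "det ?S \<noteq> 0"
    by (subst det_diagonal) (auto simp: \<sigma>_def split: sum.split)
  ultimately have "det ?A = det ?B" by simp
  then show ?thesis
    using det_complex_perturbation_of_real[of 1 "jacobian 1 x"] by (simp add: jac_det_def)
qed

end

subsection \<open>The distribution of the pseudo-lengths\<close>

text \<open>Holds without integrability, because the Bochner integral of a non-integrable function
  is 0 by convention. The lower bound on the Gaussian mass then requires no integrability of the
  shifted integrand.\<close>

lemma integral_le_nn_integral_norm:
  fixes f :: "'x \<Rightarrow> 'y::{banach,second_countable_topology}"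
  shows "ennreal (norm (integral\<^sup>L M f)) \<le> (\<integral>\<^sup>+x. ennreal (norm (f x)) \<partial>M)"
  by (cases "integrable M f") (auto simp: integral_norm_bound_ennreal not_integrable_integral_eq)

context neck_graphs
begin

definition length_measure :: "(real \<times> real) measure" where
  "length_measure = distr (density lborel (\<lambda>x. ennreal (jac_det x))) borel lengths"

lemma lengths_continuous: "continuous_on S lengths"
  unfolding lengths_def
  by (intro continuous_on_Pair continuous_on_compose2[OF cone_length_continuous_on[OF F \<kappa>, of UNIV]]
      continuous_on_compose2[OF cone_length_continuous_on[OF G \<kappa>, of UNIV]] continuous_left_right subset_UNIV)

lemma lengths_measurable: "lengths \<in> borel_measurable borel"
  by (rule borel_measurable_continuous_onI[OF lengths_continuous])

lemma nn_integral_length_measure: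
  assumes h: "h \<in> borel_measurable borel"
  shows "(\<integral>\<^sup>+z. h z \<partial>length_measure) = (\<integral>\<^sup>+x. ennreal (jac_det x) * h (lengths x) \<partial>lborel)"
proof -
  have "lengths \<in> measurable (density lborel (\<lambda>x. ennreal (jac_det x))) borel"
    using lengths_measurable by simp
  then have "(\<integral>\<^sup>+z. h z \<partial>length_measure) = (\<integral>\<^sup>+x. h (lengths x) \<partial>density lborel (\<lambda>x. ennreal (jac_det x)))"
    unfolding length_measure_def using h by (subst nn_integral_distr) simp_all
  also have "\<dots> = (\<integral>\<^sup>+x. ennreal (jac_det x) * h (lengths x) \<partial>lborel)"
    using jac_det_measurable measurable_compose[OF lengths_measurable h]
    by (intro nn_integral_density) simp_all
  finally show ?thesis .
qed

lemma sets_length_measure [simp]: "sets length_measure = sets borel"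
  by (simp add: length_measure_def)

lemma emeasure_length_measure:
  assumes "A \<in> sets borel"
  shows "emeasure length_measure A = (\<integral>\<^sup>+x. ennreal (jac_det x) * indicator A (lengths x) \<partial>lborel)"
  using nn_integral_length_measure[of "indicator A"] assms by simp

text \<open>\<Psi> exchanges the blocks: - |F p|^2 arises in the right component but combines with
  |p|^2 into the squared length of (p, F p), and likewise for \<open>G\<close>. The cross terms add
  up to twice x \<bullet> \<Psi> x.\<close>

lemma contour_exponent:
  "(\<Sum>i\<in>UNIV. (of_real (x $ i) + \<i> * of_real (perturb (- 1) x $ i))\<^sup>2)
   = complex_of_real ((fst (lengths x))\<^sup>2 + (snd (lengths x))\<^sup>2)
     + 2 * \<i> * of_real (right_vec x \<bullet> F (left_vec x) - left_vec x \<bullet> G (right_vec x))"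
proof -
  have "(\<Sum>i\<in>UNIV. (of_real (x $ i) + \<i> * of_real (perturb (- 1) x $ i))\<^sup>2)
    = (\<Sum>i\<in>UNIV. complex_of_real (x $ i * x $ i - perturb (- 1) x $ i * perturb (- 1) x $ i)
        + 2 * \<i> * of_real (x $ i * perturb (- 1) x $ i))"
    by (rule sum.cong) (simp_all add: power2_eq_square algebra_simps)
  also have "\<dots> = complex_of_real (x \<bullet> x - perturb (- 1) x \<bullet> perturb (- 1) x) + 2 * \<i> * of_real (x \<bullet> perturb (- 1) x)"
    by (simp add: sum.distrib sum_subtractf sum_distrib_left inner_vec_def)
  also have "x \<bullet> x - perturb (- 1) x \<bullet> perturb (- 1) x = (fst (lengths x))\<^sup>2 + (snd (lengths x))\<^sup>2"
    by (simp add: lengths_def perturb_def cone_length_sq[OF F \<kappa>] cone_length_sq[OF G \<kappa>] inner_vec_sum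
        power2_norm_eq_inner)
  also have "x \<bullet> perturb (- 1) x = right_vec x \<bullet> F (left_vec x) - left_vec x \<bullet> G (right_vec x)"
    by (simp add: perturb_def inner_vec_sum)
  finally show ?thesis .
qed

lemma gaussian_contour_identity:
  "(LINT x|lborel. exp (- (complex_of_real ((fst (lengths x))\<^sup>2 + (snd (lengths x))\<^sup>2)
     + 2 * \<i> * of_real (right_vec x \<bullet> F (left_vec x) - left_vec x \<bullet> G (right_vec x)))) * of_real (jac_det x))
   = of_real (LINT x|lborel. exp (- (norm (x :: real^('a + 'b)))\<^sup>2))"
  using gaussian_contour_shift[OF perturb_lip \<kappa> perturb_zero regular_open regular_negligible perturb_deriv
      jacobian_outside, of "- 1"]
  unfolding contour_exponent det_complex_jacobian by simp

lemma gaussian_weight_measurable: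
  "(\<lambda>z. ennreal (exp (- ((fst z)\<^sup>2 + (snd z)\<^sup>2)))) \<in> borel_measurable (borel :: (real \<times> real) measure)"
  by (intro measurable_compose[OF _ measurable_ennreal] borel_measurable_continuous_onI continuous_intros)

lemma gaussian_length_measure_ge:
  "ennreal (LINT x|lborel. exp (- (norm (x :: real^('a + 'b)))\<^sup>2))
   \<le> (\<integral>\<^sup>+z. ennreal (exp (- ((fst z)\<^sup>2 + (snd z)\<^sup>2))) \<partial>length_measure)"
proof -
  let ?f = "\<lambda>x. exp (- (complex_of_real ((fst (lengths x))\<^sup>2 + (snd (lengths x))\<^sup>2)
     + 2 * \<i> * of_real (right_vec x \<bullet> F (left_vec x) - left_vec x \<bullet> G (right_vec x)))) * of_real (jac_det x)"
  have "ennreal (LINT x|lborel. exp (- (norm (x :: real^('a + 'b)))\<^sup>2)) = ennreal (norm (LINT x|lborel. ?f x))"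
    unfolding gaussian_contour_identity using integral_gaussian_pos[where 'a="real^('a + 'b)"] by simp
  also have "\<dots> \<le> (\<integral>\<^sup>+x. ennreal (norm (?f x)) \<partial>lborel)"
    by (rule integral_le_nn_integral_norm)
  also have "\<dots> = (\<integral>\<^sup>+x. ennreal (jac_det x) * ennreal (exp (- ((fst (lengths x))\<^sup>2 + (snd (lengths x))\<^sup>2))) \<partial>lborel)"
    using jac_det_pos
    by (intro nn_integral_cong) (simp add: norm_mult less_imp_le abs_of_pos mult.commute flip: ennreal_mult)
  also have "\<dots> = (\<integral>\<^sup>+z. ennreal (exp (- ((fst z)\<^sup>2 + (snd z)\<^sup>2))) \<partial>length_measure)"
    by (rule nn_integral_length_measure[OF gaussian_weight_measurable, symmetric])
  finally show ?thesis .
qed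

lemma gaussian_length_measure_eq:
  assumes adj: "\<And>p q. p \<bullet> G q = q \<bullet> F p"
  shows "(\<integral>\<^sup>+z. ennreal (exp (- ((fst z)\<^sup>2 + (snd z)\<^sup>2))) \<partial>length_measure)
    = ennreal (LINT x|lborel. exp (- (norm (x :: real^('a + 'b)))\<^sup>2))"
proof -
  let ?I = "LINT x|lborel. exp (- (norm (x :: real^('a + 'b)))\<^sup>2)"
  let ?f = "\<lambda>x. jac_det x * exp (- ((fst (lengths x))\<^sup>2 + (snd (lengths x))\<^sup>2))"
  have "(LINT x|lborel. complex_of_real (?f x)) = of_real ?I"
    unfolding gaussian_contour_identity[symmetric]
    by (simp only: adj diff_self of_real_0 mult_zero_left mult_zero_right add_0_right of_real_minus[symmetric] exp_of_real
        of_real_mult mult.commute)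
  then have I: "(LINT x|lborel. ?f x) = ?I"
    unfolding integral_complex_of_real by (simp only: of_real_eq_iff)
  \<comment> \<open>A non-integrable function would have integral 0, but this integral is a positive
    number.\<close>
  have "integrable lborel ?f"
    using I integral_gaussian_pos[where 'a="real^('a + 'b)"] not_integrable_integral_eq[of lborel ?f] by fastforce
  then have "(\<integral>\<^sup>+x. ennreal (?f x) \<partial>lborel) = ennreal ?I"
    unfolding I[symmetric] by (intro nn_integral_eq_integral) (simp_all add: jac_det_pos[THEN less_imp_le])
  then show ?thesis
    unfolding nn_integral_length_measure[OF gaussian_weight_measurable]
    using jac_det_pos by (simp add: ennreal_mult less_imp_le)
qed

lemma lengths_scale:
  assumes "\<alpha> > 0" "\<beta> > 0"
  shows "lengths (join_vec (\<alpha> *\<^sub>R left_vec x, \<beta> *\<^sub>R right_vec x)) = (\<alpha> * fst (lengths x), \<beta> * snd (lengths x))"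
  using assms by (simp add: lengths_def cone_length_scale[OF F \<kappa>] cone_length_scale[OF G \<kappa>])

lemma lengths_pos: "x \<in> regular \<Longrightarrow> 0 < fst (lengths x) \<and> 0 < snd (lengths x)"
  by (simp add: lengths_def regular_def cone_length_pos[OF F \<kappa>] cone_length_pos[OF G \<kappa>])

lemma indicator_lengths_measurable:
  "A \<in> sets borel \<Longrightarrow> (\<lambda>x. indicator A (lengths x) :: ennreal) \<in> borel_measurable borel"
  by (rule measurable_compose[OF lengths_measurable]) simp

text \<open>Scaling p by \<alpha> and q by \<beta> leaves \<open>jac_det\<close> fixed, scales the
  two lengths and multiplies Lebesgue measure by \<alpha>^a \<beta>^b. As quadrants generate the
  Borel sets, the measure is thereby known up to its mass on the unit quadrant.\<close>

lemma emeasure_length_measure_atMost: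
  "emeasure length_measure {..(\<alpha>, \<beta>)} =
    (if 0 < \<alpha> \<and> 0 < \<beta> then ennreal (\<alpha> ^ CARD('a) * \<beta> ^ CARD('b)) * emeasure length_measure {..(1, 1)} else 0)"
proof (cases "0 < \<alpha> \<and> 0 < \<beta>")
  case True
  let ?f = "\<lambda>x. ennreal (jac_det x) * indicator {..(\<alpha>, \<beta>)} (lengths x)"
  have f: "?f \<in> borel_measurable borel"
    using jac_det_measurable indicator_lengths_measurable[of "{..(\<alpha>, \<beta>)}"] by simp
  have "emeasure length_measure {..(\<alpha>, \<beta>)} = (\<integral>\<^sup>+x. ?f x \<partial>lborel)"
    by (rule emeasure_length_measure) simp
  also have "\<dots> = ennreal (\<alpha> ^ CARD('a) * \<beta> ^ CARD('b)) * (\<integral>\<^sup>+x. ?f (join_vec (\<alpha> *\<^sub>R left_vec x, \<beta> *\<^sub>R right_vec x)) \<partial>lborel)"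
    using True f by (intro emeasure_lborel_scale_vec_sum) auto
  also have "?f (join_vec (\<alpha> *\<^sub>R left_vec x, \<beta> *\<^sub>R right_vec x)) = ennreal (jac_det x) * indicator {..(1, 1)} (lengths x)" for x
    using True by (cases "lengths x") (auto simp: jac_det_scale lengths_scale indicator_def less_eq_prod_def)
  then have "(\<integral>\<^sup>+x. ?f (join_vec (\<alpha> *\<^sub>R left_vec x, \<beta> *\<^sub>R right_vec x)) \<partial>lborel) = emeasure length_measure {..(1, 1)}"
    by (simp add: emeasure_length_measure)
  finally show ?thesis using True by simp
next
  case False
  have "emeasure length_measure {..(\<alpha>, \<beta>)} = (\<integral>\<^sup>+x. ennreal (jac_det x) * indicator {..(\<alpha>, \<beta>)} (lengths x) \<partial>lborel)"
    by (rule emeasure_length_measure) simp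
  \<comment> \<open>Both lengths are positive on \<open>regular\<close>, so only a null set can
    reach a quadrant with a nonpositive corner coordinate; there the infinite weight dominates any
    density.\<close>
  also have "\<dots> \<le> (\<integral>\<^sup>+x. \<infinity> * indicator (- regular) x \<partial>lborel)"
  proof (rule nn_integral_mono)
    fix x
    show "ennreal (jac_det x) * indicator {..(\<alpha>, \<beta>)} (lengths x) \<le> \<infinity> * indicator (- regular) x"
      using False lengths_pos[of x] by (cases "lengths x") (auto simp: indicator_def less_eq_prod_def)
  qed
  also have "\<dots> = 0"
    using regular_null regular_open by (subst nn_integral_cmult_indicator) (auto intro!: borel_closed simp: closed_Compl)
  finally show ?thesis using False by auto
qed

text \<open>Since \<kappa> < 1, the lengths control the Euclidean norm. This makes sublevel sets
  bounded and the mass of every quadrant finite.\<close>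

lemma norm_le_lengths:
  assumes "lengths x \<le> (s, t)"
  shows "sqrt (1 - \<kappa>\<^sup>2) * norm x \<le> s + t"
proof -
  have "norm x \<le> norm (left_vec x) + norm (right_vec x)"
    using norm_Pair_le[of "left_vec x" "right_vec x"] norm_join_vec[of "(left_vec x, right_vec x)"] by simp
  then have "sqrt (1 - \<kappa>\<^sup>2) * norm x \<le> sqrt (1 - \<kappa>\<^sup>2) * (norm (left_vec x) + norm (right_vec x))"
    using \<kappa> by (intro mult_left_mono) (auto simp: abs_square_le_1)
  also have "\<dots> \<le> fst (lengths x) + snd (lengths x)"
    using cone_length_ge[OF F \<kappa>, of "left_vec x"] cone_length_ge[OF G \<kappa>, of "right_vec x"]
    by (simp add: lengths_def distrib_left)
  also have "\<dots> \<le> s + t"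
    using assms by (cases "lengths x") (auto simp: less_eq_prod_def)
  finally show ?thesis .
qed

lemma bounded_lengths: "bounded {x. lengths x \<le> (s, t)}"
proof -
  have k: "0 < sqrt (1 - \<kappa>\<^sup>2)" using \<kappa> by (simp add: abs_square_less_1)
  have "norm x \<le> (s + t) / sqrt (1 - \<kappa>\<^sup>2)" if "lengths x \<le> (s, t)" for x
    using norm_le_lengths[OF that] k by (simp add: le_divide_eq mult.commute)
  then show ?thesis unfolding bounded_iff by blast
qed

lemma emeasure_length_measure_finite: "emeasure length_measure {..(s, t)} < \<infinity>"
proof -
  let ?C = "fact CARD('a + 'b) * 2 ^ CARD('a + 'b) :: real"
  have c: "closed {x. lengths x \<le> (s, t)}"
    unfolding lengths_def less_eq_prod_def fst_conv snd_conv
    by (intro closed_Collect_conj closed_Collect_le continuous_on_const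
        continuous_on_compose2[OF cone_length_continuous_on[OF F \<kappa>, of UNIV]]
        continuous_on_compose2[OF cone_length_continuous_on[OF G \<kappa>, of UNIV]] continuous_left_right subset_UNIV)
  have "emeasure length_measure {..(s, t)} = (\<integral>\<^sup>+x. ennreal (jac_det x) * indicator {..(s, t)} (lengths x) \<partial>lborel)"
    by (rule emeasure_length_measure) simp
  also have "\<dots> \<le> (\<integral>\<^sup>+x. ennreal ?C * indicator {x. lengths x \<le> (s, t)} x \<partial>lborel)"
    by (intro nn_integral_mono mult_mono ennreal_leI jac_det_le) (auto simp: indicator_def)
  also have "\<dots> = ennreal ?C * emeasure lborel {x. lengths x \<le> (s, t)}"
    using c by (intro nn_integral_cmult_indicator) (simp add: borel_closed)
  also have "\<dots> < \<infinity>"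
    using emeasure_bounded_finite[OF bounded_lengths[of s t]] by (simp add: ennreal_mult_less_top)
  finally show ?thesis .
qed

text \<open>Lengths do not exceed norms, so \<open>lengths\<close> sends the unit ball into the
  quadrant, and the density is positive.\<close>

lemma emeasure_length_measure_unit_pos: "0 < emeasure length_measure {..(1, 1)}"
proof (rule ccontr)
  assume "\<not> ?thesis"
  then have 0: "(\<integral>\<^sup>+x. ennreal (jac_det x) * indicator {..(1, 1)} (lengths x) \<partial>lborel) = 0"
    using emeasure_length_measure[of "{..(1, 1)}"] by simp
  have m: "(\<lambda>x. ennreal (jac_det x) * indicator {..(1, 1)} (lengths x)) \<in> borel_measurable lborel"
    using jac_det_measurable indicator_lengths_measurable[of "{..(1, 1)}"] by simp
  have "AE x in lborel. ennreal (jac_det x) * indicator {..(1, 1)} (lengths x) = 0"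
    using 0 nn_integral_0_iff_AE[OF m] by simp
  moreover have "x \<notin> ball 0 1" if "ennreal (jac_det x) * indicator {..(1, 1)} (lengths x) = 0" for x
  proof
    assume "x \<in> ball 0 1"
    then have x: "norm x \<le> 1" by simp
    have "norm (left_vec x) \<le> norm x" "norm (right_vec x) \<le> norm x"
      using norm_vec_sum_sq[of x] by (auto intro: power2_le_imp_le)
    then have "lengths x \<le> (1, 1)"
      using x cone_length_le[OF F \<kappa>, of "left_vec x"] cone_length_le[OF G \<kappa>, of "right_vec x"]
      by (simp add: lengths_def less_eq_prod_def)
    then show False using that jac_det_pos[of x] by simp
  qed
  ultimately have "AE x in lborel. x \<notin> ball (0 :: real^('a + 'b)) 1"
    by (rule eventually_mono)
  then have "ball (0 :: real^('a + 'b)) 1 \<in> null_sets lborel"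
    using AE_iff_null[of lborel "\<lambda>x. x \<notin> ball (0 :: real^('a + 'b)) 1"] by (simp add: ball_def)
  then have "emeasure lborel (ball (0 :: real^('a + 'b)) 1) = 0" by auto
  then show False
    using unit_ball_vol_pos[of "real CARD('a) + real CARD('b)"] by (simp add: emeasure_ball)
qed

end

subsection \<open>Volume of the filled join\<close>

context neck_graphs
begin

text \<open>\<Phi> in pair form: the value at (p, q) is the sum of the points (p, F p) and (G q, q)
  of the two cones.\<close>

definition shear :: "(real^'a) \<times> (real^'b) \<Rightarrow> (real^'a) \<times> (real^'b)" where
  "shear z = (fst z + G (snd z), snd z + F (fst z))"

definition body_length :: "(real^'a) \<times> (real^'b) \<Rightarrow> real" where
  "body_length z = cone_length F (fst z) + cone_length G (snd z)"

lemma join_vec_shear: "join_vec (shear z) = join_vec z + perturb 1 (join_vec z)"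
  by (simp add: shear_def perturb_def vec_sum_eq_iff vec_eq_iff)

lemma body_length_continuous: "continuous_on S body_length"
  unfolding body_length_def
  by (intro continuous_intros continuous_on_compose2[OF cone_length_continuous_on[OF F \<kappa>, of UNIV]]
      continuous_on_compose2[OF cone_length_continuous_on[OF G \<kappa>, of UNIV]] subset_UNIV)

lemma shear_continuous: "continuous_on S shear"
  unfolding shear_def
  by (intro continuous_intros continuous_on_compose2[OF short_cone_continuous_on[OF F \<kappa>(1), of UNIV]]
      continuous_on_compose2[OF short_cone_continuous_on[OF G \<kappa>(1), of UNIV]] subset_UNIV)

lemma shear_expand: "(1 - \<kappa>) * norm (z - w) \<le> norm (shear z - shear w)"
proof -
  have l: "join_vec z - join_vec w = (join_vec (z - w) :: real^('a + 'b))" for z w :: "(real^'a) \<times> (real^'b)"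
    by (simp add: linear_diff[OF linear_join_vec])
  have "(1 - \<kappa>) * norm (join_vec z - join_vec w :: real^('a + 'b))
    \<le> norm ((join_vec z + perturb 1 (join_vec z)) - (join_vec w + perturb 1 (join_vec w)))"
    by (rule contraction_perturbation_expand[OF perturb_lip \<kappa>]) simp
  then show ?thesis
    unfolding join_vec_shear[symmetric] l norm_join_vec .
qed

lemma shear_bij: "bij shear"
proof -
  have "bij (\<lambda>x. x + perturb 1 x)"
    by (rule contraction_perturbation_bij[OF perturb_lip \<kappa>]) simp
  then have "bij ((\<lambda>x. x + perturb 1 x) \<circ> join_vec)"
    using bij_join_vec bij_comp by blast
  then have "bij (inv (join_vec :: _ \<Rightarrow> real^('a + 'b)) \<circ> ((\<lambda>x. x + perturb 1 x) \<circ> join_vec))"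
    by (rule bij_comp[OF _ bij_imp_bij_inv[OF bij_join_vec]])
  moreover have "inv (join_vec :: _ \<Rightarrow> real^('a + 'b)) \<circ> ((\<lambda>x. x + perturb 1 x) \<circ> join_vec) = shear"
    by (simp add: fun_eq_iff inv_f_f bij_is_inj[OF bij_join_vec] flip: join_vec_shear)
  ultimately show ?thesis by simp
qed

lemma shear_inv_continuous: "continuous_on S (inv shear)"
proof (rule lipschitz_bound_continuous_on)
  show "norm (inv shear x - inv shear y) \<le> (1 / (1 - \<kappa>)) * norm (x - y)" for x y
    using shear_expand[of "inv shear x" "inv shear y"] \<kappa> shear_bij
    by (simp add: surj_f_inv_f bij_is_surj field_simps)
qed (use \<kappa> in simp)

lemma body_length_scale: "t \<ge> 0 \<Longrightarrow> body_length (t *\<^sub>R z) = t * body_length z"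
  by (simp add: body_length_def cone_length_scale[OF F \<kappa>] cone_length_scale[OF G \<kappa>] distrib_left)

lemma shear_scale: "t \<ge> 0 \<Longrightarrow> shear (t *\<^sub>R z) = t *\<^sub>R shear z"
  by (simp add: shear_def short_cone_scale[OF F] short_cone_scale[OF G] scaleR_add_right)

lemma body_length_ge: "sqrt (1 - \<kappa>\<^sup>2) * norm z \<le> body_length z"
  using norm_le_lengths[of "join_vec z" "cone_length F (fst z)" "cone_length G (snd z)"]
  by (simp add: lengths_def body_length_def)

lemma body_compact: "compact {z. body_length z \<le> r}"
proof -
  have k: "0 < sqrt (1 - \<kappa>\<^sup>2)" using \<kappa> by (simp add: abs_square_less_1)
  have "norm z \<le> r / sqrt (1 - \<kappa>\<^sup>2)" if "body_length z \<le> r" for z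
    using order_trans[OF body_length_ge that] k by (simp add: le_divide_eq mult.commute)
  then have "bounded {z. body_length z \<le> r}"
    unfolding bounded_iff by blast
  moreover have "closed {z. body_length z \<le> r}"
    by (intro closed_Collect_le continuous_on_const body_length_continuous)
  ultimately show ?thesis by (simp add: compact_eq_bounded_closed)
qed

text \<open>Change of variables for \<Phi>, whose Jacobian at the regular points of the body is
  \<open>jac_det\<close>; the remaining points have negligible image because \<Phi> is
  Lipschitz.\<close>

lemma emeasure_shear_body:
  "emeasure lebesgue (shear ` {z. body_length z \<le> 1}) = emeasure length_measure {z. fst z + snd z \<le> 1}"
proof -
  define \<Phi> where "\<Phi> x = x + perturb 1 x" for x
  define E where "E = {x. fst (lengths x) + snd (lengths x) \<le> 1}"
  let ?B = "{z. body_length z \<le> 1}"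
  have E: "E = join_vec ` ?B"
  proof (rule set_eqI)
    fix x
    show "x \<in> E \<longleftrightarrow> x \<in> join_vec ` ?B"
    proof
      assume "x \<in> E"
      then show "x \<in> join_vec ` ?B"
        by (intro image_eqI[of _ _ "(left_vec x, right_vec x)"]) (simp_all add: E_def body_length_def lengths_def)
    qed (auto simp: E_def body_length_def lengths_def)
  qed
  have im: "join_vec ` shear ` ?B = \<Phi> ` E"
    by (auto simp: E \<Phi>_def image_image join_vec_shear)
  have jc: "continuous_on S (join_vec :: _ \<Rightarrow> real^('a + 'b))" for S
    by (rule linear_continuous_on[OF linear_join_vec[unfolded linear_conv_bounded_linear]])
  have cB: "compact (shear ` ?B)"
    by (rule compact_continuous_image[OF shear_continuous body_compact])
  then have c\<Phi>E: "compact (\<Phi> ` E)"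
    unfolding im[symmetric] by (rule compact_continuous_image[OF jc])
  have cE: "compact E"
    unfolding E by (rule compact_continuous_image[OF jc body_compact])
  have "emeasure lebesgue (shear ` ?B) = emeasure lborel (shear ` ?B)"
    using cB by (simp add: borel_compact)
  also have "\<dots> = emeasure lborel (join_vec -` (\<Phi> ` E))"
    unfolding im[symmetric] inj_vimage_image_eq[OF bij_is_inj[OF bij_join_vec]] ..
  also have "\<dots> = emeasure (distr lborel borel join_vec) (\<Phi> ` E)"
    using c\<Phi>E borel_measurable_continuous_onI[OF jc] by (subst emeasure_distr) (simp_all add: borel_compact)
  also have "\<dots> = emeasure lborel (\<Phi> ` E)"
    using lborel_distr_join_vec[where 'a='a and 'b='b] by simp
  also have "\<dots> = emeasure lebesgue (\<Phi> ` E)"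
    using c\<Phi>E by (simp add: borel_compact)
  finally have 1: "emeasure lebesgue (shear ` ?B) = emeasure lebesgue (\<Phi> ` E)" .
  have bij: "bij \<Phi>"
    unfolding \<Phi>_def by (rule contraction_perturbation_bij[OF perturb_lip \<kappa>]) simp
  have ER: "E \<inter> regular \<in> sets borel"
    using cE regular_open by (intro sets.Int) (auto simp: borel_compact)
  have der: "(\<Phi> has_derivative ((*v) (mat 1 + jacobian 1 x))) (at x within E \<inter> regular)" if "x \<in> E \<inter> regular" for x
    unfolding \<Phi>_def matrix_vector_mult_add_rdistrib
    using that by (auto intro!: derivative_eq_intros has_derivative_at_withinI[OF perturb_deriv])
  have neg: "negligible (\<Phi> ` (E - regular))"
  proof (rule negligible_locally_Lipschitz_image)
    show "negligible (E - regular)"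
      by (rule negligible_subset[OF regular_negligible]) auto
    fix x
    have "norm (\<Phi> y - \<Phi> x) \<le> (1 + \<kappa>) * norm (y - x)" for y
    proof -
      have "norm (\<Phi> y - \<Phi> x) \<le> norm (y - x) + norm (perturb 1 y - perturb 1 x)"
        unfolding \<Phi>_def by (metis add_diff_add norm_triangle_ineq)
      then show ?thesis using perturb_lip[of 1 y x] by (simp add: algebra_simps)
    qed
    then show "\<exists>T B. open T \<and> x \<in> T \<and> (\<forall>y\<in>(E - regular) \<inter> T. norm (\<Phi> y - \<Phi> x) \<le> B * norm (y - x))"
      by blast
  qed simp
  let ?h = "\<lambda>x. jac_det x * indicator (E \<inter> regular) x"
  let ?m = "emeasure length_measure {z. fst z + snd z \<le> 1}"
  have T: "{z :: real \<times> real. fst z + snd z \<le> 1} \<in> sets borel"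
    by (intro borel_closed closed_Collect_le continuous_intros)
  have "?m = (\<integral>\<^sup>+x. ennreal (jac_det x) * indicator {z. fst z + snd z \<le> 1} (lengths x) \<partial>lborel)"
    by (rule emeasure_length_measure[OF T])
  also have "\<dots> = (\<integral>\<^sup>+x. ennreal (?h x) \<partial>lborel)"
  proof (rule nn_integral_cong_AE)
    have "- regular \<in> null_sets lborel"
      using regular_null regular_open by (simp add: null_sets_def closed_Compl borel_closed)
    from AE_not_in[OF this] have "AE x in lborel. x \<in> regular" by simp
    then show "AE x in lborel. ennreal (jac_det x) * indicator {z. fst z + snd z \<le> 1} (lengths x) = ennreal (?h x)"
      by (rule eventually_mono) (auto simp: E_def indicator_def)
  qed
  finally have m: "?m = (\<integral>\<^sup>+x. ennreal (?h x) \<partial>lborel)" .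
  \<comment> \<open>The values of \<open>lengths\<close> are nonnegative, so those in the triangle
    lie in the unit quadrant. Finiteness permits the passage to a real-valued integral.\<close>
  have "?m \<le> emeasure length_measure {..(1, 1)}"
  proof -
    have "?m = (\<integral>\<^sup>+x. ennreal (jac_det x) * indicator {z. fst z + snd z \<le> 1} (lengths x) \<partial>lborel)"
      by (rule emeasure_length_measure[OF T])
    also have "\<dots> \<le> (\<integral>\<^sup>+x. ennreal (jac_det x) * indicator {..(1, 1)} (lengths x) \<partial>lborel)"
    proof (intro nn_integral_mono mult_left_mono)
      fix x
      have "0 \<le> fst (lengths x)" "0 \<le> snd (lengths x)"
        by (simp_all add: lengths_def cone_length_nonneg[OF F \<kappa>] cone_length_nonneg[OF G \<kappa>])
      then show "indicator {z. fst z + snd z \<le> 1} (lengths x) \<le> (indicator {..(1, 1)} (lengths x) :: ennreal)"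
        by (cases "lengths x") (auto simp: indicator_def less_eq_prod_def)
    qed simp
    also have "\<dots> = emeasure length_measure {..(1, 1)}"
      by (rule emeasure_length_measure[symmetric]) simp
    finally show ?thesis .
  qed
  then have "?m < top"
    using emeasure_length_measure_finite[of 1 1] by simp
  define r where "r = enn2real ?m"
  have r: "?m = ennreal r" "0 \<le> r"
    using \<open>?m < top\<close> by (simp_all add: r_def)
  have hm: "?h \<in> borel_measurable borel"
    using jac_det_measurable ER by simp
  have "(?h has_integral r) UNIV"
    by (rule nn_integral_has_integral) (use hm r m jac_det_pos in \<open>auto simp: less_imp_le\<close>)
  then have "((\<lambda>x. if x \<in> E \<inter> regular then jac_det x else 0) has_integral r) UNIV"
    by (rule has_integral_eq[rotated]) (simp add: indicator_def)
  then have hi: "(jac_det has_integral r) (E \<inter> regular)"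
    by (simp only: has_integral_restrict_UNIV)
  have ja: "jac_det x = \<bar>det (matrix ((*v) (mat 1 + jacobian 1 x)))\<bar>" for x
    using jac_det_pos[of x] by (simp add: jac_det_def)
  have "((\<lambda>x. \<bar>det (matrix ((*v) (mat 1 + jacobian 1 x)))\<bar>) has_integral r) (E \<inter> regular)"
    by (rule has_integral_eq[OF ja hi])
  then have ms: "\<Phi> ` (E \<inter> regular) \<in> lmeasurable" "measure lebesgue (\<Phi> ` (E \<inter> regular)) = r"
    using has_measure_differentiable_image[of "E \<inter> regular" \<Phi>, OF _ der, of r]
      inj_on_subset[OF bij_is_inj[OF bij]] ER by auto
  have "emeasure lebesgue (\<Phi> ` E) = emeasure lebesgue (\<Phi> ` (E \<inter> regular) \<union> \<Phi> ` (E - regular))"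
    by (simp add: Int_Diff_Un flip: image_Un)
  also have "\<dots> = emeasure lebesgue (\<Phi> ` (E \<inter> regular))"
    using ms(1) neg by (intro emeasure_Un_null_set) (auto simp: negligible_iff_null_sets)
  also have "\<dots> = ennreal r"
    using emeasure_eq_measure2[OF ms(1)] ms(2) by simp
  finally show ?thesis using 1 r by simp
qed

end

section \<open>Comparison of the volumes of two filled joins\<close>

lemma (in neck_graphs) borel_measurable_length_measure:
  "f \<in> borel_measurable borel \<Longrightarrow> f \<in> borel_measurable length_measure"
  unfolding length_measure_def measurable_distr_eq1 .

text \<open>The scaling law makes the two length measures proportional, in the ratio of their masses
  \<open>?V\<close> and \<open>?V'\<close> on the unit quadrant. The Gaussian weight decides which
  mass is larger, and the same ratio then holds on the triangle s + t \<le> 1.\<close>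

lemma volume_comparison:
  fixes F F\<^sub>0 :: "real^'a \<Rightarrow> real^'b"
  assumes FG: "neck_graphs F G \<kappa>" and FG0: "neck_graphs F\<^sub>0 G\<^sub>0 \<kappa>\<^sub>0"
    and adj: "\<And>p q. p \<bullet> G\<^sub>0 q = q \<bullet> F\<^sub>0 p"
  shows "emeasure (neck_graphs.length_measure F\<^sub>0 G\<^sub>0) {z. fst z + snd z \<le> 1}
    \<le> emeasure (neck_graphs.length_measure F G) {z. fst z + snd z \<le> 1}"
proof -
  interpret A: neck_graphs F G \<kappa> by (rule FG)
  interpret B: neck_graphs F\<^sub>0 G\<^sub>0 \<kappa>\<^sub>0 by (rule FG0)
  let ?M = "A.length_measure" and ?M' = "B.length_measure"
  let ?V = "emeasure ?M {..(1, 1)}" and ?V' = "emeasure ?M' {..(1, 1)}"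
  let ?g = "\<lambda>z :: real \<times> real. ennreal (exp (- ((fst z)\<^sup>2 + (snd z)\<^sup>2)))"
  let ?I = "ennreal (LINT x|lborel. exp (- (norm (x :: real^('a + 'b)))\<^sup>2))"
  have V: "?V \<noteq> 0" "?V \<noteq> top" "?V' \<noteq> 0" "?V' \<noteq> top"
    using A.emeasure_length_measure_unit_pos B.emeasure_length_measure_unit_pos
      A.emeasure_length_measure_finite[of 1 1] B.emeasure_length_measure_finite[of 1 1] by auto
  \<comment> \<open>Scaling each measure by the unit mass of the other expresses proportionality
    without dividing extended reals.\<close>
  have eq: "scale_measure ?V' ?M = scale_measure ?V ?M'"
  proof (rule measure_eqI_generator_eq[of "range atMost" UNIV _ _ "\<lambda>n. {..(real n, real n)}"])
    show "Int_stable (range atMost :: (real \<times> real) set set)"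
    proof (rule Int_stableI, clarify)
      fix a b c d :: real
      have "{..(a, b)} \<inter> {..(c, d)} = {..(min a c, min b d)}"
        by (auto simp: less_eq_prod_def)
      then show "{..(a, b)} \<inter> {..(c, d)} \<in> range atMost" by blast
    qed
    show "emeasure (scale_measure ?V' ?M) X = emeasure (scale_measure ?V ?M') X"
      if X': "X \<in> range atMost" for X
    proof -
      obtain c where c: "X = {..c}" using X' by blast
      obtain a b where "c = (a, b)" by (rule prod.exhaust)
      with c have X: "X = {..(a, b)}" by simp
      show ?thesis
        unfolding X emeasure_scale_measure
          A.emeasure_length_measure_atMost[of a b] B.emeasure_length_measure_atMost[of a b]
        by (simp add: mult_ac)
    qed
    have "sets (borel :: (real \<times> real) measure) = sigma_sets UNIV (range atMost)"
      unfolding borel_eq_atMost by (rule sets_measure_of) simp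
    then show "sets (scale_measure ?V' ?M) = sigma_sets UNIV (range atMost)"
      "sets (scale_measure ?V ?M') = sigma_sets UNIV (range atMost)" by simp_all
    show "(\<Union>n. {..(real n, real n)}) = UNIV"
    proof -
      have "\<exists>n. x \<le> (real n, real n)" for x :: "real \<times> real"
      proof -
        obtain n where "max (fst x) (snd x) \<le> real n" using real_arch_simple by blast
        then show ?thesis by (intro exI[of _ n]) (simp add: less_eq_prod_def)
      qed
      then show ?thesis by auto
    qed
    show "emeasure (scale_measure ?V' ?M) {..(real n, real n)} \<noteq> \<infinity>" for n
      using V A.emeasure_length_measure_finite[of "real n" "real n"]
        B.emeasure_length_measure_finite[of "real n" "real n"] by (simp add: ennreal_mult_eq_top_iff)
  qed auto
  have gA: "?g \<in> borel_measurable ?M" and gB: "?g \<in> borel_measurable ?M'"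
    by (rule A.borel_measurable_length_measure B.borel_measurable_length_measure, rule A.gaussian_weight_measurable)+
  have "?V' * (\<integral>\<^sup>+z. ?g z \<partial>?M) = (\<integral>\<^sup>+z. ?g z \<partial>scale_measure ?V' ?M)"
    by (rule nn_integral_scale_measure[OF gA, symmetric])
  also have "\<dots> = (\<integral>\<^sup>+z. ?g z \<partial>scale_measure ?V ?M')"
    by (rule arg_cong[OF eq, of "\<lambda>M. nn_integral M ?g"])
  also have "\<dots> = ?V * (\<integral>\<^sup>+z. ?g z \<partial>?M')"
    by (rule nn_integral_scale_measure[OF gB])
  also have "\<dots> = ?V * ?I"
    by (rule arg_cong[OF B.gaussian_length_measure_eq[OF adj]])
  finally have I: "?V' * (\<integral>\<^sup>+z. ?g z \<partial>?M) = ?V * ?I" .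
  have "?V' * ?I \<le> ?V' * (\<integral>\<^sup>+z. ?g z \<partial>?M)"
    by (rule mult_left_mono[OF A.gaussian_length_measure_ge]) simp
  then have "?I * ?V' \<le> ?I * ?V"
    unfolding I by (simp only: mult.commute)
  then have le: "?V' \<le> ?V"
    using integral_gaussian_pos[where 'a="real^('a + 'b)"] by (subst (asm) ennreal_mult_le_mult_iff) auto
  let ?T = "{z :: real \<times> real. fst z + snd z \<le> 1}"
  have "?V' * emeasure ?M' ?T \<le> ?V * emeasure ?M' ?T"
    by (rule mult_right_mono[OF le]) simp
  also have "\<dots> = ?V' * emeasure ?M ?T"
    using arg_cong[OF eq, of "\<lambda>M. emeasure M ?T"] by (simp only: emeasure_scale_measure)
  finally show ?thesis
    using V by (subst (asm) ennreal_mult_le_mult_iff) auto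
qed

section \<open>The join as a level set and the region it encloses\<close>

lemma exists_unit_cone_length:
  assumes F: "short_cone \<kappa> F" and \<kappa>: "0 \<le> \<kappa>" "\<kappa> < 1"
  obtains p' where "cone_length F p' = 1" "p = cone_length F p *\<^sub>R p'"
proof -
  have unit: "cone_length F (p /\<^sub>R cone_length F p) = 1" if "p \<noteq> 0" for p
    using cone_length_pos[OF F \<kappa> that] by (simp add: cone_length_scale[OF F \<kappa>])
  show ?thesis
  proof (cases "p = 0")
    case True
    \<comment> \<open>At p = 0 the coefficient vanishes, so any point of unit length serves. This
      case occurs at the endpoints of the joining segments.\<close>
    obtain b :: 'a where "b \<in> Basis" using nonempty_Basis by blast
    then have "b \<noteq> 0" by auto
    moreover have "cone_length F 0 = 0"
      using cone_length_le[OF F \<kappa>, of 0] cone_length_nonneg[OF F \<kappa>, of 0] by simp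
    ultimately show ?thesis
      using that[of "b /\<^sub>R cone_length F b"] unit[OF \<open>b \<noteq> 0\<close>] True by simp
  next
    case False
    then show ?thesis
      using unit[OF False] cone_length_pos[OF F \<kappa> False] by (intro that[of "p /\<^sub>R cone_length F p"]) simp_all
  qed
qed

context neck_graphs
begin

text \<open>Homogeneity moves the weights of a convex combination inside \<open>F\<close> and
  \<open>G\<close>: (1 - u) (p, F p) + u (G q, q) is \<open>shear\<close> at ((1 - u) p, u q), and
  the unit lengths become 1 - u and u.\<close>

lemma geometric_join_necks:
  "geometric_join ((\<lambda>p. (p, F p)) ` {p. cone_length F p = 1}) ((\<lambda>q. (G q, q)) ` {q. cone_length G q = 1})
   = shear ` {z. body_length z = 1}"
proof (intro equalityI subsetI)
  fix z
  assume "z \<in> geometric_join ((\<lambda>p. (p, F p)) ` {p. cone_length F p = 1}) ((\<lambda>q. (G q, q)) ` {q. cone_length G q = 1})"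
  then obtain p q u where *: "cone_length F p = 1" "cone_length G q = 1" "0 \<le> u" "u \<le> 1"
    "z = (1 - u) *\<^sub>R (p, F p) + u *\<^sub>R (G q, q)"
    by (auto simp: geometric_join_def closed_segment_def)
  then have "z = shear ((1 - u) *\<^sub>R p, u *\<^sub>R q)"
    by (simp add: shear_def short_cone_scale[OF F] short_cone_scale[OF G] add.commute)
  moreover have "body_length ((1 - u) *\<^sub>R p, u *\<^sub>R q) = 1"
    using * by (simp add: body_length_def cone_length_scale[OF F \<kappa>] cone_length_scale[OF G \<kappa>])
  ultimately show "z \<in> shear ` {z. body_length z = 1}" by blast
next
  fix z
  assume "z \<in> shear ` {z. body_length z = 1}"
  then obtain p q where z: "z = shear (p, q)" and 1: "cone_length F p + cone_length G q = 1"
    by (auto simp: body_length_def)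
  obtain p' where p': "cone_length F p' = 1" "p = cone_length F p *\<^sub>R p'"
    using exists_unit_cone_length[OF F \<kappa>] .
  obtain q' where q': "cone_length G q' = 1" "q = cone_length G q *\<^sub>R q'"
    using exists_unit_cone_length[OF G \<kappa>] .
  let ?u = "cone_length G q"
  have u: "0 \<le> ?u" "?u \<le> 1" "cone_length F p = 1 - ?u"
    using 1 cone_length_nonneg[OF F \<kappa>, of p] cone_length_nonneg[OF G \<kappa>, of q] by linarith+
  have p: "p = (1 - ?u) *\<^sub>R p'"
    using p'(2) unfolding u(3) .
  have Fp: "F p = (1 - ?u) *\<^sub>R F p'"
    using arg_cong[OF p, of F] short_cone_scale[OF F, of "1 - ?u" p'] u(2) by simp
  have Gq: "G q = ?u *\<^sub>R G q'"
    using arg_cong[OF q'(2), of G] short_cone_scale[OF G u(1), of q'] by (rule trans)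
  have "z = (p + G q, F p + q)"
    by (simp add: z shear_def add.commute)
  also have "p + G q = (1 - ?u) *\<^sub>R p' + ?u *\<^sub>R G q'"
    by (rule arg_cong2[OF p Gq])
  also have "F p + q = (1 - ?u) *\<^sub>R F p' + ?u *\<^sub>R q'"
    by (rule arg_cong2[OF Fp q'(2)])
  finally have "z = (1 - ?u) *\<^sub>R (p', F p') + ?u *\<^sub>R (G q', q')"
    by simp
  then have "z \<in> closed_segment (p', F p') (G q', q')"
    using u unfolding closed_segment_def by blast
  then show "z \<in> geometric_join ((\<lambda>p. (p, F p)) ` {p. cone_length F p = 1}) ((\<lambda>q. (G q, q)) ` {q. cone_length G q = 1})"
    using p'(1) q'(1) unfolding geometric_join_def by blast
qed

text \<open>The homogeneous function \<open>g\<close>, which is \<open>body_length\<close> carried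
  along by \<open>shear\<close>, has the join as its level set at 1. Where g > 1, a ray leads to
  infinity without meeting the join; where g < 1, a connected set avoiding the join stays in the
  compact set g \<le> 1.\<close>

lemma filled_join_necks:
  "filled_join ((\<lambda>p. (p, F p)) ` {p. cone_length F p = 1}) ((\<lambda>q. (G q, q)) ` {q. cone_length G q = 1})
   = shear ` {z. body_length z \<le> 1}"
proof -
  let ?J = "shear ` {z. body_length z = 1}"
  define g where "g z = body_length (inv shear z)" for z
  have inv: "inv shear (shear w) = w" "shear (inv shear z) = z" for w z
    using shear_bij by (simp_all add: bij_is_inj bij_is_surj surj_f_inv_f)
  have g: "continuous_on S g" for S
    unfolding g_def by (rule continuous_on_compose2[OF body_length_continuous shear_inv_continuous subset_UNIV])
  have im: "shear ` {z. P (body_length z)} = {z. P (g z)}" for P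
    unfolding g_def using inv by (auto intro!: image_eqI[of _ _ "inv shear _"])
  have imJ: "?J = {z. g z = 1}" and im1: "shear ` {z. body_length z \<le> 1} = {z. g z \<le> 1}"
    using im[of "\<lambda>s. s = 1"] im[of "\<lambda>s. s \<le> 1"] by simp_all
  have gs: "g (t *\<^sub>R z) = t * g z" if "t \<ge> 0" for t z
  proof -
    have "t *\<^sub>R z = shear (t *\<^sub>R inv shear z)"
      using that by (simp add: shear_scale inv)
    then show ?thesis
      using that by (simp add: g_def inv body_length_scale)
  qed
  have "inside ?J = {z. g z < 1}"
  proof (intro equalityI subsetI CollectI)
    fix z assume z: "z \<in> inside ?J"
    then have b: "bounded (connected_component_set (- ?J) z)" and nz: "g z \<noteq> 1"
      by (auto simp: inside_def imJ)
    show "g z < 1"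
    proof (rule ccontr)
      assume "\<not> g z < 1"
      then have gt: "1 < g z" using nz by simp
      let ?R = "(\<lambda>t. t *\<^sub>R z) ` {1..}"
      have "?R \<subseteq> connected_component_set (- ?J) z"
      proof (rule connected_component_maximal)
        show "z \<in> ?R" by (rule image_eqI[of _ _ 1]) auto
        show "connected ?R"
          by (intro connected_continuous_image continuous_intros) (simp add: is_interval_connected)
        show "?R \<subseteq> - ?J"
        proof
          fix y assume "y \<in> ?R"
          then obtain t where t: "t \<ge> 1" "y = t *\<^sub>R z" by auto
          have "1 * 1 < t * g z" using t gt by (intro mult_le_less_imp_less) auto
          then have "g y \<noteq> 1" using t gs[of t z] by simp
          then show "y \<in> - ?J" by (simp add: imJ)
        qed
      qed
      then have "bounded ?R" using b bounded_subset by blast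
      then obtain B where B: "\<And>t. t \<ge> 1 \<Longrightarrow> norm (t *\<^sub>R z) \<le> B"
        unfolding bounded_iff by blast
      have "z \<noteq> 0" using gs[of 0 z] gt by auto
      then have nz: "norm z > 0" by simp
      have "norm ((1 + \<bar>B\<bar> / norm z) *\<^sub>R z) = norm z + \<bar>B\<bar>"
        using nz by (simp add: field_simps)
      moreover have "norm ((1 + \<bar>B\<bar> / norm z) *\<^sub>R z) \<le> B"
        using nz by (intro B) simp
      ultimately show False using nz by linarith
    qed
  next
    fix z assume "z \<in> {z. g z < 1}"
    then have z: "g z < 1" by simp
    let ?C = "connected_component_set (- ?J) z"
    have zJ: "z \<notin> ?J" using z by (simp add: imJ)
    have "g y \<le> 1" if y: "y \<in> ?C" for y
    proof (rule ccontr)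
      assume "\<not> g y \<le> 1"
      have "connected (g ` ?C)"
        by (intro connected_continuous_image g connected_connected_component)
      moreover have "g z \<in> g ` ?C" "g y \<in> g ` ?C"
        using zJ y by auto
      ultimately have "1 \<in> g ` ?C"
        using z \<open>\<not> g y \<le> 1\<close> connected_contains_Icc[of "g ` ?C" "g z" "g y"] by auto
      then show False
        using connected_component_subset[of "- ?J" z] by (auto simp: imJ)
    qed
    then have "?C \<subseteq> shear ` {z. body_length z \<le> 1}"
      by (auto simp: im1)
    moreover have "bounded (shear ` {z. body_length z \<le> 1})"
      by (intro compact_imp_bounded compact_continuous_image shear_continuous body_compact)
    ultimately have "bounded ?C" using bounded_subset by blast
    then show "z \<in> inside ?J"
      using zJ by (simp add: inside_def)
  qed
  then show ?thesis
    unfolding filled_join_def geometric_join_necks by (auto simp: imJ im1)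
qed

end

subsection \<open>Necks as graphs\<close>

lemma Ck_on_cong:
  assumes "open U" "\<And>x. x \<in> U \<Longrightarrow> f x = g x"
  shows "Ck_on k U f \<longleftrightarrow> Ck_on k U g"
  using assms
proof (induction k arbitrary: f g)
  case 0
  then show ?case by (simp cong: continuous_on_cong)
next
  case (Suc k)
  have d: "(f has_derivative f') (at x) \<longleftrightarrow> (g has_derivative f') (at x)" if "x \<in> U" for x f'
    using has_derivative_transform_within_open[OF _ \<open>open U\<close> that, of f f' UNIV g]
      has_derivative_transform_within_open[OF _ \<open>open U\<close> that, of g f' UNIV f] Suc.prems(2) by auto
  then have "frechet_derivative f (at x) = frechet_derivative g (at x)" if "x \<in> U" for x
    using that by (simp add: frechet_derivative_def)
  then have "Ck_on k U (\<lambda>x. frechet_derivative f (at x) v) \<longleftrightarrow> Ck_on k U (\<lambda>x. frechet_derivative g (at x) v)" for v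
    using Suc.prems(1) by (intro Suc.IH) auto
  moreover have "f differentiable (at x) \<longleftrightarrow> g differentiable (at x)" if "x \<in> U" for x
    using d[OF that] by (simp add: differentiable_def)
  ultimately show ?case by simp
qed

text \<open>Straight lines in a chart must yield curves admissible in \<open>tangent_vector\<close>,
  which asks for all orders of differentiability.\<close>

lemma Ck_on_line:
  fixes f :: "'e::euclidean_space \<Rightarrow> 'f::euclidean_space"
  assumes "Ck_on k V f" "open T" "\<And>t. t \<in> T \<Longrightarrow> a + t *\<^sub>R d \<in> V"
  shows "Ck_on k T (\<lambda>t::real. f (a + t *\<^sub>R d))"
  using assms(1)
proof (induction k arbitrary: f)
  case 0
  then show ?case
    using assms(3) by (auto intro!: continuous_on_compose2[of V f] continuous_intros)
next
  case (Suc k)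
  have der: "((\<lambda>t. f (a + t *\<^sub>R d)) has_derivative (\<lambda>h. frechet_derivative f (at (a + t *\<^sub>R d)) (h *\<^sub>R d))) (at t)"
    if "t \<in> T" for t
  proof -
    have 1: "((\<lambda>t. a + t *\<^sub>R d) has_derivative (\<lambda>h. h *\<^sub>R d)) (at t)"
      by (auto intro!: derivative_eq_intros)
    have 2: "(f has_derivative frechet_derivative f (at (a + t *\<^sub>R d))) (at (a + t *\<^sub>R d))"
      using Suc.prems assms(3)[OF that] by (simp add: frechet_derivative_works[symmetric])
    show ?thesis by (rule has_derivative_compose[OF 1 2])
  qed
  have "Ck_on k T (\<lambda>t. frechet_derivative (\<lambda>t. f (a + t *\<^sub>R d)) (at t) v)" for v
  proof -
    have "Ck_on k T (\<lambda>t. frechet_derivative f (at (a + t *\<^sub>R d)) (v *\<^sub>R d))"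
      by (rule Suc.IH) (use Suc.prems in simp)
    moreover have "frechet_derivative (\<lambda>t. f (a + t *\<^sub>R d)) (at t) v = frechet_derivative f (at (a + t *\<^sub>R d)) (v *\<^sub>R d)"
      if "t \<in> T" for t
      using frechet_derivative_at[OF der[OF that]] by metis
    ultimately show ?thesis
      by (subst Ck_on_cong[OF assms(2)]) auto
  qed
  then show ?case
    using der by (auto simp: differentiable_def)
qed

text \<open>Mean value inequality for \<open>f - D x0\<close>, whose derivative is small near
  \<open>x0\<close> by continuity. Unlike differentiability at \<open>x0\<close> alone, the estimate
  compares two arbitrary nearby points, as a Lipschitz bound requires.\<close>

lemma strict_derivative:
  fixes f :: "'a::euclidean_space \<Rightarrow> 'b::euclidean_space"
  assumes V: "open V" "x0 \<in> V"
    and der: "\<And>x. x \<in> V \<Longrightarrow> (f has_derivative D x) (at x)"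
    and cont: "\<And>v. continuous_on V (\<lambda>x. D x v)"
    and \<epsilon>: "\<epsilon> > 0"
  shows "\<exists>\<delta>>0. \<forall>x\<in>ball x0 \<delta>. \<forall>y\<in>ball x0 \<delta>. norm (f x - f y - D x0 (x - y)) \<le> \<epsilon> * norm (x - y)"
proof -
  \<comment> \<open>Continuity of the derivative is known one direction at a time. Errors of \<eta>
    in each basis direction add up to at most \<epsilon> in operator norm.\<close>
  define \<eta> where "\<eta> = \<epsilon> / DIM('a)"
  have \<eta>: "\<eta> > 0" using \<epsilon> by (simp add: \<eta>_def)
  have "\<forall>\<^sub>F x in nhds x0. norm (D x b - D x0 b) < \<eta>" for b
  proof -
    have "isCont (\<lambda>x. D x b) x0"
      using cont V by (simp add: continuous_on_eq_continuous_at)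
    then have "((\<lambda>x. D x b) \<longlongrightarrow> D x0 b) (nhds x0)"
      unfolding isCont_def by (rule iffD1[OF tendsto_at_iff_tendsto_nhds])
    from tendstoD[OF this \<eta>] show ?thesis by (simp add: dist_norm)
  qed
  then have "\<forall>\<^sub>F x in nhds x0. \<forall>b\<in>Basis. norm (D x b - D x0 b) < \<eta>"
    by (intro eventually_ball_finite) auto
  moreover have "\<forall>\<^sub>F x in nhds x0. x \<in> V"
    using V by (rule eventually_nhds_in_open)
  ultimately have "\<forall>\<^sub>F x in nhds x0. x \<in> V \<and> (\<forall>b\<in>Basis. norm (D x b - D x0 b) < \<eta>)"
    by eventually_elim auto
  then obtain \<delta> where \<delta>: "\<delta> > 0" "\<And>x. x \<in> ball x0 \<delta> \<Longrightarrow> x \<in> V \<and> (\<forall>b\<in>Basis. norm (D x b - D x0 b) < \<eta>)"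
    by (auto simp: eventually_nhds_metric dist_commute)
  have lin: "linear (D x)" if "x \<in> V" for x
    using der[OF that] by (rule has_derivative_linear)
  show ?thesis
  proof (intro exI[of _ \<delta>] conjI ballI)
    show "\<delta> > 0" by (rule \<delta>(1))
    fix x y assume xy: "x \<in> ball x0 \<delta>" "y \<in> ball x0 \<delta>"
    have "norm ((f x - D x0 x) - (f y - D x0 y)) \<le> \<epsilon> * norm (x - y)"
    proof (rule differentiable_bound[of "ball x0 \<delta>" "\<lambda>x. f x - D x0 x" "\<lambda>x h. D x h - D x0 h"])
      fix z assume z: "z \<in> ball x0 \<delta>"
      have 1: "(f has_derivative D z) (at z)"
        using der \<delta>(2)[OF z] by blast
      have 2: "(D x0 has_derivative D x0) (at z)"
        using lin[OF V(2)] by (rule linear_imp_has_derivative)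
      show "((\<lambda>x. f x - D x0 x) has_derivative (\<lambda>h. D z h - D x0 h)) (at z within ball x0 \<delta>)"
        by (rule has_derivative_at_withinI[OF has_derivative_diff[OF 1 2]])
      show "onorm (\<lambda>h. D z h - D x0 h) \<le> \<epsilon>"
      proof (rule onorm_le)
        fix h :: 'a
        have sum: "D y h = (\<Sum>b\<in>Basis. (h \<bullet> b) *\<^sub>R D y b)" if "y \<in> V" for y
        proof -
          have "D y h = D y (\<Sum>b\<in>Basis. (h \<bullet> b) *\<^sub>R b)"
            by (simp only: euclidean_representation)
          also have "\<dots> = (\<Sum>b\<in>Basis. (h \<bullet> b) *\<^sub>R D y b)"
            by (simp only: linear_sum[OF lin[OF that]] linear_scale[OF lin[OF that]] o_def)
          finally show ?thesis .
        qed
        have eq: "D z h - D x0 h = (\<Sum>b\<in>Basis. (h \<bullet> b) *\<^sub>R (D z b - D x0 b))"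
          unfolding sum[OF V(2)] using \<delta>(2)[OF z] sum[of z] by (simp only: sum_subtractf scaleR_diff_right)
        have "norm (D z h - D x0 h) \<le> (\<Sum>b\<in>Basis. norm ((h \<bullet> b) *\<^sub>R (D z b - D x0 b)))"
          unfolding eq by (rule norm_sum)
        also have "\<dots> \<le> (\<Sum>b\<in>(Basis::'a set). norm h * \<eta>)"
        proof (rule sum_mono)
          fix b :: 'a assume b: "b \<in> Basis"
          then have "norm (D z b - D x0 b) \<le> \<eta>" using \<delta>(2)[OF z] by (simp add: less_imp_le)
          then have "\<bar>h \<bullet> b\<bar> * norm (D z b - D x0 b) \<le> norm h * \<eta>"
            using Basis_le_norm[OF b, of h] by (intro mult_mono) auto
          then show "norm ((h \<bullet> b) *\<^sub>R (D z b - D x0 b)) \<le> norm h * \<eta>" by simp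
        qed
        also have "\<dots> = \<epsilon> * norm h" by (simp add: \<eta>_def)
        finally show "norm (D z h - D x0 h) \<le> \<epsilon> * norm h" .
      qed
    qed (use xy in auto)
    then show "norm (f x - f y - D x0 (x - y)) \<le> \<epsilon> * norm (x - y)"
      by (simp add: linear_diff[OF lin[OF V(2)]] algebra_simps)
  qed
qed

text \<open>The parameters \<open>w p\<close> need only trace out the graph of \<open>F\<close>: no inverse function theorem is
  needed, since surjectivity onto a neighbourhood of \<open>p0\<close> is built into \<open>w\<close>.\<close>

lemma parametrized_graph_local:
  fixes F :: "'x::euclidean_space \<Rightarrow> 'y::euclidean_space" and w :: "'x \<Rightarrow> 'w::euclidean_space"
  assumes P: "linear P" and Q: "linear Q" and W: "subspace W"
    and short: "\<And>h. h \<in> W \<Longrightarrow> h \<noteq> 0 \<Longrightarrow> norm (Q h) < norm (P h)"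
    and strict: "\<And>\<epsilon>. \<epsilon> > 0 \<Longrightarrow> \<exists>\<delta>>0. \<forall>p\<in>ball p0 \<delta>. \<forall>p'\<in>ball p0 \<delta>. w p - w p' \<in> W \<and>
        norm (p - p' - P (w p - w p')) \<le> \<epsilon> * norm (w p - w p') \<and>
        norm (F p - F p' - Q (w p - w p')) \<le> \<epsilon> * norm (w p - w p')"
  shows "\<exists>\<kappa><1. \<exists>\<delta>>0. \<forall>p\<in>ball p0 \<delta>. \<forall>p'\<in>ball p0 \<delta>. norm (F p - F p') \<le> \<kappa> * norm (p - p')"
    and "F differentiable (at p0)"
proof -
  \<comment> \<open>The gap scales with h, so its minimum over the compact unit sphere of
    \<open>W\<close> serves as \<open>m\<close>; for trivial \<open>W\<close> any \<open>m\<close>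
    does.\<close>
  have "\<exists>m>0. \<forall>h\<in>W. m * norm h \<le> norm (P h) - norm (Q h)"
  proof (cases "W \<inter> sphere 0 1 = {}")
    case True
    have "h = 0" if "h \<in> W" for h
    proof (rule ccontr)
      assume "h \<noteq> 0"
      then have "h /\<^sub>R norm h \<in> W \<inter> sphere 0 1"
        using that W by (simp add: subspace_scale)
      then show False using True by blast
    qed
    then have "1 * norm h \<le> norm (P h) - norm (Q h)" if "h \<in> W" for h
      using that linear_0[OF P] linear_0[OF Q] by fastforce
    then show ?thesis using zero_less_one by blast
  next
    case False
    have c: "compact (W \<inter> sphere 0 1)"
      using W by (intro closed_Int_compact closed_subspace) auto
    have "continuous_on (W \<inter> sphere 0 1) (\<lambda>h. norm (P h) - norm (Q h))"
      using P Q by (intro continuous_intros linear_continuous_on) (simp_all add: linear_conv_bounded_linear)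
    from continuous_attains_inf[OF c False this]
    obtain h0 where h0: "h0 \<in> W" "norm h0 = 1"
      "\<And>h. h \<in> W \<Longrightarrow> norm h = 1 \<Longrightarrow> norm (P h0) - norm (Q h0) \<le> norm (P h) - norm (Q h)" by auto
    let ?m = "norm (P h0) - norm (Q h0)"
    have "?m * norm h \<le> norm (P h) - norm (Q h)" if "h \<in> W" for h
    proof (cases "h = 0")
      case False
      have "?m \<le> norm (P (h /\<^sub>R norm h)) - norm (Q (h /\<^sub>R norm h))"
        using False that W by (intro h0) (simp_all add: subspace_scale)
      also have "\<dots> = (norm (P h) - norm (Q h)) / norm h"
        using False by (simp add: linear_scale[OF P] linear_scale[OF Q] divide_inverse algebra_simps)
      finally show ?thesis using False by (simp add: le_divide_eq)
    qed (simp add: linear_0[OF P] linear_0[OF Q])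
    moreover have "?m > 0" using short[OF h0(1)] h0(2) by force
    ultimately show ?thesis by blast
  qed
  then obtain m where m: "m > 0" "\<And>h. h \<in> W \<Longrightarrow> m * norm h \<le> norm (P h) - norm (Q h)" by blast
  obtain B where B: "B > 0" "\<And>h. norm (P h) \<le> B * norm h"
    using linear_bounded_pos[OF P] by blast
  have mW: "m * norm h \<le> norm (P h)" if "h \<in> W" for h
    using m(2)[OF that] norm_ge_zero[of "Q h"] by linarith
  show "\<exists>\<kappa><1. \<exists>\<delta>>0. \<forall>p\<in>ball p0 \<delta>. \<forall>p'\<in>ball p0 \<delta>. norm (F p - F p') \<le> \<kappa> * norm (p - p')"
  proof -
    obtain \<delta> where \<delta>: "\<delta> > 0" and s: "\<And>p p'. p \<in> ball p0 \<delta> \<Longrightarrow> p' \<in> ball p0 \<delta> \<Longrightarrow> w p - w p' \<in> W \<and>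
        norm (p - p' - P (w p - w p')) \<le> m / 4 * norm (w p - w p') \<and>
        norm (F p - F p' - Q (w p - w p')) \<le> m / 4 * norm (w p - w p')"
      using strict[of "m / 4"] m(1) by auto
    \<comment> \<open>With h the increment of \<open>w\<close>, both first-order errors cost m/4
      |h|. Hence |F p - F p'| \<le> |p - p'| - m/2 |h|, while |p - p'| \<le> (B + m/4) |h|.
      Eliminating |h| gives this value.\<close>
    define \<kappa> where "\<kappa> = 1 - (m / 2) / (B + m / 4)"
    have "norm (F p - F p') \<le> \<kappa> * norm (p - p')" if pp: "p \<in> ball p0 \<delta>" "p' \<in> ball p0 \<delta>" for p p'
    proof -
      let ?h = "w p - w p'"
      have "norm (F p - F p') \<le> norm (Q ?h) + m / 4 * norm ?h"
        using s[OF pp] norm_triangle_sub[of "F p - F p'" "Q ?h"] by linarith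
      moreover have "norm (P ?h) \<le> norm (p - p') + m / 4 * norm ?h"
        using s[OF pp] norm_triangle_sub[of "P ?h" "p - p'"] by (simp add: norm_minus_commute)
      moreover have "m * norm ?h \<le> norm (P ?h) - norm (Q ?h)"
        using s[OF pp] m(2) by blast
      ultimately have 1: "norm (F p - F p') \<le> norm (p - p') - m / 2 * norm ?h" by linarith
      have "norm (p - p') \<le> B * norm ?h + m / 4 * norm ?h"
        using s[OF pp] norm_triangle_sub[of "p - p'" "P ?h"] B(2)[of ?h] by linarith
      then have "norm (p - p') / (B + m / 4) \<le> norm ?h"
        using B(1) m(1) by (simp add: divide_le_eq algebra_simps)
      then have "m / 2 * (norm (p - p') / (B + m / 4)) \<le> m / 2 * norm ?h"
        using m(1) by (intro mult_left_mono) auto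
      moreover have "\<kappa> * norm (p - p') = norm (p - p') - m / 2 * (norm (p - p') / (B + m / 4))"
        by (simp add: \<kappa>_def left_diff_distrib)
      ultimately show ?thesis using 1 by linarith
    qed
    moreover have "\<kappa> < 1" using B(1) m(1) by (simp add: \<kappa>_def)
    ultimately show ?thesis using \<delta> by (intro exI[of _ \<kappa>] conjI exI[of _ \<delta>] ballI)
  qed
  \<comment> \<open>The gap \<open>m\<close> makes \<open>P\<close> injective on \<open>W\<close>; a
    left inverse \<open>R\<close> then gives the candidate Q R for the derivative of
    \<open>F\<close>.\<close>
  have "inj_on P W"
  proof (rule inj_onI)
    fix h h' assume h: "h \<in> W" "h' \<in> W" "P h = P h'"
    have "m * norm (h - h') \<le> norm (P (h - h'))"
      using h W by (intro mW) (simp add: subspace_diff)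
    then have "m * norm (h - h') \<le> 0"
      using h(3) by (simp add: linear_diff[OF P])
    then show "h = h'" using m(1) by (simp add: mult_le_0_iff)
  qed
  from linear_exists_left_inverse_on[OF P W this]
  obtain R where R: "linear R" "\<And>h. h \<in> W \<Longrightarrow> R (P h) = h" by auto
  obtain C where C: "C > 0" "\<And>v. norm (Q (R v)) \<le> C * norm v"
    using linear_bounded_pos[OF linear_compose[OF R(1) Q]] by (auto simp: o_def)
  have "(F has_derivative (\<lambda>v. Q (R v))) (at p0)"
    unfolding has_derivative_at_alt
  proof (intro conjI allI impI)
    show "bounded_linear (\<lambda>v. Q (R v))"
      using linear_compose[OF R(1) Q] by (simp add: o_def linear_conv_bounded_linear)
    fix e :: real assume e: "e > 0"
    \<comment> \<open>The first bound gives |h| \<le> (2 / m) |p - p0|, and the second then turns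
      the total error \<epsilon> (1 + C) |h| into e |p - p0|.\<close>
    define \<epsilon> where "\<epsilon> = min (m / 2) (e * (m / 2) / (1 + C))"
    have \<epsilon>: "\<epsilon> > 0" "\<epsilon> \<le> m / 2" "\<epsilon> * (1 + C) \<le> e * (m / 2)"
    proof -
      show "\<epsilon> > 0" using m(1) e C(1) by (simp add: \<epsilon>_def)
      show "\<epsilon> \<le> m / 2" unfolding \<epsilon>_def by (rule min.cobounded1)
      have "\<epsilon> \<le> e * (m / 2) / (1 + C)" unfolding \<epsilon>_def by (rule min.cobounded2)
      moreover have "0 < 1 + C" using C(1) by simp
      ultimately show "\<epsilon> * (1 + C) \<le> e * (m / 2)" by (simp only: pos_le_divide_eq)
    qed
    obtain \<delta> where \<delta>: "\<delta> > 0" and s: "\<And>p p'. p \<in> ball p0 \<delta> \<Longrightarrow> p' \<in> ball p0 \<delta> \<Longrightarrow> w p - w p' \<in> W \<and>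
        norm (p - p' - P (w p - w p')) \<le> \<epsilon> * norm (w p - w p') \<and>
        norm (F p - F p' - Q (w p - w p')) \<le> \<epsilon> * norm (w p - w p')"
      using strict[OF \<epsilon>(1)] by auto
    show "\<exists>d>0. \<forall>y. norm (y - p0) < d \<longrightarrow> norm (F y - F p0 - Q (R (y - p0))) \<le> e * norm (y - p0)"
    proof (intro exI[of _ \<delta>] conjI allI impI \<delta>)
      fix p assume "norm (p - p0) < \<delta>"
      then have pb: "p \<in> ball p0 \<delta>" "p0 \<in> ball p0 \<delta>"
        using \<delta> by (auto simp: dist_norm norm_minus_commute)
      let ?h = "w p - w p0" and ?n = "p - p0"
      note sp = s[OF pb]
      have "norm (P ?h) \<le> norm ?n + \<epsilon> * norm ?h"
        using sp norm_triangle_sub[of "P ?h" ?n] norm_minus_commute[of ?n "P ?h"] by linarith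
      moreover have "m * norm ?h \<le> norm (P ?h)" using sp mW by blast
      moreover have "\<epsilon> * norm ?h \<le> m / 2 * norm ?h" using \<epsilon> by (intro mult_right_mono) auto
      ultimately have h: "m / 2 * norm ?h \<le> norm ?n" by linarith
      have "Q (R ?n) = Q ?h + Q (R (?n - P ?h))"
        using sp R(2)[of ?h] by (simp add: linear_diff[OF R(1)] linear_diff[OF Q])
      then have eq: "F p - F p0 - Q (R ?n) = (F p - F p0 - Q ?h) - Q (R (?n - P ?h))" by simp
      have "norm (F p - F p0 - Q (R ?n)) \<le> norm (F p - F p0 - Q ?h) + norm (Q (R (?n - P ?h)))"
        unfolding eq by (rule norm_triangle_ineq4)
      also have "\<dots> \<le> \<epsilon> * norm ?h + C * (\<epsilon> * norm ?h)"
        using sp C by (intro add_mono order_trans[OF C(2)] mult_left_mono) auto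
      also have "\<dots> = (\<epsilon> * (1 + C)) * norm ?h" by (simp add: algebra_simps)
      also have "\<dots> \<le> (e * (m / 2)) * norm ?h" using \<epsilon> by (intro mult_right_mono) auto
      also have "\<dots> = e * (m / 2 * norm ?h)" by simp
      also have "\<dots> \<le> e * norm ?n" using h e by (intro mult_left_mono) auto
      finally show "norm (F p - F p0 - Q (R (p - p0))) \<le> e * norm (p - p0)" .
    qed
  qed
  then show "F differentiable (at p0)" by (auto simp: differentiable_def)
qed

text \<open>Finitely many of the balls cover the unit sphere, which makes the bound on derivatives
  uniform, and homogeneity spreads it to every nonzero point. The mean value inequality handles
  segments that avoid 0. On a segment through 0 the norms of the endpoints add up to their distance,
  and |F p| \<le> \<kappa> |p| suffices.\<close>

lemma local_short_imp_short_cone: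
  fixes F :: "'x::euclidean_space \<Rightarrow> 'y::euclidean_space"
  assumes hom: "\<And>t p. t \<ge> 0 \<Longrightarrow> F (t *\<^sub>R p) = t *\<^sub>R F p"
    and diff: "\<And>p. p \<noteq> 0 \<Longrightarrow> F differentiable (at p)"
    and loc: "\<And>u. u \<in> sphere 0 1 \<Longrightarrow> \<exists>\<kappa><1. \<exists>\<delta>>0. \<forall>p\<in>ball u \<delta>. \<forall>p'\<in>ball u \<delta>. norm (F p - F p') \<le> \<kappa> * norm (p - p')"
  obtains \<kappa> where "0 \<le> \<kappa>" "\<kappa> < 1" "short_cone \<kappa> F"
proof -
  have "\<forall>u\<in>sphere 0 1. \<exists>k \<delta>. k < 1 \<and> \<delta> > 0 \<and> (\<forall>p\<in>ball u \<delta>. \<forall>p'\<in>ball u \<delta>. norm (F p - F p') \<le> k * norm (p - p'))"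
    using loc by meson
  then obtain k d where kd: "\<And>u. u \<in> sphere 0 1 \<Longrightarrow> k u < 1" "\<And>u. u \<in> sphere 0 1 \<Longrightarrow> d u > 0"
    "\<And>u p p'. u \<in> sphere 0 1 \<Longrightarrow> p \<in> ball u (d u) \<Longrightarrow> p' \<in> ball u (d u) \<Longrightarrow> norm (F p - F p') \<le> k u * norm (p - p')"
    by (metis (no_types, lifting))
  have "sphere 0 1 \<subseteq> (\<Union>u\<in>sphere 0 1. ball u (d u))"
    using kd(2) by force
  from compactE_image[OF compact_sphere _ this]
  obtain C where C: "C \<subseteq> sphere 0 1" "finite C" "sphere 0 1 \<subseteq> (\<Union>u\<in>C. ball u (d u))" by auto
  \<comment> \<open>Inserting 0 keeps \<kappa> nonnegative, as the local constants may be
    negative.\<close>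
  define \<kappa> where "\<kappa> = Max (insert 0 (k ` C))"
  have \<kappa>: "0 \<le> \<kappa>" "\<kappa> < 1" "\<And>u. u \<in> C \<Longrightarrow> k u \<le> \<kappa>"
    unfolding \<kappa>_def using C kd(1) by (auto intro!: Max_ge)
  have der1: "\<exists>F'. (F has_derivative F') (at v) \<and> (\<forall>h. norm (F' h) \<le> \<kappa> * norm h)" if v: "v \<in> sphere 0 1" for v
  proof -
    obtain u where u: "u \<in> C" "v \<in> ball u (d u)" using C(3) v by blast
    have "v \<noteq> 0" using v by auto
    then obtain F' where F': "(F has_derivative F') (at v)"
      using diff unfolding differentiable_def by blast
    have "norm (F' h) \<le> k u * norm h" for h
    proof (rule has_derivative_local_lipschitz_bound[OF F'])
      have "\<forall>\<^sub>F y in nhds v. y \<in> ball u (d u)"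
        using u(2) by (intro eventually_nhds_in_open) auto
      then show "\<forall>\<^sub>F y in nhds v. norm (F y - F v) \<le> k u * norm (y - v)"
        by (rule eventually_mono) (use kd(3) u C(1) in blast)
    qed
    then have "norm (F' h) \<le> \<kappa> * norm h" for h
      using mult_right_mono[OF \<kappa>(3)[OF u(1)], of "norm h"] order_trans by fastforce
    with F' show ?thesis by blast
  qed
  have der: "\<exists>F'. (F has_derivative F') (at p) \<and> (\<forall>h. norm (F' h) \<le> \<kappa> * norm h)" if p: "p \<noteq> 0" for p
  proof -
    have "p /\<^sub>R norm p \<in> sphere 0 1" using p by simp
    then obtain F' where F': "(F has_derivative F') (at (p /\<^sub>R norm p))" "\<And>h. norm (F' h) \<le> \<kappa> * norm h"
      using der1 by blast
    have "(F has_derivative F') (at (norm p *\<^sub>R (p /\<^sub>R norm p)))"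
      by (rule homogeneous_has_derivative_scale[OF hom F'(1)]) (use p in auto)
    then show ?thesis using F'(2) p by auto
  qed
  then obtain F' where F': "\<And>p. p \<noteq> 0 \<Longrightarrow> (F has_derivative F' p) (at p)"
    "\<And>p h. p \<noteq> 0 \<Longrightarrow> norm (F' p h) \<le> \<kappa> * norm h"
    by metis
  have seg: "norm (F p - F p') \<le> \<kappa> * norm (p - p')" if 0: "0 \<notin> closed_segment p p'" for p p'
  proof (rule differentiable_bound[OF convex_closed_segment[of p p'], of F F'])
    fix z assume "z \<in> closed_segment p p'"
    then have z: "z \<noteq> 0" using 0 by blast
    show "(F has_derivative F' z) (at z within closed_segment p p')"
      by (rule has_derivative_at_withinI[OF F'(1)[OF z]])
    show "onorm (F' z) \<le> \<kappa>"
      by (rule onorm_le) (rule F'(2)[OF z])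
  qed auto
  have F0: "F 0 = 0" using hom[of 0 0] by simp
  have norm_le: "norm (F p) \<le> \<kappa> * norm p" for p
  proof (cases "p = 0")
    case False
    \<comment> \<open>The segment from p to p / 2 avoids 0, and by homogeneity its Lipschitz
      estimate is half of the desired bound.\<close>
    have "0 \<notin> closed_segment p ((1/2) *\<^sub>R p)"
    proof
      assume "0 \<in> closed_segment p ((1/2) *\<^sub>R p)"
      then obtain u where u: "0 \<le> u" "u \<le> 1" "0 = (1 - u) *\<^sub>R p + u *\<^sub>R ((1/2) *\<^sub>R p)"
        by (auto simp: closed_segment_def)
      have "(1 - u) *\<^sub>R p + u *\<^sub>R ((1/2) *\<^sub>R p) = (1 - u / 2) *\<^sub>R p"
        by (simp add: scaleR_left_distrib[symmetric])
      with u False show False by simp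
    qed
    from seg[OF this] have "norm (F p - (1/2) *\<^sub>R F p) \<le> \<kappa> * norm (p - (1/2) *\<^sub>R p)"
      using hom[of "1/2" p] by simp
    moreover have "F p - (1/2) *\<^sub>R F p = (1/2) *\<^sub>R F p" "p - (1/2) *\<^sub>R p = (1/2) *\<^sub>R p"
      using scaleR_left_diff_distrib[of 1 "1/2" "F p"] scaleR_left_diff_distrib[of 1 "1/2" p] by simp_all
    ultimately show ?thesis by simp
  qed (simp add: F0)
  have lip: "norm (F p - F p') \<le> \<kappa> * norm (p - p')" for p p'
  proof (cases "0 \<in> closed_segment p p'")
    case True
    then have "norm (p - p') = norm p + norm p'"
      using between_mem_segment[of p p' 0] by (simp add: between dist_norm)
    moreover have "norm (F p - F p') \<le> norm (F p) + norm (F p')" by (rule norm_triangle_ineq4)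
    ultimately show ?thesis
      using norm_le[of p] norm_le[of p'] by (simp add: distrib_left)
  qed (rule seg)
  show ?thesis
    using that[OF \<kappa>(1,2)] lip hom diff by (simp add: short_cone_def)
qed

text \<open>The curve is the image under \<psi> of the line through \<open>l0\<close> in direction
  \<open>d\<close>, which stays in the slice \<open>L\<close>.\<close>

lemma chart_tangent_vector:
  fixes \<psi> :: "'e::euclidean_space \<Rightarrow> 'e"
  assumes V: "open V" "l0 \<in> V" and \<psi>: "smooth_on V \<psi>" and L: "subspace L" "l0 \<in> L" "d \<in> L"
    and sub: "\<psi> ` (V \<inter> L) \<subseteq> N"
  shows "tangent_vector N (\<psi> l0) (frechet_derivative \<psi> (at l0) d)"
proof -
  obtain e where e: "e > 0" "ball l0 e \<subseteq> V" using V open_contains_ball by blast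
  \<comment> \<open>The summand 1 covers d = 0.\<close>
  define \<epsilon> where "\<epsilon> = e / (1 + norm d)"
  have \<epsilon>: "\<epsilon> > 0" using e by (simp add: \<epsilon>_def add_pos_nonneg)
  have inV: "l0 + t *\<^sub>R d \<in> V" if "t \<in> {-\<epsilon><..<\<epsilon>}" for t
  proof -
    have "\<bar>t\<bar> < \<epsilon>" using that by auto
    then have "\<bar>t\<bar> * (1 + norm d) < e"
      using norm_ge_zero[of d] by (simp add: \<epsilon>_def pos_less_divide_eq add_pos_nonneg)
    moreover have "\<bar>t\<bar> * norm d \<le> \<bar>t\<bar> * (1 + norm d)" by (simp add: algebra_simps)
    ultimately have "dist l0 (l0 + t *\<^sub>R d) < e" by (simp add: dist_norm)
    then show ?thesis using e by auto
  qed
  let ?\<gamma> = "\<lambda>t. \<psi> (l0 + t *\<^sub>R d)"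
  have "smooth_on {-\<epsilon><..<\<epsilon>} ?\<gamma>"
    using \<psi> inV unfolding smooth_on_def by (auto intro: Ck_on_line)
  moreover have "?\<gamma> ` {-\<epsilon><..<\<epsilon>} \<subseteq> N"
  proof (rule image_subsetI)
    fix t assume "t \<in> {-\<epsilon><..<\<epsilon>}"
    then have "l0 + t *\<^sub>R d \<in> V \<inter> L"
      using inV L by (simp add: subspace_add subspace_scale)
    then show "?\<gamma> t \<in> N" using sub by blast
  qed
  moreover have "(?\<gamma> has_vector_derivative frechet_derivative \<psi> (at l0) d) (at 0)"
  proof -
    have "Ck_on 1 V \<psi>" using \<psi> by (simp only: smooth_on_def)
    then have "(\<psi> has_derivative frechet_derivative \<psi> (at l0)) (at l0)"
      using V by (simp add: frechet_derivative_works[symmetric])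
    then have 1: "(\<psi> has_derivative frechet_derivative \<psi> (at l0)) (at (l0 + 0 *\<^sub>R d))" by simp
    have 2: "((\<lambda>t. l0 + t *\<^sub>R d) has_derivative (\<lambda>h. h *\<^sub>R d)) (at 0)"
      by (auto intro!: derivative_eq_intros)
    show ?thesis
      using has_derivative_compose[OF 2 1] linear_scale[OF has_derivative_linear[OF 1]]
      by (simp add: has_vector_derivative_def)
  qed
  ultimately show ?thesis
    unfolding tangent_vector_def using \<epsilon> by (intro exI[of _ \<epsilon>] conjI exI[of _ ?\<gamma>]) auto
qed

text \<open>Differentiate the constant |f|^2 - |g|^2 along a curve in \<open>N\<close>.\<close>

lemma tangent_vector_orthogonal:
  fixes N :: "'e::euclidean_space set" and f :: "'e \<Rightarrow> 'x::euclidean_space" and g :: "'e \<Rightarrow> 'y::euclidean_space"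
  assumes lin: "linear f" "linear g"
    and N: "\<And>x. x \<in> N \<Longrightarrow> (norm (f x))\<^sup>2 - (norm (g x))\<^sup>2 = 1"
    and tv: "tangent_vector N x v"
  shows "f x \<bullet> f v = g x \<bullet> g v"
proof -
  obtain \<epsilon> \<gamma> where \<gamma>: "\<epsilon> > 0" "\<gamma> ` {-\<epsilon><..<\<epsilon>} \<subseteq> N" "\<gamma> (0::real) = x" "(\<gamma> has_vector_derivative v) (at 0)"
    using tv unfolding tangent_vector_def by blast
  have bl: "bounded_linear f" "bounded_linear g" using lin by (simp_all add: linear_conv_bounded_linear)
  have 1: "((\<lambda>t. f (\<gamma> t)) has_vector_derivative f v) (at 0)" "((\<lambda>t. g (\<gamma> t)) has_vector_derivative g v) (at 0)"
    using bounded_linear.has_vector_derivative[OF bl(1) \<gamma>(4)] bounded_linear.has_vector_derivative[OF bl(2) \<gamma>(4)] by auto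
  have "((\<lambda>t. f (\<gamma> t) \<bullet> f (\<gamma> t) - g (\<gamma> t) \<bullet> g (\<gamma> t)) has_derivative
      (\<lambda>h. (f (\<gamma> 0) \<bullet> (h *\<^sub>R f v) + (h *\<^sub>R f v) \<bullet> f (\<gamma> 0)) - (g (\<gamma> 0) \<bullet> (h *\<^sub>R g v) + (h *\<^sub>R g v) \<bullet> g (\<gamma> 0)))) (at 0)"
    using 1 unfolding has_vector_derivative_def by (intro has_derivative_diff has_derivative_inner)
  moreover have "((\<lambda>t. f (\<gamma> t) \<bullet> f (\<gamma> t) - g (\<gamma> t) \<bullet> g (\<gamma> t)) has_derivative (\<lambda>h. 0)) (at 0)"
  proof (rule has_derivative_transform_within_open[of "\<lambda>t. 1 :: real" _ _ _ "{-\<epsilon><..<\<epsilon>}"])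
    show "1 = f (\<gamma> t) \<bullet> f (\<gamma> t) - g (\<gamma> t) \<bullet> g (\<gamma> t)" if "t \<in> {-\<epsilon><..<\<epsilon>}" for t
    proof -
      have "\<gamma> t \<in> N" using \<gamma>(2) that by blast
      from N[OF this] show ?thesis by (simp add: power2_norm_eq_inner)
    qed
  qed (use \<gamma>(1) in auto)
  ultimately have "(\<lambda>h. (f (\<gamma> 0) \<bullet> (h *\<^sub>R f v) + (h *\<^sub>R f v) \<bullet> f (\<gamma> 0)) - (g (\<gamma> 0) \<bullet> (h *\<^sub>R g v) + (h *\<^sub>R g v) \<bullet> g (\<gamma> 0))) = (\<lambda>h. 0)"
    by (rule has_derivative_unique)
  from fun_cong[OF this, of 1] show ?thesis
    by (simp add: \<gamma>(3) inner_commute)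
qed

text \<open>Stated for arbitrary \<open>f, g\<close> so that it serves both kinds of necks: \<open>(f, g) = (fst, snd)\<close> and \<open>(snd, fst)\<close>.\<close>

lemma neck_short_cone:
  fixes N :: "'e::euclidean_space set" and f :: "'e \<Rightarrow> 'x::euclidean_space" and g :: "'e \<Rightarrow> 'y::euclidean_space"
  assumes lin: "linear f" "linear g"
    and N1: "\<And>x. x \<in> N \<Longrightarrow> (norm (f x))\<^sup>2 - (norm (g x))\<^sup>2 = 1"
    and sm: "smooth_submanifold k N"
    and tan: "\<And>x v. x \<in> N \<Longrightarrow> tangent_vector N x v \<Longrightarrow> v \<noteq> 0 \<Longrightarrow> norm (g v) < norm (f v)"
    and s: "continuous_on (sphere 0 1) s" "N = s ` sphere 0 1"
      "\<And>u. u \<in> sphere 0 1 \<Longrightarrow> f (s u) /\<^sub>R norm (f (s u)) = u"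
  obtains F \<kappa> where "0 \<le> \<kappa>" "\<kappa> < 1" "short_cone \<kappa> F"
    "(\<lambda>x. (f x, g x)) ` N = (\<lambda>p. (p, F p)) ` {p. cone_length F p = 1}"
proof -
  define \<rho> where "\<rho> u = norm (f (s u))" for u
  define n where "n p = p /\<^sub>R norm p" for p :: 'x
  \<comment> \<open>\<open>c p\<close> rescales the section so that its projection has norm |p|;
    thus \<open>\<sigma> p\<close> is the point of the cone over \<open>N\<close> that
    \<open>f\<close> projects to \<open>p\<close>, and it is 0 at the origin.\<close>
  define c where "c p = norm p / \<rho> (n p)" for p
  define \<sigma> where "\<sigma> p = c p *\<^sub>R s (n p)" for p
  define F where "F p = g (\<sigma> p)" for p
  have bl: "bounded_linear f" "bounded_linear g" using lin by (simp_all add: linear_conv_bounded_linear)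
  have sN: "s u \<in> N" if "u \<in> sphere 0 1" for u using that s(2) by blast
  have \<rho>: "\<rho> u > 0" if "u \<in> sphere 0 1" for u
  proof -
    have "(\<rho> u)\<^sup>2 = 1 + (norm (g (s u)))\<^sup>2" using N1[OF sN[OF that]] by (simp add: \<rho>_def)
    then have "\<rho> u \<noteq> 0" by (auto simp: add_nonneg_eq_0_iff)
    then show ?thesis by (simp add: \<rho>_def)
  qed
  have fs: "f (s u) = \<rho> u *\<^sub>R u" if "u \<in> sphere 0 1" for u
  proof -
    have "\<rho> u *\<^sub>R u = \<rho> u *\<^sub>R (f (s u) /\<^sub>R \<rho> u)" using s(3)[OF that] by (simp add: \<rho>_def)
    then show ?thesis using \<rho>[OF that] by simp
  qed
  have n: "n p \<in> sphere 0 1" if "p \<noteq> 0" for p using that by (simp add: n_def)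
  have c_pos: "c p > 0" if "p \<noteq> 0" for p using that \<rho>[OF n[OF that]] by (simp add: c_def)
  have f\<sigma>: "f (\<sigma> p) = p" for p
  proof (cases "p = 0")
    case False
    have "f (\<sigma> p) = c p *\<^sub>R (\<rho> (n p) *\<^sub>R n p)"
      unfolding \<sigma>_def linear_scale[OF lin(1)] fs[OF n[OF False]] ..
    then show ?thesis
      using False \<rho>[OF n[OF False]] by (simp add: c_def n_def)
  qed (simp add: \<sigma>_def c_def linear_0[OF lin(1)])
  have \<sigma>_scale: "\<sigma> (t *\<^sub>R p) = t *\<^sub>R \<sigma> p" if "t \<ge> 0" for t p
  proof (cases "t = 0")
    case False
    then have "n (t *\<^sub>R p) = n p" using that by (simp add: n_def)
    then show ?thesis using that by (simp add: \<sigma>_def c_def)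
  qed (simp add: \<sigma>_def c_def)
  have hom: "F (t *\<^sub>R p) = t *\<^sub>R F p" if "t \<ge> 0" for t p
    unfolding F_def \<sigma>_scale[OF that] by (rule linear_scale[OF lin(2)])
  have n_cont: "continuous_on (- {0}) n"
    unfolding n_def by (intro continuous_intros) auto
  have sn_cont: "continuous_on (- {0}) (\<lambda>p. s (n p))"
    by (rule continuous_on_compose2[OF s(1) n_cont]) (intro image_subsetI n, simp)
  have c_cont: "continuous_on (- {0}) c"
  proof -
    have "norm (f (s (n p))) \<noteq> 0" if "p \<noteq> 0" for p
      using \<rho>[OF n[OF that]] by (simp add: \<rho>_def)
    then show ?thesis
      unfolding c_def \<rho>_def
      by (intro continuous_on_divide continuous_on_norm[OF continuous_on_id]
          continuous_on_norm[OF bounded_linear.continuous_on[OF bl(1) sn_cont]]) simp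
  qed
  have local: "(\<exists>\<kappa><1. \<exists>\<delta>>0. \<forall>p\<in>ball p0 \<delta>. \<forall>p'\<in>ball p0 \<delta>. norm (F p - F p') \<le> \<kappa> * norm (p - p'))
      \<and> F differentiable (at p0)" if p0: "p0 \<noteq> 0" for p0
  proof -
    define x0 where "x0 = s (n p0)"
    have x0: "x0 \<in> N" unfolding x0_def by (rule sN[OF n[OF p0]])
    from sm[unfolded smooth_submanifold_def, rule_format, OF x0]
    obtain U V L \<phi> \<psi> where ch: "open U" "x0 \<in> U" "open V" "subspace L" "homeomorphism U V \<phi> \<psi>"
      "smooth_on U \<phi>" "smooth_on V \<psi>" "\<phi> ` (N \<inter> U) = V \<inter> (L :: 'e set)"
      by (elim exE conjE)
    define l0 where "l0 = \<phi> x0"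
    define D where "D y = frechet_derivative \<psi> (at y)" for y
    have inv: "\<psi> (\<phi> x) = x" if "x \<in> U" for x using homeomorphism_apply1[OF ch(5) that] .
    have inv': "\<phi> (\<psi> y) = y" if "y \<in> V" for y using homeomorphism_apply2[OF ch(5) that] .
    have \<phi>N: "\<phi> x \<in> V \<inter> L" if "x \<in> N" "x \<in> U" for x using ch(8) that by blast
    have l0: "l0 \<in> V" "l0 \<in> L" "\<psi> l0 = x0"
      using \<phi>N[OF x0 ch(2)] inv[OF ch(2)] by (auto simp: l0_def)
    have "Ck_on (Suc 0) V \<psi>" "Ck_on (Suc 0) U \<phi>" using ch(6,7) unfolding smooth_on_def by blast+
    then have \<psi>der: "\<And>y. y \<in> V \<Longrightarrow> (\<psi> has_derivative D y) (at y)"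
      and Dcont: "\<And>v. continuous_on V (\<lambda>y. D y v)"
      and \<phi>diff: "\<And>x. x \<in> U \<Longrightarrow> \<phi> differentiable (at x)"
      by (simp_all add: D_def frechet_derivative_works[symmetric])
    have linD: "linear (D l0)" using \<psi>der[OF l0(1)] by (rule has_derivative_linear)
    \<comment> \<open>\<phi> is a differentiable left inverse of \<psi>, so its derivative is a left
      inverse of \<open>D l0\<close>.\<close>
    have Dinj: "d = 0" if "D l0 d = 0" for d
    proof -
      obtain \<phi>' where \<phi>': "(\<phi> has_derivative \<phi>') (at (\<psi> l0))"
        using \<phi>diff[OF ch(2)] l0(3) unfolding differentiable_def by auto
      have "((\<lambda>y. y) has_derivative (\<lambda>h. \<phi>' (D l0 h))) (at l0)"
        by (rule has_derivative_transform_within_open[OF has_derivative_compose[OF \<psi>der[OF l0(1)] \<phi>'] ch(3) l0(1)])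
           (rule inv')
      then have "(\<lambda>h. \<phi>' (D l0 h)) = (\<lambda>h. h)"
        by (rule has_derivative_unique) (rule has_derivative_ident)
      from fun_cong[OF this, of d] show ?thesis
        using that linear_0[OF has_derivative_linear[OF \<phi>']] by simp
    qed
    have sub: "\<psi> ` (V \<inter> L) \<subseteq> N"
      unfolding ch(8)[symmetric] using inv by auto
    define A where "A = {p \<in> - {0}. s (n p) \<in> U}"
    have "A = - {0} \<inter> (\<lambda>p. s (n p)) -` U" by (auto simp: A_def)
    then have A: "open A"
      using continuous_open_preimage[OF sn_cont _ ch(1)] by (simp add: open_Compl)
    have p0A: "p0 \<in> A" using p0 ch(2) by (simp add: A_def x0_def)
    \<comment> \<open>Coordinates of \<open>\<sigma> p\<close> on the cone: radial factor and chart
      point. The section is only known to be continuous, hence so is \<open>w\<close>;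
      differentiability comes from \<open>\<eta>\<close>, which maps these coordinates back to the
      cone.\<close>
    define w where "w p = (c p, \<phi> (s (n p)))" for p
    have wcont: "continuous_on A w"
      unfolding w_def
      by (intro continuous_on_Pair continuous_on_subset[OF c_cont]
          continuous_on_compose2[OF homeomorphism_cont1[OF ch(5)] continuous_on_subset[OF sn_cont]])
         (auto simp: A_def)
    define \<eta> where "\<eta> z = fst z *\<^sub>R \<psi> (snd z)" for z
    define T where "T z h = fst h *\<^sub>R \<psi> (snd z) + fst z *\<^sub>R D (snd z) (snd h)" for z h
    have \<eta>der: "(\<eta> has_derivative T z) (at z)" if "z \<in> UNIV \<times> V" for z
    proof -
      have "((\<lambda>z. \<psi> (snd z)) has_derivative (\<lambda>h. D (snd z) (snd h))) (at z)"
        using that by (intro has_derivative_compose[OF has_derivative_snd[OF has_derivative_ident] \<psi>der]) auto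
      then show ?thesis
        unfolding \<eta>_def T_def by (auto intro!: derivative_eq_intros)
    qed
    have Tcont: "continuous_on (UNIV \<times> V) (\<lambda>z. T z h)" for h
      unfolding T_def
      by (intro continuous_intros continuous_on_compose2[OF Dcont] 
          continuous_on_compose2[OF homeomorphism_cont2[OF ch(5)]]) auto
    define z0 where "z0 = w p0"
    have z0: "fst z0 = c p0" "snd z0 = l0" by (simp_all add: z0_def w_def l0_def x0_def)
    have z0V: "z0 \<in> UNIV \<times> V" using z0 l0(1) by (cases z0) simp
    have linT: "linear (T z0)" using \<eta>der[OF z0V] by (rule has_derivative_linear)
    let ?W = "UNIV \<times> L :: (real \<times> 'e) set"
    have W: "subspace ?W" using ch(4) by (intro subspace_Times subspace_UNIV)
    \<comment> \<open>A tangent vector of the cone is r x0 + \<tau> with \<tau> tangent to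
      \<open>N\<close>. As \<tau> is orthogonal to x0 for the indefinite form, the cross term drops
      out and the square is r^2 plus that of \<tau>.\<close>
    have short: "norm (g (T z0 h)) < norm (f (T z0 h))" if h: "h \<in> ?W" "h \<noteq> 0" for h
    proof -
      define r where "r = fst h"
      define d where "d = c p0 *\<^sub>R snd h"
      define \<tau> where "\<tau> = D l0 d"
      have d: "d \<in> L" using h(1) ch(4) by (auto simp: d_def subspace_scale)
      have Th: "T z0 h = r *\<^sub>R x0 + \<tau>"
        by (simp add: T_def z0 l0(3) r_def \<tau>_def d_def linear_scale[OF linD])
      have tv: "tangent_vector N x0 \<tau>"
        using chart_tangent_vector[OF ch(3) l0(1) ch(7,4) l0(2) d sub] by (simp add: \<tau>_def D_def l0(3))
      have orth: "f x0 \<bullet> f \<tau> = g x0 \<bullet> g \<tau>"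
        by (rule tangent_vector_orthogonal[OF lin N1 tv])
      have "(norm (f (T z0 h)))\<^sup>2 - (norm (g (T z0 h)))\<^sup>2
          = r\<^sup>2 * ((norm (f x0))\<^sup>2 - (norm (g x0))\<^sup>2) + ((norm (f \<tau>))\<^sup>2 - (norm (g \<tau>))\<^sup>2)"
        unfolding Th linear_add[OF lin(1)] linear_add[OF lin(2)] linear_scale[OF lin(1)] linear_scale[OF lin(2)] power2_norm_eq_inner
        using orth by (simp add: inner_add_left inner_add_right inner_commute power2_eq_square algebra_simps)
      also have "\<dots> = r\<^sup>2 + ((norm (f \<tau>))\<^sup>2 - (norm (g \<tau>))\<^sup>2)"
        using N1[OF x0] by simp
      also have "\<dots> > 0"
      proof (cases "\<tau> = 0")
        case True
        then have "d = 0" using Dinj by (simp add: \<tau>_def)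
        then have "snd h = 0" using c_pos[OF p0] by (simp add: d_def)
        then have "r \<noteq> 0" using h(2) by (auto simp: r_def prod_eq_iff)
        then show ?thesis using True by (simp add: linear_0[OF lin(1)] linear_0[OF lin(2)])
      next
        case False
        have "(norm (g \<tau>))\<^sup>2 < (norm (f \<tau>))\<^sup>2"
          using tan[OF x0 tv False] by (intro power_strict_mono) auto
        then show ?thesis using zero_le_power2[of r] by linarith
      qed
      finally have "(norm (g (T z0 h)))\<^sup>2 < (norm (f (T z0 h)))\<^sup>2" by simp
      then show ?thesis by (rule power2_less_imp_less) simp
    qed
    obtain B where B: "B > 0" "\<And>x. norm (f x) \<le> B * norm x" "\<And>x. norm (g x) \<le> B * norm x"
    proof -
      obtain B1 where B1: "B1 > 0" "\<And>x. norm (f x) \<le> B1 * norm x" using linear_bounded_pos[OF lin(1)] by blast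
      obtain B2 where B2: "B2 > 0" "\<And>x. norm (g x) \<le> B2 * norm x" using linear_bounded_pos[OF lin(2)] by blast
      have "norm (f x) \<le> max B1 B2 * norm x" "norm (g x) \<le> max B1 B2 * norm x" for x
        using B1(2)[of x] B2(2)[of x] mult_right_mono[OF max.cobounded1[of B1 B2], of "norm x"]
          mult_right_mono[OF max.cobounded2[of B2 B1], of "norm x"] by auto
      then show ?thesis using that[of "max B1 B2"] B1(1) by auto
    qed
    have strict: "\<exists>\<delta>>0. \<forall>p\<in>ball p0 \<delta>. \<forall>p'\<in>ball p0 \<delta>. w p - w p' \<in> ?W \<and>
        norm (p - p' - f (T z0 (w p - w p'))) \<le> \<epsilon> * norm (w p - w p') \<and>
        norm (F p - F p' - g (T z0 (w p - w p'))) \<le> \<epsilon> * norm (w p - w p')" if \<epsilon>: "\<epsilon> > 0" for \<epsilon>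
    proof -
      have oV: "open (UNIV \<times> V :: (real \<times> 'e) set)" using ch(3) by (intro open_Times) auto
      have "\<epsilon> / B > 0" using B(1) \<epsilon> by simp
      from strict_derivative[OF oV z0V \<eta>der Tcont this]
      obtain \<delta>1 where \<delta>1: "\<delta>1 > 0" "\<And>x y. x \<in> ball z0 \<delta>1 \<Longrightarrow> y \<in> ball z0 \<delta>1 \<Longrightarrow>
          norm (\<eta> x - \<eta> y - T z0 (x - y)) \<le> \<epsilon> / B * norm (x - y)" by blast
      have "open (A \<inter> w -` ball z0 \<delta>1)"
        by (rule continuous_open_preimage[OF wcont A open_ball])
      moreover have "p0 \<in> A \<inter> w -` ball z0 \<delta>1" using p0A \<delta>1(1) by (simp add: z0_def)
      ultimately obtain \<delta> where \<delta>: "\<delta> > 0" "ball p0 \<delta> \<subseteq> A \<inter> w -` ball z0 \<delta>1"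
        using open_contains_ball by blast
      have "w p - w p' \<in> ?W \<and>
        norm (p - p' - f (T z0 (w p - w p'))) \<le> \<epsilon> * norm (w p - w p') \<and>
        norm (F p - F p' - g (T z0 (w p - w p'))) \<le> \<epsilon> * norm (w p - w p')"
        if pp: "p \<in> ball p0 \<delta>" "p' \<in> ball p0 \<delta>" for p p'
      proof -
        have in_L: "snd (w q) \<in> L" and \<eta>w: "\<eta> (w q) = \<sigma> q" if "q \<in> A" for q
          using that \<phi>N[OF sN[OF n], of q] inv[of "s (n q)"]
          by (auto simp: A_def w_def \<eta>_def \<sigma>_def)
        have pA: "p \<in> A" "p' \<in> A" "w p \<in> ball z0 \<delta>1" "w p' \<in> ball z0 \<delta>1" using pp \<delta>(2) by auto
        let ?e = "\<sigma> p - \<sigma> p' - T z0 (w p - w p')"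
        have e: "norm ?e \<le> \<epsilon> / B * norm (w p - w p')"
          using \<delta>1(2)[OF pA(3,4)] \<eta>w[OF pA(1)] \<eta>w[OF pA(2)] by simp
        have eB: "B * norm ?e \<le> \<epsilon> * norm (w p - w p')"
          using mult_left_mono[OF e, of B] B(1) by simp
        have "p - p' - f (T z0 (w p - w p')) = f ?e"
          by (simp add: linear_diff[OF lin(1)] f\<sigma>)
        moreover have "F p - F p' - g (T z0 (w p - w p')) = g ?e"
          by (simp add: linear_diff[OF lin(2)] F_def)
        moreover have "w p - w p' \<in> ?W"
          using subspace_diff[OF ch(4) in_L[OF pA(1)] in_L[OF pA(2)]] by (simp add: mem_Times_iff)
        ultimately show ?thesis
          using order_trans[OF B(2) eB] order_trans[OF B(3) eB] by simp
      qed
      then show ?thesis using \<delta>(1) by blast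
    qed
    have P: "linear (\<lambda>h. f (T z0 h))" and Q: "linear (\<lambda>h. g (T z0 h))"
      using linear_compose[OF linT lin(1)] linear_compose[OF linT lin(2)] by (simp_all add: o_def)
    show ?thesis
      using parametrized_graph_local[OF P Q W short strict] by blast
  qed
  obtain \<kappa> where \<kappa>: "0 \<le> \<kappa>" "\<kappa> < 1" "short_cone \<kappa> F"
  proof (rule local_short_imp_short_cone[of F])
    show "\<exists>\<kappa><1. \<exists>\<delta>>0. \<forall>p\<in>ball u \<delta>. \<forall>p'\<in>ball u \<delta>. norm (F p - F p') \<le> \<kappa> * norm (p - p')"
      if "u \<in> sphere 0 1" for u
    proof -
      have "u \<noteq> 0" using that by auto
      from local[OF this] show ?thesis by (rule conjunct1)
    qed
    show "F differentiable (at p)" if "p \<noteq> 0" for p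
      using local[OF that] by (rule conjunct2)
  qed (rule hom)
  have "(\<lambda>x. (f x, g x)) ` N = (\<lambda>p. (p, F p)) ` {p. cone_length F p = 1}"
  proof (intro equalityI subsetI)
    fix y assume "y \<in> (\<lambda>x. (f x, g x)) ` N"
    then obtain u where u: "u \<in> sphere 0 1" "y = (f (s u), g (s u))" using s(2) by auto
    have nu: "n (f (s u)) = u" using s(3)[OF u(1)] by (simp add: n_def)
    have "c (f (s u)) = 1" using \<rho>[OF u(1)] by (simp add: c_def nu) (simp add: \<rho>_def)
    then have "F (f (s u)) = g (s u)" by (simp add: F_def \<sigma>_def nu)
    moreover have "cone_length F (f (s u)) = 1"
      using N1[OF sN[OF u(1)]] calculation by (simp add: cone_length_def)
    ultimately show "y \<in> (\<lambda>p. (p, F p)) ` {p. cone_length F p = 1}" using u(2) by auto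
  next
    fix y assume "y \<in> (\<lambda>p. (p, F p)) ` {p. cone_length F p = 1}"
    then obtain p where p: "cone_length F p = 1" "y = (p, F p)" by auto
    have "p \<noteq> 0" using p(1) short_cone_zero[OF \<kappa>(3)] by (auto simp: cone_length_def)
    note np = n[OF this] and cp = c_pos[OF this]
    have 1: "p = c p *\<^sub>R f (s (n p))" "F p = c p *\<^sub>R g (s (n p))"
      using f\<sigma>[of p] by (simp_all add: F_def \<sigma>_def linear_scale[OF lin(1)] linear_scale[OF lin(2)])
    have "(norm p)\<^sup>2 - (norm (F p))\<^sup>2 = (c p)\<^sup>2 * ((norm (f (s (n p))))\<^sup>2 - (norm (g (s (n p))))\<^sup>2)"
      by (subst (1) 1(1), subst 1(2)) (simp add: power_mult_distrib algebra_simps)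
    also have "\<dots> = (c p)\<^sup>2" using N1[OF sN[OF np]] by simp
    finally have "c p = 1" using p(1) cp by (simp add: cone_length_def)
    then show "y \<in> (\<lambda>x. (f x, g x)) ` N" using 1 p(2) sN[OF np] by (intro image_eqI[of _ _ "s (n p)"]) auto
  qed
  with \<kappa> show ?thesis by (rule that)
qed

lemma short_cone_mono:
  assumes F: "short_cone \<kappa> F" and le: "\<kappa> \<le> \<kappa>'"
  shows "short_cone \<kappa>' F"
proof -
  have "norm (F p - F p') \<le> \<kappa>' * norm (p - p')" for p p'
    by (rule order_trans[OF short_cone_lip[OF F] mult_right_mono[OF le norm_ge_zero]])
  then show ?thesis using F by (simp add: short_cone_def)
qed

lemma neck_pos_graph:
  fixes N :: "('a::finite, 'b::finite) pseudo set"
  assumes "neck_pos N"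
  obtains F \<kappa> where "0 \<le> \<kappa>" "\<kappa> < 1" "short_cone \<kappa> F" "N = (\<lambda>p. (p, F p)) ` {p. cone_length F p = 1}"
proof -
  from assms obtain s where N: "N \<subseteq> H_pos" "smooth_submanifold (CARD('a) - 1) N"
    "\<And>x v. x \<in> N \<Longrightarrow> tangent_vector N x v \<Longrightarrow> v \<noteq> 0 \<Longrightarrow> spacelike v"
    and s: "bundle_section proj_pos H_pos (sphere 0 1) s" "N = s ` sphere 0 1"
    unfolding neck_pos_def spacelike_submanifold_def by blast
  show ?thesis
  proof (rule neck_short_cone[OF linear_fst linear_snd _ N(2) _ _ s(2)])
    show "(norm (fst x))\<^sup>2 - (norm (snd x))\<^sup>2 = 1" if "x \<in> N" for x
      using N(1) that by (auto simp: H_pos_def pinner_def power2_norm_eq_inner)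
    show "norm (snd v) < norm (fst v)" if "x \<in> N" "tangent_vector N x v" "v \<noteq> 0" for x v
    proof -
      have "(norm (snd v))\<^sup>2 < (norm (fst v))\<^sup>2"
        using N(3)[OF that] by (simp add: spacelike_def pinner_def power2_norm_eq_inner)
      then show ?thesis by (rule power2_less_imp_less) simp
    qed
    show "continuous_on (sphere 0 1) s"
      using s(1) by (simp add: bundle_section_def)
    show "fst (s u) /\<^sub>R norm (fst (s u)) = u" if "u \<in> sphere 0 1" for u
      using s(1) that by (simp add: bundle_section_def proj_pos_def)
    show ?thesis if "0 \<le> \<kappa>" "\<kappa> < 1" "short_cone \<kappa> F"
      "(\<lambda>x. (fst x, snd x)) ` N = (\<lambda>p. (p, F p)) ` {p. cone_length F p = 1}" for F \<kappa>
      using \<open>\<And>\<kappa> F. 0 \<le> \<kappa> \<Longrightarrow> \<kappa> < 1 \<Longrightarrow> short_cone \<kappa> F \<Longrightarrow> N = (\<lambda>p. (p, F p)) ` {p. cone_length F p = 1} \<Longrightarrow> thesis\<close>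
        that by simp
  qed
qed

lemma neck_neg_graph:
  fixes N :: "('a::finite, 'b::finite) pseudo set"
  assumes "neck_neg N"
  obtains G \<kappa> where "0 \<le> \<kappa>" "\<kappa> < 1" "short_cone \<kappa> G" "N = (\<lambda>q. (G q, q)) ` {q. cone_length G q = 1}"
proof -
  from assms obtain s where N: "N \<subseteq> H_neg" "smooth_submanifold (CARD('b) - 1) N"
    "\<And>x v. x \<in> N \<Longrightarrow> tangent_vector N x v \<Longrightarrow> v \<noteq> 0 \<Longrightarrow> timelike v"
    and s: "bundle_section proj_neg H_neg (sphere 0 1) s" "N = s ` sphere 0 1"
    unfolding neck_neg_def timelike_submanifold_def by blast
  show ?thesis
  proof (rule neck_short_cone[OF linear_snd linear_fst _ N(2) _ _ s(2)])
    show "(norm (snd x))\<^sup>2 - (norm (fst x))\<^sup>2 = 1" if "x \<in> N" for x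
      using N(1) that by (auto simp: H_neg_def pinner_def power2_norm_eq_inner)
    show "norm (fst v) < norm (snd v)" if "x \<in> N" "tangent_vector N x v" "v \<noteq> 0" for x v
    proof -
      have "(norm (fst v))\<^sup>2 < (norm (snd v))\<^sup>2"
        using N(3)[OF that] by (simp add: timelike_def pinner_def power2_norm_eq_inner)
      then show ?thesis by (rule power2_less_imp_less) simp
    qed
    show "continuous_on (sphere 0 1) s"
      using s(1) by (simp add: bundle_section_def)
    show "snd (s u) /\<^sub>R norm (snd (s u)) = u" if "u \<in> sphere 0 1" for u
      using s(1) that by (simp add: bundle_section_def proj_neg_def)
    show ?thesis if G: "0 \<le> \<kappa>" "\<kappa> < 1" "short_cone \<kappa> G"
      "(\<lambda>x. (snd x, fst x)) ` N = (\<lambda>q. (q, G q)) ` {q. cone_length G q = 1}" for G \<kappa>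
    proof -
      have "N = prod.swap ` (\<lambda>x. (snd x, fst x)) ` N" by (simp add: image_image)
      also have "\<dots> = (\<lambda>q. (G q, q)) ` {q. cone_length G q = 1}"
        unfolding G(4) by (simp add: image_image)
      finally show ?thesis
        using \<open>\<And>\<kappa> G. 0 \<le> \<kappa> \<Longrightarrow> \<kappa> < 1 \<Longrightarrow> short_cone \<kappa> G \<Longrightarrow> N = (\<lambda>q. (G q, q)) ` {q. cone_length G q = 1} \<Longrightarrow> thesis\<close>
          G by blast
    qed
  qed
qed

subsection \<open>Flat necks\<close>

lemma linear_short_cone:
  assumes "linear A" "\<And>p. norm (A p) \<le> \<kappa> * norm p"
  shows "short_cone \<kappa> A"
  using assms unfolding short_cone_def
  by (auto simp: linear_scale linear_imp_differentiable simp flip: linear_diff)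

text \<open>A nonzero vector with vanishing first component is not spacelike, so \<open>fst\<close>
  is injective on \<open>P\<close>, and bijective by dimension. Compactness of the unit sphere turns
  |A p| < |p| into a uniform constant.\<close>

lemma spacelike_subspace_graph:
  fixes P :: "('a::finite, 'b::finite) pseudo set"
  assumes P: "spacelike_subspace P" "dim P = CARD('a)"
  obtains A \<kappa> where "linear A" "0 \<le> \<kappa>" "\<kappa> < 1" "\<forall>p. norm (A p) \<le> \<kappa> * norm p" "P = range (\<lambda>p. (p, A p))"
proof -
  have sub: "subspace P" and sp: "\<And>x. x \<in> P \<Longrightarrow> x \<noteq> 0 \<Longrightarrow> norm (snd x) < norm (fst x)"
  proof -
    show "subspace P" using P(1) by (simp add: spacelike_subspace_def)
    fix x assume "x \<in> P" "x \<noteq> 0"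
    then have "(norm (snd x))\<^sup>2 < (norm (fst x))\<^sup>2"
      using P(1) by (auto simp: spacelike_subspace_def spacelike_def pinner_def power2_norm_eq_inner)
    then show "norm (snd x) < norm (fst x)" by (rule power2_less_imp_less) simp
  qed
  have inj: "inj_on fst P"
  proof (rule inj_onI, rule ccontr)
    fix x y assume *: "x \<in> P" "y \<in> P" "fst x = fst y" "x \<noteq> y"
    then have "norm (snd (x - y)) < norm (fst (x - y))"
      by (intro sp subspace_diff[OF sub]) auto
    then show False using * by simp
  qed
  have span: "span P = P" using sub by (simp add: span_eq_iff)
  obtain R where R: "range R \<subseteq> P" "linear R" "\<And>x. x \<in> P \<Longrightarrow> R (fst x) = x"
    using linear_exists_left_inverse_on[OF linear_fst sub inj] by auto
  have "dim (fst ` P) = CARD('a)"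
    using dim_image_eq[OF linear_fst, of P] inj span P(2) by simp
  moreover have "subspace (fst ` P)" by (rule linear_subspace_image[OF linear_fst sub])
  ultimately have surj: "fst ` P = UNIV"
    by (metis DIM_cart DIM_real dim_eq_full mult.right_neutral span_eq_iff)
  define A where "A p = snd (R p)" for p
  have graph: "(p, A p) \<in> P" for p
  proof -
    obtain x where "x \<in> P" "p = fst x" using surj by (metis UNIV_I imageE)
    then show ?thesis using R(3)[of x] by (simp add: A_def)
  qed
  have eq: "P = range (\<lambda>p. (p, A p))"
  proof
    show "P \<subseteq> range (\<lambda>p. (p, A p))"
    proof
      fix x assume "x \<in> P"
      then have "x = (fst x, A (fst x))" using R(3)[of x] by (simp add: A_def)
      then show "x \<in> range (\<lambda>p. (p, A p))" by blast
    qed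
  qed (use graph in blast)
  have lin: "linear A"
    unfolding A_def using linear_compose[OF R(2) linear_snd] by (simp add: o_def)
  have "continuous_on (sphere 0 1) (\<lambda>p. norm (A p))"
    using lin by (intro continuous_on_norm linear_continuous_on) (simp add: linear_conv_bounded_linear)
  moreover have "sphere (0 :: real^'a) 1 \<noteq> {}" by simp
  ultimately obtain u where u: "norm u = 1" "\<And>v. norm v = 1 \<Longrightarrow> norm (A v) \<le> norm (A u)"
    using continuous_attains_sup[OF compact_sphere, of 0 1 "\<lambda>p. norm (A p)"] by auto
  have "u \<noteq> 0" using u(1) by auto
  then have "norm (A u) < 1"
    using sp[OF graph[of u]] u(1) by (simp add: prod_eq_iff)
  moreover have "norm (A p) \<le> norm (A u) * norm p" for p
  proof (cases "p = 0")
    case False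
    then have "norm (A (p /\<^sub>R norm p)) \<le> norm (A u)" by (intro u(2)) simp
    then show ?thesis using False by (simp add: linear_scale[OF lin] divide_le_eq field_simps)
  qed (simp add: linear_0[OF lin])
  ultimately show ?thesis
    using that[OF lin norm_ge_zero[of "A u"]] eq by blast
qed

text \<open>For the indefinite form, the orthogonal complement of the graph of \<open>A\<close> is
  the graph of its adjoint over the second factor. By Cauchy-Schwarz the adjoint inherits the bound
  \<kappa>.\<close>

lemma flat_necks:
  fixes P :: "('a::finite, 'b::finite) pseudo set"
  assumes P: "spacelike_subspace P" "dim P = CARD('a)"
  obtains A B \<kappa> where "neck_graphs A B \<kappa>" "\<forall>p q. p \<bullet> B q = q \<bullet> A p"
    "H_pos \<inter> P = (\<lambda>p. (p, A p)) ` {p. cone_length A p = 1}"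
    "H_neg \<inter> porthogonal P = (\<lambda>q. (B q, q)) ` {q. cone_length B q = 1}"
proof -
  obtain A \<kappa> where A: "linear A" "0 \<le> \<kappa>" "\<kappa> < 1" "\<forall>p. norm (A p) \<le> \<kappa> * norm p" "P = range (\<lambda>p. (p, A p))"
    by (rule spacelike_subspace_graph[OF P])
  let ?B = "adjoint A"
  have adj: "p \<bullet> ?B q = q \<bullet> A p" for p q
    using adjoint_works[OF A(1), of p q] by (simp add: inner_commute)
  have B: "norm (?B q) \<le> \<kappa> * norm q" for q
  proof (cases "?B q = 0")
    case False
    have "norm (?B q) * norm (?B q) = q \<bullet> A (?B q)"
      using adj[of "?B q" q] by (simp add: power2_norm_eq_inner[symmetric] power2_eq_square)
    also have "\<dots> \<le> norm q * norm (A (?B q))" by (rule norm_cauchy_schwarz)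
    also have "\<dots> \<le> norm q * (\<kappa> * norm (?B q))" by (intro mult_left_mono A(4)[rule_format]) simp
    finally show ?thesis using False by (simp add: mult_ac)
  qed (use A(2) in simp)
  have "neck_graphs A ?B \<kappa>"
    using A B by (simp add: neck_graphs_def linear_short_cone adjoint_linear)
  moreover have "H_pos \<inter> P = (\<lambda>p. (p, A p)) ` {p. cone_length A p = 1}"
    by (auto simp: A(5) H_pos_def pinner_def cone_length_def power2_norm_eq_inner)
  moreover have "porthogonal P = range (\<lambda>q. (?B q, q))"
  proof (rule set_eqI)
    fix z :: "('a, 'b) pseudo"
    have "z \<in> porthogonal P \<longleftrightarrow> (\<forall>p. p \<bullet> fst z = p \<bullet> ?B (snd z))"
      by (simp add: porthogonal_def A(5) pinner_def adj inner_commute)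
    also have "\<dots> \<longleftrightarrow> fst z = ?B (snd z)" by (rule vector_eq_ldot)
    also have "\<dots> \<longleftrightarrow> z \<in> range (\<lambda>q. (?B q, q))" by (cases z) auto
    finally show "z \<in> porthogonal P \<longleftrightarrow> z \<in> range (\<lambda>q. (?B q, q))" .
  qed
  then have "H_neg \<inter> porthogonal P = (\<lambda>q. (?B q, q)) ` {q. cone_length ?B q = 1}"
    by (auto simp: H_neg_def pinner_def cone_length_def power2_norm_eq_inner)
  ultimately show ?thesis using adj that[of A ?B \<kappa>] by blast
qed

theorem theorem1p4:
  fixes P N_pos N_neg :: "('a::finite, 'b::finite) pseudo set"
  assumes "spacelike_subspace P" and "dim P = CARD('a)"
    and "neck_pos N_pos" and "neck_neg N_neg"
  shows "emeasure lebesgue (filled_join N_pos N_neg)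
           \<ge> emeasure lebesgue (filled_join (H_pos \<inter> P) (H_neg \<inter> porthogonal P))"
proof -
  obtain F \<kappa>\<^sub>1 where F: "0 \<le> \<kappa>\<^sub>1" "\<kappa>\<^sub>1 < 1" "short_cone \<kappa>\<^sub>1 F"
    and N_pos: "N_pos = (\<lambda>p. (p, F p)) ` {p. cone_length F p = 1}"
    using neck_pos_graph[OF assms(3)] .
  obtain G \<kappa>\<^sub>2 where G: "0 \<le> \<kappa>\<^sub>2" "\<kappa>\<^sub>2 < 1" "short_cone \<kappa>\<^sub>2 G"
    and N_neg: "N_neg = (\<lambda>q. (G q, q)) ` {q. cone_length G q = 1}"
    using neck_neg_graph[OF assms(4)] .
  have FG: "neck_graphs F G (max \<kappa>\<^sub>1 \<kappa>\<^sub>2)"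
    using F G short_cone_mono[OF F(3) max.cobounded1] short_cone_mono[OF G(3) max.cobounded2]
    by (simp add: neck_graphs_def)
  obtain A B \<kappa>\<^sub>0 where AB: "neck_graphs A B \<kappa>\<^sub>0" "\<forall>p q. p \<bullet> B q = q \<bullet> A p"
    and flat: "H_pos \<inter> P = (\<lambda>p. (p, A p)) ` {p. cone_length A p = 1}"
      "H_neg \<inter> porthogonal P = (\<lambda>q. (B q, q)) ` {q. cone_length B q = 1}"
    by (rule flat_necks[OF assms(1,2)])
  have "emeasure lebesgue (filled_join (H_pos \<inter> P) (H_neg \<inter> porthogonal P))
      = emeasure (neck_graphs.length_measure A B) {z. fst z + snd z \<le> 1}"
    unfolding flat neck_graphs.filled_join_necks[OF AB(1)] by (rule neck_graphs.emeasure_shear_body[OF AB(1)])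
  also have "\<dots> \<le> emeasure (neck_graphs.length_measure F G) {z. fst z + snd z \<le> 1}"
    by (rule volume_comparison[OF FG AB(1) AB(2)[rule_format]])
  also have "\<dots> = emeasure lebesgue (filled_join N_pos N_neg)"
    unfolding N_pos N_neg neck_graphs.filled_join_necks[OF FG]
    by (rule neck_graphs.emeasure_shear_body[OF FG, symmetric])
  finally show ?thesis .
qed

end
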